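(* Let $\phi:N^{n-1}\to\mathbb{CP}^{n-1}$ be a minimal Lagrangian immersion of a simply connected manifold $N$, and $\tilde\phi:N\to\mathbb{S}^{2n-1}$ the horizontal lift of $\phi$ with respect to the Hopf fibration $\mathbb{S}^{2n-1}\to\mathbb{CP}^{n-1}$. (a) Given a solution $r(s)$, $s\in\mathbb{R}$, of $$r''\sin r\cos r=(1-(r')^2)(n\cos^2r-\sin^2r),\quad r(0)=\rho,\ r'(0)=0\quad(\rho\in\mathbb{R}^+),$$ the map $\Phi:\mathbb{R}\times N\to\mathbb{CP}^n$ defined by $$\Phi(s,x)=\left[\left(\sin r(s)\,e^{-i\int_0^s\frac{dt}{\sin^{n+1}r(t)}}\,\tilde\phi(x),\ \cos r(s)\,e^{i\int_0^s\frac{\tan^2r(t)\,dt}{\sin^{n+1}r(t)}}\right)\right]$$ is a minimal Lagrangian immersion in $\mathbb{CP}^n$. (b) The map $\Phi:(0,\frac{\pi}{2})\times N\to\mathbb{CP}^n$, $(s,x)\mapsto[(\sin s\,\tilde\phi(x),\cos s)]$, is a minimal Lagrangian immersion in $\mathbb{CP}^n$. (c) Let $\gamma=(\gamma_1,\gamma_2):I\to\mathbb{S}^3$ be a Legendre curve. The map $\Phi:I\times N\to\mathbb{CP}^n$ defined by $$\Phi(s,x)=[(\gamma_1(s)\tilde\phi(x),\gamma_2(s))]$$ is a minimal Lagrangian immersion if and only if $\Phi$ is congruent to some of the examples given in (a) and (b).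
   Context: $\mathbb{CP}^m=\mathbb{S}^{2m+1}/\mathbb{S}^1$, with Hopf fibration $z\mapsto[z]$ and the Fubini–Study metric of constant holomorphic sectional curvature $4$. An immersion of an $m$-manifold in $\mathbb{CP}^m$ is Lagrangian if the Kähler two-form pulls back to $0$, and minimal if its mean curvature vanishes. A Lagrangian immersion of a simply connected manifold in $\mathbb{CP}^m$ has a horizontal lift to $\mathbb{S}^{2m+1}$, i.e. a lift whose differential takes values orthogonal to the fibres of the Hopf fibration; it is unique up to isometries. A Legendre curve in $\mathbb{S}^3\subset\mathbb{C}^2$ is a regular curve $\gamma$ on an interval $I$ that is horizontal for the Hopf fibration, i.e. $\gamma_1'\bar\gamma_1+\gamma_2'\bar\gamma_2=0$. Congruent means equal up to a holomorphic isometry of $\mathbb{CP}^n$. $N^{n-1}$ means that $N$ has dimension $n-1$.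
   Formalization: In (a) both phase integrals carry the factor cos ρ sin^n ρ, without which (a) fails unless tan²ρ = n; in (c) example (b) is taken on (0,π) instead of (0,π/2) when γ_2 has a zero, and congruence allows a regular change of parameter and restriction to a subinterval. *)

theory Defs
  imports "HOL-Analysis.Analysis"
begin

section \<open>Smooth maps and smooth manifolds\<close>

abbreviation D :: "('a::real_normed_vector \<Rightarrow> 'b::real_normed_vector) \<Rightarrow> 'a \<Rightarrow> 'a \<Rightarrow> 'b"
  where "D f x \<equiv> frechet_derivative f (at x)"

text \<open>The next two notions are meant for open sets only.\<close>

primrec Ck_on :: "nat \<Rightarrow> 'a::real_normed_vector set \<Rightarrow> ('a \<Rightarrow> 'b::real_normed_vector) \<Rightarrow> bool" where
  "Ck_on 0 S f \<longleftrightarrow> continuous_on S f"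
| "Ck_on (Suc k) S f \<longleftrightarrow>
     (\<forall>x\<in>S. f differentiable (at x)) \<and> (\<forall>v. Ck_on k S (\<lambda>x. D f x v))"

definition smooth_on :: "'a::real_normed_vector set \<Rightarrow> ('a \<Rightarrow> 'b::real_normed_vector) \<Rightarrow> bool"
  where "smooth_on S f \<longleftrightarrow> (\<forall>k. Ck_on k S f)"

type_synonym ('p, 'e) atlas = "('p set \<times> ('p \<Rightarrow> 'e)) set"

text \<open>A smooth manifold without boundary is a whole type, Hausdorff and second countable by
  its type class, together with a smooth atlas. A chart is a pair of its domain and its map.\<close>

definition smooth_atlas ::
    "('p::{t2_space, second_countable_topology}, 'e::euclidean_space) atlas \<Rightarrow> bool"
  where "smooth_atlas \<A> \<longleftrightarrow>
     (\<Union>(U, c)\<in>\<A>. U) = UNIV \<and>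
     (\<forall>(U, c)\<in>\<A>. open U \<and> open (c ` U) \<and> homeomorphism U (c ` U) c (inv_into U c)) \<and>
     (\<forall>(U, c)\<in>\<A>. \<forall>(V, d)\<in>\<A>. smooth_on (c ` (U \<inter> V)) (d \<circ> inv_into U c))"

text \<open>The product of an open subset of the line with a manifold.\<close>

definition prod_atlas :: "real set \<Rightarrow> ('p, 'e) atlas \<Rightarrow> (real \<times> 'p, real \<times> 'e) atlas"
  where "prod_atlas I \<A> = (\<lambda>(U, c). (I \<times> U, map_prod id c)) ` \<A>"

section \<open>Riemannian geometry in coordinates\<close>

text \<open>A metric on an open subset of \<open>'f\<close> is a function \<open>G\<close>, where \<open>G w u v\<close> is
  the scalar product at the point \<open>w\<close> of the tangent vectors \<open>u\<close> and \<open>v\<close>.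
  The Christoffel symbols of its Levi-Civita connection are given by the Koszul formula for
  constant vector fields.\<close>

definition christoffel ::
    "('f::real_normed_vector \<Rightarrow> 'f \<Rightarrow> 'f \<Rightarrow> real) \<Rightarrow> 'f \<Rightarrow> 'f \<Rightarrow> 'f \<Rightarrow> 'f"
  where "christoffel G w u v = (THE a. \<forall>z. 2 * G w a z =
     D (\<lambda>x. G x v z) w u + D (\<lambda>x. G x u z) w v - D (\<lambda>x. G x u v) w z)"

text \<open>The covariant derivative, along a map \<open>h\<close> between coordinate spaces, of the vector
  field \<open>dh(v)\<close> in the direction \<open>u\<close>. The normal part of it is the second
  fundamental form of \<open>h\<close> at \<open>(u, v)\<close>; the tangential correction by the
  Levi-Civita connection of the induced metric does not affect the normal part.\<close>

definition cov_deriv ::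
    "('f::real_normed_vector \<Rightarrow> 'f \<Rightarrow> 'f \<Rightarrow> real) \<Rightarrow> ('e::real_normed_vector \<Rightarrow> 'f) \<Rightarrow> 'e \<Rightarrow> 'e \<Rightarrow> 'e \<Rightarrow> 'f"
  where "cov_deriv G h x u v =
     D (\<lambda>y. D h y v) x u + christoffel G (h x) (D h x u) (D h x v)"

definition normal_part ::
    "('f::real_normed_vector \<Rightarrow> 'f \<Rightarrow> 'f \<Rightarrow> real) \<Rightarrow> ('e::real_normed_vector \<Rightarrow> 'f) \<Rightarrow> 'e \<Rightarrow> 'f \<Rightarrow> 'f"
  where "normal_part G h x a =
     a - (THE t. t \<in> range (D h x) \<and> (\<forall>v. G (h x) (a - t) (D h x v) = 0))"

definition second_fund_form ::
    "('f::real_normed_vector \<Rightarrow> 'f \<Rightarrow> 'f \<Rightarrow> real) \<Rightarrow> ('e::real_normed_vector \<Rightarrow> 'f) \<Rightarrow> 'e \<Rightarrow> 'e \<Rightarrow> 'e \<Rightarrow> 'f"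
  where "second_fund_form G h x u v = normal_part G h x (cov_deriv G h x u v)"

text \<open>The vector dual, with respect to the induced metric, to the covector given by the
  Euclidean product with \<open>b\<close>. For the standard basis vectors \<open>e\<^sub>i\<close> it is
  \<open>\<Sum>\<^sub>j g\<^sup>i\<^sup>j e\<^sub>j\<close>, where \<open>g\<^sup>i\<^sup>j\<close> is the inverse of the Gram matrix, so the sum
  in the definition after it is the trace with respect to the induced metric.\<close>

definition induced_sharp ::
    "('f::real_normed_vector \<Rightarrow> 'f \<Rightarrow> 'f \<Rightarrow> real) \<Rightarrow> ('e::euclidean_space \<Rightarrow> 'f) \<Rightarrow> 'e \<Rightarrow> 'e \<Rightarrow> 'e"
  where "induced_sharp G h x b = (THE a. \<forall>v. G (h x) (D h x a) (D h x v) = b \<bullet> v)"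

definition mean_curvature ::
    "('f::real_normed_vector \<Rightarrow> 'f \<Rightarrow> 'f \<Rightarrow> real) \<Rightarrow> ('e::euclidean_space \<Rightarrow> 'f) \<Rightarrow> 'e \<Rightarrow> 'f"
  where "mean_curvature G h x =
     (1 / DIM('e)) *\<^sub>R (\<Sum>b\<in>Basis. second_fund_form G h x b (induced_sharp G h x b))"

section \<open>Complex projective space\<close>

text \<open>A point of projective space is a fibre of the Hopf fibration of the unit sphere.\<close>

definition hopf :: "complex^'k \<Rightarrow> (complex^'k) set"
  where "hopf z = {u *s z | u. cmod u = 1}"

definition CP :: "(complex^'k::finite) set set"
  where "CP = hopf ` sphere 0 1"

text \<open>Identification of \<open>\<complex>\<^sup>m \<times> \<complex>\<close> with \<open>\<complex>\<^sup>m\<^sup>+\<^sup>1\<close>; the index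
  \<open>None\<close> is the last coordinate.\<close>

definition join :: "complex^'m \<Rightarrow> complex \<Rightarrow> complex^('m option)"
  where "join v c = (\<chi> j. case j of None \<Rightarrow> c | Some i \<Rightarrow> v $ i)"

definition unitary :: "complex^'k^'k \<Rightarrow> bool"
  where "unitary A \<longleftrightarrow> (\<chi> i j. cnj (A $ j $ i)) ** A = mat 1"

text \<open>Affine coordinates \<open>w\<close> of the point with homogeneous coordinates \<open>(w, 1)\<close>
  with respect to the orthonormal basis formed by the columns of \<open>A\<close>. The first map is a
  local section of the Hopf fibration, the second one is the inverse of a holomorphic chart.
  With permutation matrices \<open>A\<close> one obtains the usual affine charts.\<close>

definition aff_section :: "complex^('m option)^('m option) \<Rightarrow> complex^'m \<Rightarrow> complex^('m::finite option)"
  where "aff_section A w = (1 / norm (A *v join w 1)) *\<^sub>R (A *v join w 1)"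

definition aff :: "complex^('m option)^('m option) \<Rightarrow> complex^'m \<Rightarrow> (complex^('m::finite option)) set"
  where "aff A w = hopf (aff_section A w)"

text \<open>The component orthogonal to the Hopf fibre, which is tangent to \<open>\<i> z\<close>, of a
  vector tangent to the sphere at \<open>z\<close>. The real inner product is the real part of the
  Hermitian one.\<close>

definition horizontal_part :: "complex^'k \<Rightarrow> complex^'k \<Rightarrow> complex^'k::finite"
  where "horizontal_part z v = v - (v \<bullet> (\<i> *s z)) *\<^sub>R (\<i> *s z)"

definition hor_diff :: "complex^('m option)^('m option) \<Rightarrow> complex^'m \<Rightarrow> complex^'m \<Rightarrow> complex^('m::finite option)"
  where "hor_diff A w u = horizontal_part (aff_section A w) (D (aff_section A) w u)"

text \<open>The Fubini-Study metric, i.e. the quotient metric for which the Hopf fibration of the unit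
  sphere is a Riemannian submersion (so that the holomorphic sectional curvature is 4), and its
  Kaehler form, both in the coordinates given by \<open>A\<close>.\<close>

definition fubini_study :: "complex^('m option)^('m option) \<Rightarrow> complex^'m \<Rightarrow> complex^'m \<Rightarrow> complex^'m::finite \<Rightarrow> real"
  where "fubini_study A w u v = hor_diff A w u \<bullet> hor_diff A w v"

definition kaehler_form :: "complex^('m option)^('m option) \<Rightarrow> complex^'m \<Rightarrow> complex^'m \<Rightarrow> complex^'m::finite \<Rightarrow> real"
  where "kaehler_form A w u v = fubini_study A w (\<i> *s u) v"

definition holomorphic_isometry ::
    "((complex^('m::finite option)) set \<Rightarrow> (complex^('m option)) set) \<Rightarrow> bool"
  where "holomorphic_isometry F \<longleftrightarrow> bij_betw F CP CP \<and>
     (\<forall>A B. unitary A \<and> unitary B \<longrightarrow>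
       (let V = {w. F (aff A w) \<in> range (aff B)}; h = inv (aff B) \<circ> F \<circ> aff A in
         open V \<and> smooth_on V h \<and>
         (\<forall>w\<in>V. \<forall>u v. D h w (\<i> *s u) = \<i> *s D h w u \<and>
            fubini_study B (h w) (D h w u) (D h w v) = fubini_study A w u v)))"

section \<open>Minimal Lagrangian immersions\<close>

text \<open>Domain and formula of the expression of a map \<open>f\<close> to projective space in a chart
  \<open>(U, c)\<close> of the source and the affine coordinates given by \<open>B\<close>.\<close>

definition coord_dom ::
    "('p \<Rightarrow> (complex^('m::finite option)) set) \<Rightarrow> 'p set \<Rightarrow> ('p \<Rightarrow> 'e) \<Rightarrow> complex^('m option)^('m option) \<Rightarrow> 'e set"
  where "coord_dom f U c B = {y \<in> c ` U. f (inv_into U c y) \<in> range (aff B)}"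

definition coord_rep ::
    "('p \<Rightarrow> (complex^('m::finite option)) set) \<Rightarrow> 'p set \<Rightarrow> ('p \<Rightarrow> 'e) \<Rightarrow> complex^('m option)^('m option) \<Rightarrow> 'e \<Rightarrow> complex^'m"
  where "coord_rep f U c B = inv (aff B) \<circ> f \<circ> inv_into U c"

definition smooth_to_CP ::
    "('p, 'e::euclidean_space) atlas \<Rightarrow> ('p \<Rightarrow> (complex^('m::finite option)) set) \<Rightarrow> bool"
  where "smooth_to_CP \<A> f \<longleftrightarrow>
     (\<forall>(U, c)\<in>\<A>. f ` U \<subseteq> CP \<and>
       (\<forall>B. unitary B \<longrightarrow>
         open (coord_dom f U c B) \<and> smooth_on (coord_dom f U c B) (coord_rep f U c B)))"

definition immersion_to_CP ::
    "('p, 'e::euclidean_space) atlas \<Rightarrow> ('p \<Rightarrow> (complex^('m::finite option)) set) \<Rightarrow> bool"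
  where "immersion_to_CP \<A> f \<longleftrightarrow> smooth_to_CP \<A> f \<and>
     (\<forall>(U, c)\<in>\<A>. \<forall>B. unitary B \<longrightarrow>
       (\<forall>y \<in> coord_dom f U c B. inj (D (coord_rep f U c B) y)))"

definition lagrangian ::
    "('p, 'e::euclidean_space) atlas \<Rightarrow> ('p \<Rightarrow> (complex^('m::finite option)) set) \<Rightarrow> bool"
  where "lagrangian \<A> f \<longleftrightarrow> DIM('e) = CARD('m) \<and>
     (\<forall>(U, c)\<in>\<A>. \<forall>B. unitary B \<longrightarrow>
       (\<forall>y \<in> coord_dom f U c B. \<forall>u v.
          kaehler_form B (coord_rep f U c B y)
            (D (coord_rep f U c B) y u) (D (coord_rep f U c B) y v) = 0))"

definition minimal ::
    "('p, 'e::euclidean_space) atlas \<Rightarrow> ('p \<Rightarrow> (complex^('m::finite option)) set) \<Rightarrow> bool"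
  where "minimal \<A> f \<longleftrightarrow>
     (\<forall>(U, c)\<in>\<A>. \<forall>B. unitary B \<longrightarrow>
       (\<forall>y \<in> coord_dom f U c B. mean_curvature (fubini_study B) (coord_rep f U c B) y = 0))"

definition minimal_lagrangian_immersion ::
    "('p, 'e::euclidean_space) atlas \<Rightarrow> ('p \<Rightarrow> (complex^('m::finite option)) set) \<Rightarrow> bool"
  where "minimal_lagrangian_immersion \<A> f \<longleftrightarrow>
     immersion_to_CP \<A> f \<and> lagrangian \<A> f \<and> minimal \<A> f"

definition horizontal_lift ::
    "('p, 'e::euclidean_space) atlas \<Rightarrow> ('p \<Rightarrow> (complex^'k::finite) set) \<Rightarrow> ('p \<Rightarrow> complex^'k) \<Rightarrow> bool"
  where "horizontal_lift \<A> \<phi> \<psi> \<longleftrightarrow>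
     (\<forall>x. norm (\<psi> x) = 1 \<and> hopf (\<psi> x) = \<phi> x) \<and>
     (\<forall>(U, c)\<in>\<A>. smooth_on (c ` U) (\<psi> \<circ> inv_into U c) \<and>
       (\<forall>y \<in> c ` U. \<forall>u. D (\<psi> \<circ> inv_into U c) y u \<bullet> (\<i> *s \<psi> (inv_into U c y)) = 0))"

section \<open>Legendre curves and the examples\<close>

definition legendre_curve :: "real set \<Rightarrow> (real \<Rightarrow> complex^2) \<Rightarrow> bool"
  where "legendre_curve I \<gamma> \<longleftrightarrow> smooth_on I \<gamma> \<and>
     (\<forall>s\<in>I. norm (\<gamma> s) = 1 \<and> vector_derivative \<gamma> (at s) \<noteq> 0 \<and>
        vector_derivative \<gamma> (at s) $ 1 * cnj (\<gamma> s $ 1) +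
        vector_derivative \<gamma> (at s) $ 2 * cnj (\<gamma> s $ 2) = 0)"

definition curve_map ::
    "(real \<Rightarrow> complex) \<Rightarrow> (real \<Rightarrow> complex) \<Rightarrow> ('p \<Rightarrow> complex^'k) \<Rightarrow> real \<times> 'p \<Rightarrow> (complex^('k option)) set"
  where "curve_map \<gamma>1 \<gamma>2 \<psi> = (\<lambda>(s, x). hopf (join (\<gamma>1 s *s \<psi> x) (\<gamma>2 s)))"

definition profile_solution :: "nat \<Rightarrow> real \<Rightarrow> (real \<Rightarrow> real) \<Rightarrow> bool"
  where "profile_solution n \<rho> r \<longleftrightarrow>
     (\<exists>r' r''. (\<forall>s. (r has_real_derivative r' s) (at s)) \<and>
        (\<forall>s. (r' has_real_derivative r'' s) (at s)) \<and>
        (\<forall>s. r'' s * sin (r s) * cos (r s) =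
              (1 - (r' s)\<^sup>2) * (real n * (cos (r s))\<^sup>2 - (sin (r s))\<^sup>2)) \<and>
        r 0 = \<rho> \<and> r' 0 = 0)"

text \<open>The equation has the first integral
  \<open>(1 - r'\<^sup>2) cos\<^sup>2 r sin\<^sup>2\<^sup>n r\<close>, with value \<open>\<kappa>\<^sup>2\<close> for the number \<open>\<kappa>\<close>
  below. The two phases carry the factor \<open>\<kappa>\<close>; it makes the curve parametrised by
  arc length. Without this factor the resulting map is still Lagrangian, but minimal only for the
  constant solutions, those with \<open>tan\<^sup>2 \<rho> = n\<close>.\<close>

definition first_integral_const :: "nat \<Rightarrow> real \<Rightarrow> real"
  where "first_integral_const n \<rho> = cos \<rho> * sin \<rho> ^ n"

definition example_a ::
    "nat \<Rightarrow> real \<Rightarrow> (real \<Rightarrow> real) \<Rightarrow> ('p \<Rightarrow> complex^'k) \<Rightarrow> real \<times> 'p \<Rightarrow> (complex^('k option)) set"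
  where "example_a n \<rho> r = curve_map
     (\<lambda>s. of_real (sin (r s)) *
        exp (- \<i> * of_real (first_integral_const n \<rho> *
          (LBINT t=0..ereal s. 1 / sin (r t) ^ (n + 1)))))
     (\<lambda>s. of_real (cos (r s)) *
        exp (\<i> * of_real (first_integral_const n \<rho> *
          (LBINT t=0..ereal s. (tan (r t))\<^sup>2 / sin (r t) ^ (n + 1)))))"

definition example_b :: "('p \<Rightarrow> complex^'k) \<Rightarrow> real \<times> 'p \<Rightarrow> (complex^('k option)) set"
  where "example_b = curve_map (\<lambda>s. of_real (sin s)) (\<lambda>s. of_real (cos s))"

text \<open>Congruence to an example on \<open>J \<times> N\<close>, or to the restriction of it to a
  subinterval, after a regular change of the parameter of the curve (the examples are
  parametrised by arc length, whereas a Legendre curve has an arbitrary parameter).\<close>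

definition congruent_on ::
    "real set \<Rightarrow> real set \<Rightarrow> (real \<times> 'p \<Rightarrow> (complex^('m::finite option)) set) \<Rightarrow>
     (real \<times> 'p \<Rightarrow> (complex^('m option)) set) \<Rightarrow> bool"
  where "congruent_on I J \<Phi> \<Psi> \<longleftrightarrow>
     (\<exists>F h. holomorphic_isometry F \<and> smooth_on I h \<and> (\<forall>s\<in>I. deriv h s \<noteq> 0) \<and> h ` I \<subseteq> J \<and>
        (\<forall>s\<in>I. \<forall>x. \<Phi> (s, x) = F (\<Psi> (h s, x))))"

text \<open>Interval on which the example \<open>[(sin s \<psi>, cos s)]\<close> is taken in the
  characterisation of the minimal immersions constructed from Legendre curves. If the curve
  crosses \<open>\<gamma>\<^sub>2 = 0\<close>, then the larger interval is needed: the curve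
  \<open>(sin s, cos s)\<close> on \<open>(0, \<pi>)\<close> also gives a minimal Lagrangian immersion.\<close>

definition interval_b :: "real set \<Rightarrow> (real \<Rightarrow> complex^2) \<Rightarrow> real set"
  where "interval_b I \<gamma> =
     (if \<forall>s\<in>I. \<gamma> s $ 2 \<noteq> 0 then {0<..<pi/2} else {0<..<pi})"

end

theory Submission
  imports Defs
begin

text \<open>
  In affine coordinates the Fubini-Study metric and its Christoffel symbols are explicit rational
  expressions. For a horizontal lift \<open>F\<close> of a map to projective space they give
  \<open>g(\<nabla>\<^sub>u h\<^sub>v, h\<^sub>w) = \<langle>F\<^sub>u\<^sub>v, F\<^sub>w\<rangle>\<close> with the Hermitian products on both sides, so all conditions on the
  immersion become conditions on \<open>F\<close>. For the lift \<open>(\<gamma>\<^sub>1 \<psi>, \<gamma>\<^sub>2)\<close> and minimal \<open>\<psi>\<close>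
  they reduce to \<open>\<gamma>\<^sub>1 \<noteq> 0\<close> and
  \<open>Im \<langle>\<gamma>'', \<gamma>'\<rangle> / \<bar>\<gamma>'\<bar>\<^sup>2 + d Im (\<gamma>\<^sub>1' cnj \<gamma>\<^sub>1) / \<bar>\<gamma>\<^sub>1\<bar>\<^sup>2 = 0\<close>, i.e. with
  \<open>\<gamma>' = \<lambda> (- cnj \<gamma>\<^sub>2, cnj \<gamma>\<^sub>1)\<close> the argument of \<open>\<lambda> \<gamma>\<^sub>1\<^sup>d\<close> is a constant \<open>arg c\<close>.
  Then \<open>K = Im (cnj c \<gamma>\<^sub>1\<^sup>d\<^sup>+\<^sup>1 \<gamma>\<^sub>2)\<close> is conserved and the square of the radius \<open>\<bar>\<gamma>\<^sub>1\<bar>\<close>, as a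
  function of arc length, moves in a potential well with strictly concave kinetic energy; hence it
  is part of a global solution with a turning point, which is the initial point of the profile
  \<open>r\<close> in (a). If \<open>K = 0\<close> both components have constant argument, and the curve is a great
  circle as in (b).

  Conversely, a congruence preserves the induced metric, that is \<open>\<bar>\<gamma>\<^sub>1\<bar>\<close> and \<open>\<bar>\<gamma>'\<bar>\<close>. These
  determine \<open>\<bar>Im (\<gamma>\<^sub>1' cnj \<gamma>\<^sub>1)\<bar>\<close>, and therefore the logarithmic derivatives of
  both components up to complex conjugation, under which the minimality condition is invariant.
\<close>

section \<open>Calculus of smooth maps\<close>

text \<open>The congruence in (c) is an arbitrary holomorphic isometry, and the proof does not
  identify such maps with unitary matrices. Mean curvature is therefore not transported through it:
  only the pulled-back metric is compared, and the curve is recovered from that up to a complex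
  conjugation. The other direction needs a profile on the whole line, while the force has a pole at
  radius 0. The force is truncated below a value that the energy forbids; the field becomes globally
  Lipschitz and the truncation is never met. Uniqueness is stated for curves of speed
  \<open>l\<close>, so a Legendre curve need not be reparametrised by arc length. A nonzero
  \<open>K\<close> keeps the squared radius \<open>x\<close> strictly between 0 and 1, where
  \<open>arcsin (sqrt x)\<close> is smooth. Two choices remain when a curve is matched with (a): the
  time of the turning point, and the orientation, which is fixed by the sign of
  \<open>K\<close>.\<close>

lemma D_eq: "(f has_derivative f') (at x) \<Longrightarrow> D f x = f'"
  by (metis frechet_derivative_at)

lemma D_works: "f differentiable (at x) \<Longrightarrow> (f has_derivative D f x) (at x)"
  by (simp add: frechet_derivative_works)

lemma D_cong:
  assumes "open S" "x \<in> S" "\<And>y. y \<in> S \<Longrightarrow> f y = g y"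
  shows "D f x = D g x"
proof -
  have "(f has_derivative f') (at x) \<longleftrightarrow> (g has_derivative f') (at x)" for f'
    using assms has_derivative_transform_within_open[of f f' x UNIV S g]
      has_derivative_transform_within_open[of g f' x UNIV S f] by auto
  then show ?thesis by (simp add: frechet_derivative_def)
qed

lemma Ck_on_subset: "Ck_on k T f \<Longrightarrow> S \<subseteq> T \<Longrightarrow> Ck_on k S f"
  by (induction k arbitrary: f) (auto intro: continuous_on_subset)

text \<open>On an open set the derivative at a point depends only on values inside the set, so the
  induction passes from \<open>f\<close> and \<open>g\<close> to their directional
  derivatives.\<close>

lemma Ck_on_cong:
  assumes "open S" "\<And>x. x \<in> S \<Longrightarrow> f x = g x"
  shows "Ck_on k S f \<longleftrightarrow> Ck_on k S g"
  using assms(2)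
proof (induction k arbitrary: f g)
  case 0
  then show ?case by (simp cong: continuous_on_cong)
next
  case (Suc k)
  have "f differentiable at x \<longleftrightarrow> g differentiable at x" if "x \<in> S" for x
    using Suc.prems assms(1) that has_derivative_transform_within_open[of f _ x UNIV S g]
      has_derivative_transform_within_open[of g _ x UNIV S f]
    unfolding differentiable_def by auto
  moreover have "Ck_on k S (\<lambda>x. D f x v) \<longleftrightarrow> Ck_on k S (\<lambda>x. D g x v)" for v
    by (rule Suc.IH) (simp add: D_cong[OF assms(1) _ Suc.prems])
  ultimately show ?case by simp
qed

lemma Ck_on_SucI:
  assumes "open S" "\<And>x. x \<in> S \<Longrightarrow> (f has_derivative f' x) (at x)"
    and "\<And>v. Ck_on k S (\<lambda>x. f' x v)"
  shows "Ck_on (Suc k) S f"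
proof -
  have "Ck_on k S (\<lambda>x. D f x v)" for v
    using assms(3)[of v] by (subst Ck_on_cong[OF assms(1)]) (auto simp: D_eq[OF assms(2)])
  then show ?thesis using assms(2) by (auto simp: differentiable_def)
qed

lemma Ck_on_Suc_D: "Ck_on (Suc k) S f \<Longrightarrow> Ck_on k S f"
proof (induction k arbitrary: f)
  case 0
  then show ?case
    by (auto intro!: continuous_at_imp_continuous_on differentiable_imp_continuous_within)
next
  case (Suc k)
  then show ?case by (simp only: Ck_on.simps) blast
qed

lemma Ck_on_const: "Ck_on k S (\<lambda>x. c)"
  by (induction k arbitrary: c) auto

lemma Ck_on_bounded_linear:
  assumes "open S" "bounded_linear f"
  shows "Ck_on k S f"
proof (cases k)
  case 0
  then show ?thesis using assms(2) by (simp add: linear_continuous_on)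
next
  case (Suc k')
  show ?thesis unfolding Suc
    by (rule Ck_on_SucI[OF assms(1), where f' = "\<lambda>x. f"])
      (use assms(2) in \<open>auto simp: bounded_linear_imp_has_derivative Ck_on_const\<close>)
qed

lemma Ck_on_add:
  assumes "open S" "Ck_on k S f" "Ck_on k S g"
  shows "Ck_on k S (\<lambda>x. f x + g x)"
  using assms(2,3)
proof (induction k arbitrary: f g)
  case (Suc k)
  show ?case
  proof (rule Ck_on_SucI[OF assms(1)])
    show "((\<lambda>x. f x + g x) has_derivative (\<lambda>v. D f x v + D g x v)) (at x)" if "x \<in> S" for x
      using Suc.prems that by (intro has_derivative_add D_works) auto
  qed (use Suc in auto)
qed (simp add: continuous_on_add)

lemma Ck_on_sum:
  assumes "open S" "\<And>i. i \<in> I \<Longrightarrow> Ck_on k S (f i)"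
  shows "Ck_on k S (\<lambda>x. \<Sum>i\<in>I. f i x)"
  using assms(2)
  by (induction I rule: infinite_finite_induct)
    (auto simp: Ck_on_const Ck_on_add[OF assms(1)])

lemma Ck_on_bilinear:
  assumes "bounded_bilinear p" "open S" "Ck_on k S f" "Ck_on k S g"
  shows "Ck_on k S (\<lambda>x. p (f x) (g x))"
  using assms(3,4)
proof (induction k arbitrary: f g)
  case 0
  then show ?case by (simp add: bounded_bilinear.continuous_on[OF assms(1)])
next
  case (Suc k)
  show ?case
  proof (rule Ck_on_SucI[OF assms(2)])
    show "((\<lambda>x. p (f x) (g x)) has_derivative (\<lambda>v. p (f x) (D g x v) + p (D f x v) (g x))) (at x)"
      if "x \<in> S" for x
      using Suc.prems that by (intro bounded_bilinear.FDERIV[OF assms(1)] D_works) auto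
    show "Ck_on k S (\<lambda>x. p (f x) (D g x v) + p (D f x v) (g x))" for v
      by (intro Ck_on_add[OF assms(2)] Suc.IH)
        (use Suc.prems Ck_on_Suc_D in auto)
  qed
qed

text \<open>In the chain rule the outer derivative is taken in the varying direction
  \<open>D f x v\<close>, which the induction hypothesis does not cover. Expanding this direction in
  the basis of the Euclidean space in the middle leaves derivatives of \<open>g\<close> in fixed
  directions.\<close>

lemma Ck_on_compose:
  fixes f :: "'a::real_normed_vector \<Rightarrow> 'b::euclidean_space"
    and g :: "'b \<Rightarrow> 'c::real_normed_vector"
  assumes "open S" "Ck_on k S f" "Ck_on k T g" "f ` S \<subseteq> T"
  shows "Ck_on k S (\<lambda>x. g (f x))"
  using assms(2,3)
proof (induction k arbitrary: g)
  case 0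
  then show ?case using assms(4) by (auto intro: continuous_on_compose2)
next
  case (Suc k)
  have f: "f differentiable at x" and g: "g differentiable at (f x)" if "x \<in> S" for x
    using Suc.prems assms(4) that by auto
  have dg: "D g (f x) u = (\<Sum>b\<in>Basis. (u \<bullet> b) *\<^sub>R D g (f x) b)" if "x \<in> S" for x u
  proof -
    have l: "linear (D g (f x))" using g[OF that] by (rule linear_frechet_derivative)
    have "D g (f x) u = D g (f x) (\<Sum>b\<in>Basis. (u \<bullet> b) *\<^sub>R b)" by (simp add: euclidean_representation)
    also have "\<dots> = (\<Sum>b\<in>Basis. (u \<bullet> b) *\<^sub>R D g (f x) b)"
      by (simp add: linear_sum[OF l] linear_scale[OF l])
    finally show ?thesis .
  qed
  show ?case
  proof (rule Ck_on_SucI[OF assms(1)])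
    show "((\<lambda>x. g (f x)) has_derivative
        (\<lambda>v. \<Sum>b\<in>Basis. (D f x v \<bullet> b) *\<^sub>R D g (f x) b)) (at x)" if "x \<in> S" for x
    proof -
      have "(\<lambda>v. D g (f x) (D f x v)) = (\<lambda>v. \<Sum>b\<in>Basis. (D f x v \<bullet> b) *\<^sub>R D g (f x) b)"
        by (rule ext) (rule dg[OF that])
      with has_derivative_compose[OF D_works[OF f[OF that]] D_works[OF g[OF that]]]
      show ?thesis by metis
    qed
    show "Ck_on k S (\<lambda>x. \<Sum>b\<in>Basis. (D f x v \<bullet> b) *\<^sub>R D g (f x) b)" for v
    proof (intro Ck_on_sum[OF assms(1)] Ck_on_bilinear[OF bounded_bilinear_scaleR assms(1)])
      show "Ck_on k S (\<lambda>x. D f x v \<bullet> b)" for b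
        by (rule Ck_on_bilinear[OF bounded_bilinear_inner assms(1)])
          (use Suc.prems in \<open>auto simp: Ck_on_const\<close>)
      show "Ck_on k S (\<lambda>x. D g (f x) b)" for b
        by (rule Suc.IH) (use Suc.prems Ck_on_Suc_D in auto)
    qed
  qed
qed

lemma Ck_on_Pair:
  assumes "open S" "Ck_on k S f" "Ck_on k S g"
  shows "Ck_on k S (\<lambda>x. (f x, g x))"
  using assms(2,3)
proof (induction k arbitrary: f g)
  case (Suc k)
  show ?case
  proof (rule Ck_on_SucI[OF assms(1)])
    show "((\<lambda>x. (f x, g x)) has_derivative (\<lambda>v. (D f x v, D g x v))) (at x)" if "x \<in> S" for x
      using Suc.prems that by (intro has_derivative_Pair D_works) auto
  qed (use Suc in auto)
qed (simp add: continuous_on_Pair)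

lemma Ck_on_inverse:
  fixes S :: "'a::real_normed_field set"
  assumes "open S" "0 \<notin> S"
  shows "Ck_on k S inverse"
proof (induction k)
  case 0
  then show ?case using assms by (auto intro!: continuous_intros)
next
  case (Suc k)
  show ?case
  proof (rule Ck_on_SucI[OF assms(1)])
    show "(inverse has_derivative (\<lambda>v. - (inverse x * v * inverse x))) (at x)" if "x \<in> S" for x
      using that assms by (intro has_derivative_inverse') auto
    show "Ck_on k S (\<lambda>x. - (inverse x * v * inverse x))" for v
      using Ck_on_bilinear[OF bounded_bilinear_mult assms(1)
          Ck_on_bilinear[OF bounded_bilinear_mult assms(1) Suc Ck_on_const[where c = "- v"]] Suc]
      by simp
  qed
qed

lemma smooth_onI: "(\<And>k. Ck_on k S f) \<Longrightarrow> smooth_on S f"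
  by (simp add: smooth_on_def)

lemma smooth_on_D: "smooth_on S f \<Longrightarrow> smooth_on S (\<lambda>x. D f x v)"
  unfolding smooth_on_def by (metis Ck_on.simps(2))

lemma smooth_on_differentiable: "smooth_on S f \<Longrightarrow> x \<in> S \<Longrightarrow> f differentiable (at x)"
  unfolding smooth_on_def by (metis Ck_on.simps(2))

lemma smooth_on_has_derivative:
  "smooth_on S f \<Longrightarrow> x \<in> S \<Longrightarrow> (f has_derivative D f x) (at x)"
  by (simp add: D_works smooth_on_differentiable)

lemma smooth_on_continuous: "smooth_on S f \<Longrightarrow> continuous_on S f"
  unfolding smooth_on_def by (metis Ck_on.simps(1))

lemma smooth_on_subset: "smooth_on T f \<Longrightarrow> S \<subseteq> T \<Longrightarrow> smooth_on S f"
  by (auto simp: smooth_on_def intro: Ck_on_subset)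

lemma smooth_on_cong:
  "open S \<Longrightarrow> (\<And>x. x \<in> S \<Longrightarrow> f x = g x) \<Longrightarrow> smooth_on S f \<longleftrightarrow> smooth_on S g"
  by (simp add: smooth_on_def Ck_on_cong[of S f g])

lemma smooth_on_derivative:
  assumes "open S" "\<And>x. x \<in> S \<Longrightarrow> (f has_derivative f' x) (at x)"
    and "\<And>v. smooth_on S (\<lambda>x. f' x v)"
  shows "smooth_on S f"
proof (rule smooth_onI)
  show "Ck_on k S f" for k
    by (rule Ck_on_Suc_D, rule Ck_on_SucI[OF assms(1,2)])
      (use assms(3) in \<open>auto simp: smooth_on_def\<close>)
qed

lemma smooth_on_const: "smooth_on S (\<lambda>x. c)"
  by (simp add: smooth_on_def Ck_on_const)

lemma smooth_on_bounded_linear: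
  "open S \<Longrightarrow> bounded_linear f \<Longrightarrow> smooth_on S f"
  by (simp add: smooth_on_def Ck_on_bounded_linear)

lemma smooth_on_add:
  "open S \<Longrightarrow> smooth_on S f \<Longrightarrow> smooth_on S g \<Longrightarrow> smooth_on S (\<lambda>x. f x + g x)"
  by (simp add: smooth_on_def Ck_on_add)

lemma smooth_on_bilinear:
  "bounded_bilinear p \<Longrightarrow> open S \<Longrightarrow> smooth_on S f \<Longrightarrow> smooth_on S g \<Longrightarrow>
    smooth_on S (\<lambda>x. p (f x) (g x))"
  by (simp add: smooth_on_def Ck_on_bilinear)

lemmas smooth_on_mult = smooth_on_bilinear[OF bounded_bilinear_mult]
lemmas smooth_on_scaleR = smooth_on_bilinear[OF bounded_bilinear_scaleR]

lemma smooth_on_power: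
  fixes f :: "'a::real_normed_vector \<Rightarrow> 'b::real_normed_field"
  shows "open S \<Longrightarrow> smooth_on S f \<Longrightarrow> smooth_on S (\<lambda>x. f x ^ m)"
  by (induction m) (auto intro: smooth_on_const smooth_on_mult)

lemma smooth_on_compose:
  fixes f :: "'a::real_normed_vector \<Rightarrow> 'b::euclidean_space"
    and g :: "'b \<Rightarrow> 'c::real_normed_vector"
  shows "open S \<Longrightarrow> smooth_on T g \<Longrightarrow> smooth_on S f \<Longrightarrow> f ` S \<subseteq> T \<Longrightarrow>
    smooth_on S (\<lambda>x. g (f x))"
  unfolding smooth_on_def by (blast intro: Ck_on_compose)

lemma smooth_on_linear_compose:
  fixes f :: "'a::real_normed_vector \<Rightarrow> 'b::euclidean_space"
  shows "bounded_linear g \<Longrightarrow> open S \<Longrightarrow> smooth_on S f \<Longrightarrow> smooth_on S (\<lambda>x. g (f x))"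
  by (rule smooth_on_compose[of _ UNIV]) (auto intro: smooth_on_bounded_linear)

lemma smooth_on_minus:
  fixes f :: "'a::real_normed_vector \<Rightarrow> 'b::euclidean_space"
  shows "open S \<Longrightarrow> smooth_on S f \<Longrightarrow> smooth_on S (\<lambda>x. - f x)"
  by (rule smooth_on_linear_compose[OF bounded_linear_minus[OF bounded_linear_ident]])

lemma smooth_on_diff:
  fixes f g :: "'a::real_normed_vector \<Rightarrow> 'b::euclidean_space"
  shows "open S \<Longrightarrow> smooth_on S f \<Longrightarrow> smooth_on S g \<Longrightarrow> smooth_on S (\<lambda>x. f x - g x)"
  using smooth_on_add[of S f "\<lambda>x. - g x"] smooth_on_minus by auto

lemma smooth_on_inverse:
  fixes f :: "'a::real_normed_vector \<Rightarrow> 'b::{euclidean_space,real_normed_field}"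
  assumes "open S" "smooth_on S f" "\<And>x. x \<in> S \<Longrightarrow> f x \<noteq> 0"
  shows "smooth_on S (\<lambda>x. inverse (f x))"
  by (rule smooth_on_compose[of _ "- {0}"])
    (use assms in \<open>auto intro!: smooth_onI Ck_on_inverse\<close>)

lemma smooth_on_divide:
  fixes f :: "'a::real_normed_vector \<Rightarrow> 'b::{euclidean_space,real_normed_field}"
  assumes "open S" "smooth_on S f" "smooth_on S g" "\<And>x. x \<in> S \<Longrightarrow> g x \<noteq> 0"
  shows "smooth_on S (\<lambda>x. f x / g x)"
  using smooth_on_mult[OF assms(1,2) smooth_on_inverse[OF assms(1,3,4)]]
  by (simp add: divide_inverse)

lemma smooth_on_Pair:
  "open S \<Longrightarrow> smooth_on S f \<Longrightarrow> smooth_on S g \<Longrightarrow> smooth_on S (\<lambda>x. (f x, g x))"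
  by (simp add: smooth_on_def Ck_on_Pair)

lemma smooth_on_exp:
  fixes f :: "'a::real_normed_vector \<Rightarrow> 'b::{euclidean_space,real_normed_field,banach}"
  assumes "open S" "smooth_on S f"
  shows "smooth_on S (\<lambda>x. exp (f x))"
proof -
  have "Ck_on k UNIV (exp :: 'b \<Rightarrow> 'b)" for k
  proof (induction k)
    case (Suc k)
    show ?case
      by (rule Ck_on_SucI[where f' = "\<lambda>x v. v * exp x"])
        (auto intro!: derivative_eq_intros Ck_on_bilinear[OF bounded_bilinear_mult] Ck_on_const Suc)
  qed (auto intro!: continuous_intros)
  then show ?thesis
    using assms smooth_on_compose[of S UNIV exp f] by (auto simp: smooth_on_def)
qed

lemma smooth_on_sin_cos:
  fixes f :: "'a::real_normed_vector \<Rightarrow> real"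
  assumes "open S" "smooth_on S f"
  shows "smooth_on S (\<lambda>x. sin (f x))" "smooth_on S (\<lambda>x. cos (f x))"
proof -
  \<comment> \<open>Simultaneous induction, as each of the two functions is the derivative of the
    other up to sign.\<close>
  have "Ck_on k UNIV (sin :: real \<Rightarrow> real) \<and> Ck_on k UNIV (cos :: real \<Rightarrow> real)" for k
  proof (induction k)
    case (Suc k)
    have "Ck_on (Suc k) UNIV (sin :: real \<Rightarrow> real)"
    proof (rule Ck_on_SucI[where f' = "\<lambda>x v. cos x * v"])
      show "Ck_on k UNIV (\<lambda>x. cos x * v)" for v :: real
        using Suc by (intro Ck_on_bilinear[OF bounded_bilinear_mult] Ck_on_const) auto
    qed (auto intro!: derivative_eq_intros)
    moreover have "Ck_on (Suc k) UNIV (cos :: real \<Rightarrow> real)"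
    proof (rule Ck_on_SucI[where f' = "\<lambda>x v. sin x * (- v)"])
      show "Ck_on k UNIV (\<lambda>x. sin x * (- v))" for v :: real
        using Suc by (intro Ck_on_bilinear[OF bounded_bilinear_mult] Ck_on_const) auto
    qed (auto intro!: derivative_eq_intros)
    ultimately show ?case by blast
  qed (auto intro!: continuous_intros)
  then show "smooth_on S (\<lambda>x. sin (f x))" "smooth_on S (\<lambda>x. cos (f x))"
    using assms smooth_on_compose[of S UNIV sin f] smooth_on_compose[of S UNIV cos f]
    by (auto simp: smooth_on_def)
qed

lemma smooth_on_powr:
  fixes f :: "'a::real_normed_vector \<Rightarrow> real"
  assumes "open S" "smooth_on S f" "\<And>x. x \<in> S \<Longrightarrow> f x > 0"
  shows "smooth_on S (\<lambda>x. f x powr a)"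
proof -
  have "Ck_on k {0<..} (\<lambda>x::real. x powr a)" for k
  proof (induction k arbitrary: a)
    case (Suc k)
    show ?case
    proof (rule Ck_on_SucI[where f' = "\<lambda>x v. (v * a) * x powr (a - 1)"])
      show "((\<lambda>x. x powr a) has_derivative (\<lambda>v. v * a * x powr (a - 1))) (at x)"
        if "x \<in> {0<..}" for x
        using that has_real_derivative_powr[of x a]
        by (auto simp: has_field_derivative_def mult_ac elim!: has_derivative_eq_rhs)
      show "Ck_on k {0<..} (\<lambda>x. v * a * x powr (a - 1))" for v
        by (intro Ck_on_bilinear[OF bounded_bilinear_mult] Ck_on_const Suc) auto
    qed auto
  qed (auto intro!: continuous_intros)
  then show ?thesis
    using assms smooth_on_compose[of S "{0<..}" "\<lambda>x. x powr a" f] by (auto simp: smooth_on_def)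
qed

lemma smooth_on_sqrt:
  fixes f :: "'a::real_normed_vector \<Rightarrow> real"
  assumes "open S" "smooth_on S f" "\<And>x. x \<in> S \<Longrightarrow> f x > 0"
  shows "smooth_on S (\<lambda>x. sqrt (f x))"
  using smooth_on_powr[OF assms, of "1/2"]
  by (subst smooth_on_cong[OF assms(1), where g = "\<lambda>x. f x powr (1/2)"])
    (use assms(3) in \<open>auto simp: powr_half_sqrt less_imp_le\<close>)

text \<open>A vector is the sum of the images of its coordinates under the linear embeddings
  \<open>axis i\<close>.\<close>

lemma smooth_on_vec:
  fixes f :: "'a::real_normed_vector \<Rightarrow> 'b::euclidean_space ^ 'k"
  assumes "open S" "\<And>i. smooth_on S (\<lambda>x. f x $ i)"
  shows "smooth_on S f"
proof -
  have "smooth_on S (\<lambda>x. \<Sum>i\<in>UNIV. axis i (f x $ i))"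
    unfolding smooth_on_def
  proof (intro allI Ck_on_sum[OF assms(1)])
    fix k i
    have "bounded_linear (axis i :: 'b \<Rightarrow> 'b^'k)"
      by (intro linear_conv_bounded_linear[THEN iffD1] linearI) (auto simp: vec_eq_iff axis_def)
    from smooth_on_linear_compose[OF this assms] show "Ck_on k S (\<lambda>x. axis i (f x $ i))"
      by (auto simp: smooth_on_def)
  qed
  moreover have "(\<Sum>i\<in>UNIV. axis i (f x $ i)) = f x" for x
    by (simp add: vec_eq_iff axis_def if_distrib cong: if_cong)
  ultimately show ?thesis by simp
qed

lemma smooth_on_real_curve:
  fixes f :: "real \<Rightarrow> 'b::real_normed_vector"
  assumes "open S" "\<And>x. x \<in> S \<Longrightarrow> (f has_vector_derivative f' x) (at x)" "smooth_on S f'"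
  shows "smooth_on S f"
  by (rule smooth_on_derivative[OF assms(1), where f' = "\<lambda>x v. v *\<^sub>R f' x"])
    (use assms in \<open>auto simp: has_vector_derivative_def intro: smooth_on_scaleR smooth_on_const\<close>)

section \<open>The Hermitian product and the unitary group\<close>

text \<open>Conjugate-linear in the second argument. The real part is the Euclidean product and the
  imaginary part is the product with \<open>\<i> *s y\<close>, so a single complex equation carries
  both metric and symplectic information.\<close>

definition herm :: "complex^'k::finite \<Rightarrow> complex^'k \<Rightarrow> complex"
  where "herm x y = (\<Sum>i\<in>UNIV. x $ i * cnj (y $ i))"

lemma scaleR_eq_smult: "c *\<^sub>R x = complex_of_real c *s (x :: complex^'k)"
  by (simp add: vec_eq_iff scaleR_conv_of_real[where 'a = complex])

lemma herm_add_left: "herm (x + y) z = herm x z + herm y z"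
  and herm_add_right: "herm x (y + z) = herm x y + herm x z"
  and herm_diff_left: "herm (x - y) z = herm x z - herm y z"
  and herm_diff_right: "herm x (y - z) = herm x y - herm x z"
  and herm_minus_left: "herm (- x) z = - herm x z"
  and herm_minus_right: "herm x (- z) = - herm x z"
  and herm_smult_left: "herm (c *s x) z = c * herm x z"
  and herm_smult_right: "herm x (c *s z) = cnj c * herm x z"
  and herm_scaleR_left: "herm (r *\<^sub>R x) z = of_real r * herm x z"
  and herm_scaleR_right: "herm x (r *\<^sub>R z) = of_real r * herm x z"
  and herm_zero_left: "herm 0 x = 0"
  and herm_zero_right: "herm x 0 = 0"
  by (simp_all add: herm_def algebra_simps sum.distrib sum_subtractf sum_negf sum_distrib_left
      scaleR_conv_of_real[where 'a = complex])

lemmas herm_simps = herm_add_left herm_add_right herm_diff_left herm_diff_right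
  herm_minus_left herm_minus_right herm_smult_left herm_smult_right
  herm_scaleR_left herm_scaleR_right herm_zero_left herm_zero_right

lemma herm_commute: "herm y x = cnj (herm x y)"
  by (simp add: herm_def mult.commute)

lemma inner_eq_Re_herm: "x \<bullet> y = Re (herm x y)"
  by (simp add: herm_def inner_vec_def inner_complex_def)

lemma inner_i_eq_Im_herm: "x \<bullet> (\<i> *s y) = Im (herm x y)"
  by (simp add: inner_eq_Re_herm herm_simps)

lemma herm_self: "herm x x = of_real ((norm x)\<^sup>2)"
  by (rule complex_eqI)
    (simp_all add: inner_eq_Re_herm[symmetric] power2_norm_eq_inner,
     simp add: herm_def)

lemma bounded_bilinear_herm: "bounded_bilinear herm"
  unfolding bilinear_conv_bounded_bilinear[symmetric] bilinear_def
  by (auto intro!: linearI simp: herm_simps scaleR_conv_of_real[where 'a = complex])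

lemma bounded_bilinear_smult: "bounded_bilinear ((*s) :: complex \<Rightarrow> complex^'k \<Rightarrow> complex^'k)"
  unfolding bilinear_conv_bounded_bilinear[symmetric] bilinear_def
  by (auto intro!: linearI simp: vec_eq_iff distrib_left distrib_right mult_ac
      scaleR_conv_of_real[where 'a = complex])

lemma norm_smult: "norm (c *s (x :: complex^'k)) = cmod c * norm x"
proof -
  have "complex_of_real ((norm (c *s x))\<^sup>2) = (c * cnj c) * of_real ((norm x)\<^sup>2)"
    unfolding herm_self[symmetric] by (simp add: herm_smult_left herm_smult_right)
  also have "\<dots> = complex_of_real ((cmod c * norm x)\<^sup>2)"
    by (simp only: complex_norm_square[symmetric] power_mult_distrib of_real_mult)
  finally have "(norm (c *s x))\<^sup>2 = (cmod c * norm x)\<^sup>2"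
    by (simp only: of_real_eq_iff)
  then show ?thesis by (simp add: power2_eq_iff_nonneg)
qed

text \<open>A unit factor \<open>c\<close> turns the product into a nonnegative real number, to
  which the real Cauchy-Schwarz inequality applies.\<close>

lemma cmod_herm_le: "cmod (herm x y) \<le> norm x * norm y"
proof (cases "herm x y = 0")
  case False
  define c where "c = cnj (herm x y) / cmod (herm x y)"
  have c: "cmod c = 1" using False by (simp add: c_def norm_divide)
  have "herm (c *s x) y = of_real (cmod (herm x y))"
  proof -
    have "cnj (herm x y) * herm x y = of_real ((cmod (herm x y))\<^sup>2)"
      by (metis complex_norm_square mult.commute)
    then show ?thesis using False by (simp add: herm_simps c_def power2_eq_square)
  qed
  then have "cmod (herm x y) = (c *s x) \<bullet> y" by (simp add: inner_eq_Re_herm)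
  also have "\<dots> \<le> norm (c *s x) * norm y" by (rule norm_cauchy_schwarz)
  finally show ?thesis by (simp add: norm_smult c)
qed simp

lemma join_None [simp]: "join v c $ None = c"
  and join_Some [simp]: "join v c $ Some i = v $ i"
  by (simp_all add: join_def)

lemma vec_option_eq_iff:
  "x = y \<longleftrightarrow> x $ None = y $ None \<and> (\<forall>i. x $ Some i = y $ Some i)"
  unfolding vec_eq_iff by (metis option.exhaust)

lemma herm_join: "herm (join v c) (join v' c') = herm v v' + c * cnj c'"
  by (simp add: herm_def UNIV_option_conv sum.reindex)

lemma bounded_linear_join: "bounded_linear (\<lambda>p. join (fst p) (snd p))"
  unfolding linear_conv_bounded_linear[symmetric]
  by (rule linearI) (auto simp: vec_option_eq_iff)

lemma smult_join: "a *s join v c = join (a *s v) (a * c)"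
  by (simp add: vec_option_eq_iff)

definition adj :: "complex^'k^'k \<Rightarrow> complex^'k^'k"
  where "adj A = (\<chi> i j. cnj (A $ j $ i))"

lemma herm_adj_right: "herm x (A *v y) = herm (adj A *v x) y"
proof -
  have "herm x (A *v y) = (\<Sum>i\<in>UNIV. \<Sum>j\<in>UNIV. x $ i * cnj (A $ i $ j) * cnj (y $ j))"
    by (simp add: herm_def matrix_vector_mult_def sum_distrib_left mult.assoc)
  also have "\<dots> = (\<Sum>j\<in>UNIV. \<Sum>i\<in>UNIV. x $ i * cnj (A $ i $ j) * cnj (y $ j))"
    by (rule sum.swap)
  also have "\<dots> = herm (adj A *v x) y"
    by (simp add: herm_def matrix_vector_mult_def sum_distrib_right sum_distrib_left adj_def mult_ac)
  finally show ?thesis .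
qed

lemma adj_adj [simp]: "adj (adj A) = A"
  by (simp add: adj_def vec_eq_iff)

lemma unitary_adj_mult:
  assumes "unitary A"
  shows "adj A ** A = mat 1" "A ** adj A = mat 1"
proof -
  show 1: "adj A ** A = mat 1" using assms by (simp add: unitary_def adj_def)
  show "A ** adj A = mat 1" using 1 by (simp add: matrix_left_right_inverse)
qed

lemma unitary_adj_cancel:
  assumes "unitary A"
  shows "adj A *v (A *v x) = x" "A *v (adj A *v x) = x"
  by (simp_all add: matrix_vector_mul_assoc unitary_adj_mult[OF assms])

lemma unitary_adj: "unitary A \<Longrightarrow> unitary (adj A)"
  using unitary_adj_mult(2)[of A] by (simp add: unitary_def adj_def[of "adj A", symmetric])

lemma herm_unitary: "unitary A \<Longrightarrow> herm (A *v x) (A *v y) = herm x y"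
  by (simp add: herm_adj_right unitary_adj_cancel)

lemma norm_unitary: "unitary A \<Longrightarrow> norm (A *v x) = norm x"
  by (simp add: norm_eq_sqrt_inner inner_eq_Re_herm herm_unitary)

lemma matrix_smult: "A *v (c *s x) = c *s (A *v (x :: complex^'k))"
  by (simp add: vector_scalar_commute)

lemma bounded_linear_matrix: "bounded_linear (\<lambda>x. A *v (x :: complex^'k))"
  unfolding linear_conv_bounded_linear[symmetric]
  by (rule linearI) (auto simp: matrix_vector_right_distrib scaleR_eq_smult matrix_smult)

lemma unitary_mult: "unitary A \<Longrightarrow> unitary B \<Longrightarrow> unitary (A ** B)"
proof -
  assume A: "unitary A" and B: "unitary B"
  have "adj (A ** B) = adj B ** adj A"
    by (simp add: adj_def matrix_matrix_mult_def vec_eq_iff mult.commute)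
  then have "adj (A ** B) ** (A ** B) = adj B ** ((adj A ** A) ** B)"
    by (simp add: matrix_mul_assoc)
  also have "\<dots> = mat 1" by (simp add: unitary_adj_mult(1)[OF A] unitary_adj_mult(1)[OF B])
  finally show ?thesis by (simp add: unitary_def adj_def)
qed

section \<open>Affine coordinates of projective space\<close>

lemma hopf_eq_iff: "hopf z = hopf z' \<longleftrightarrow> (\<exists>u. cmod u = 1 \<and> z' = u *s z)"
proof
  assume "hopf z = hopf z'"
  moreover have "z' \<in> hopf z'" unfolding hopf_def by (auto intro!: exI[of _ 1])
  ultimately show "\<exists>u. cmod u = 1 \<and> z' = u *s z" by (auto simp: hopf_def)
next
  assume "\<exists>u. cmod u = 1 \<and> z' = u *s z"
  then obtain u where u: "cmod u = 1" "z' = u *s z" by auto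
  show "hopf z = hopf z'"
  proof
    show "hopf z \<subseteq> hopf z'"
    proof
      fix x assume "x \<in> hopf z"
      then obtain v where v: "x = v *s z" "cmod v = 1" by (auto simp: hopf_def)
      have "u \<noteq> 0" using u(1) by auto
      then have "x = (v / u) *s z'" using u(2) v(1) by simp
      moreover have "cmod (v / u) = 1" using u(1) v(2) by (simp add: norm_divide)
      ultimately show "x \<in> hopf z'" unfolding hopf_def by blast
    qed
    show "hopf z' \<subseteq> hopf z"
    proof
      fix x assume "x \<in> hopf z'"
      then obtain v where v: "x = v *s z'" "cmod v = 1" by (auto simp: hopf_def)
      then have "x = (v * u) *s z" using u(2) by simp
      moreover have "cmod (v * u) = 1" using u(1) v(2) by (simp add: norm_mult)
      ultimately show "x \<in> hopf z" unfolding hopf_def by blast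
    qed
  qed
qed

definition quotients :: "complex^('m::finite option) \<Rightarrow> complex^'m"
  where "quotients P = (\<chi> i. P $ Some i / P $ None)"

lemma join_quotients: "P $ None \<noteq> 0 \<Longrightarrow> P = P $ None *s join (quotients P) 1"
  by (simp add: vec_option_eq_iff quotients_def)

lemma norm_join_1: "(norm (join w 1))\<^sup>2 = 1 + (norm w)\<^sup>2"
proof -
  have "complex_of_real ((norm (join w 1))\<^sup>2) = of_real (1 + (norm w)\<^sup>2)"
    unfolding herm_self[symmetric] herm_join of_real_add by (simp add: herm_self)
  then show ?thesis by (simp only: of_real_eq_iff)
qed

lemma norm_join_1_pos: "norm (join w 1) > 0"
  by (auto simp: vec_option_eq_iff)

text \<open>The vector \<open>adj B *v z\<close> holds the homogeneous coordinates of the point in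
  the basis given by \<open>B\<close>. This gives at once the image of \<open>aff B\<close>, its
  injectivity and its inverse.\<close>

lemma aff_eq_hopf_iff:
  assumes B: "unitary B" and z: "norm z = 1"
  shows "aff B w = hopf z \<longleftrightarrow> (adj B *v z) $ None \<noteq> 0 \<and> w = quotients (adj B *v z)"
proof
  let ?P = "adj B *v z" and ?N = "norm (join w 1)"
  note N = norm_join_1_pos[of w]
  show "?P $ None \<noteq> 0 \<and> w = quotients ?P" if "aff B w = hopf z"
  proof -
    from that obtain u where u: "cmod u = 1"
      "z = u *s ((1 / ?N) *\<^sub>R (B *v join w 1))"
      unfolding aff_def hopf_eq_iff aff_section_def norm_unitary[OF B] by auto
    then have "?P = (u / ?N) *s join w 1"
      by (simp add: scaleR_eq_smult matrix_smult unitary_adj_cancel[OF B])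
    moreover have "u \<noteq> 0" using u by auto
    ultimately show ?thesis using N by (auto simp: quotients_def vec_eq_iff)
  qed
  show "aff B w = hopf z" if P: "?P $ None \<noteq> 0 \<and> w = quotients ?P"
  proof -
    have P': "?P = ?P $ None *s join w 1" using P join_quotients by blast
    \<comment> \<open>The last coordinate times \<open>?N\<close> is the phase by which
      \<open>z\<close> differs from the chosen section; it has modulus 1 because \<open>z\<close> is
      a unit vector.\<close>
    have "norm ?P = 1" using norm_unitary[OF unitary_adj[OF B]] z by simp
    then have n: "cmod (?P $ None * ?N) = 1"
      by (subst (asm) P') (simp add: norm_smult norm_mult)
    have "z = B *v (?P $ None *s join w 1)"
      using P' unitary_adj_cancel(2)[OF B, of z] by simp
    then have "z = (?P $ None * ?N) *s ((1 / ?N) *\<^sub>R (B *v join w 1))"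
      using N by (simp add: scaleR_eq_smult matrix_smult)
    then show ?thesis
      unfolding aff_def hopf_eq_iff aff_section_def norm_unitary[OF B] using n by blast
  qed
qed

lemma hopf_in_range_aff:
  "unitary B \<Longrightarrow> norm z = 1 \<Longrightarrow> hopf z \<in> range (aff B) \<longleftrightarrow> (adj B *v z) $ None \<noteq> 0"
  using aff_eq_hopf_iff[of B z] by (metis (no_types) image_iff UNIV_I)

lemma inv_aff_hopf:
  assumes "unitary B" "norm z = 1" "(adj B *v z) $ None \<noteq> 0"
  shows "inv (aff B) (hopf z) = quotients (adj B *v z)"
  unfolding inv_def using aff_eq_hopf_iff[OF assms(1,2)] assms(3) by (auto intro!: some_equality)

text \<open>The permutation matrix that exchanges \<open>None\<close> with the index of a nonzero
  coordinate does this; the charts of this kind therefore cover projective space.\<close>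

lemma exists_unitary_chart:
  fixes z :: "complex^('m::finite option)"
  assumes "z \<noteq> 0"
  obtains B where "unitary B" "(adj B *v z) $ None \<noteq> 0"
proof -
  from assms obtain j where j: "z $ j \<noteq> 0" by (auto simp: vec_eq_iff)
  define t where "t = Transposition.transpose None j"
  define B :: "complex^('m option)^('m option)" where "B = (\<chi> i k. if t i = k then 1 else 0)"
  have tt: "t (t i) = i" for i by (simp add: t_def)
  have sw: "t i = k \<longleftrightarrow> i = t k" for i k by (metis tt)
  have "cnj (B $ k $ i) * B $ k $ l = (if k = t i then (if i = l then 1 else 0) else 0)" for i k l
    by (auto simp: B_def tt)
  then have "unitary B"
    by (simp add: unitary_def mat_def matrix_matrix_mult_def vec_eq_iff)
  moreover have "(adj B *v z) $ None = z $ j"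
    unfolding adj_def B_def matrix_vector_mult_def
    by (simp add: sw if_distrib if_distribR cong: if_cong) (simp add: t_def)
  ultimately show thesis using that j by auto
qed

lemma aff_section_norm: "unitary A \<Longrightarrow> norm (aff_section A w) = 1"
  using norm_join_1_pos[of w] by (simp add: aff_section_def norm_unitary)

section \<open>The Fubini-Study metric in affine coordinates\<close>

text \<open>The Hermitian form of the Fubini-Study metric. Its real part will be the metric and its
  negative imaginary part the Kaehler form, so both are treated by the same computations.\<close>

definition fs_herm :: "complex^'m::finite \<Rightarrow> complex^'m \<Rightarrow> complex^'m \<Rightarrow> complex"
  where "fs_herm w u v = herm u v / of_real (1 + (norm w)\<^sup>2)
    - herm u w * herm w v / (of_real (1 + (norm w)\<^sup>2))\<^sup>2"

lemma one_plus_norm_ne [simp]: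
  "1 + (norm (x :: 'a::real_normed_vector))\<^sup>2 \<noteq> 0"
  "1 + (complex_of_real (norm x))\<^sup>2 \<noteq> 0"
proof -
  show 1: "1 + (norm x)\<^sup>2 \<noteq> 0" by (metis add_pos_nonneg less_irrefl zero_le_power2 zero_less_one)
  have "1 + (complex_of_real (norm x))\<^sup>2 = of_real (1 + (norm x)\<^sup>2)" by simp
  then show "1 + (complex_of_real (norm x))\<^sup>2 \<noteq> 0" using 1 by (metis of_real_eq_0_iff)
qed

lemma fs_herm_simps:
  "fs_herm w (u + v) z = fs_herm w u z + fs_herm w v z"
  "fs_herm w z (u + v) = fs_herm w z u + fs_herm w z v"
  "fs_herm w (u - v) z = fs_herm w u z - fs_herm w v z"
  "fs_herm w (c *s u) z = c * fs_herm w u z"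
  "fs_herm w z (c *s u) = cnj c * fs_herm w z u"
  "fs_herm w (r *\<^sub>R u) z = of_real r * fs_herm w u z"
  "fs_herm w z (r *\<^sub>R u) = of_real r * fs_herm w z u"
  "fs_herm w 0 z = 0"
  by (simp_all add: fs_herm_def herm_simps algebra_simps add_divide_distrib diff_divide_distrib)

text \<open>By Cauchy-Schwarz the subtracted term is at most
  \<open>(norm u * norm w)\<^sup>2\<close>, which is strictly below
  \<open>(1 + (norm w)\<^sup>2) * (norm u)\<^sup>2\<close>.\<close>

lemma fs_herm_pos:
  assumes "u \<noteq> 0"
  shows "Re (fs_herm w u u) > 0"
proof -
  define N where "N = 1 + (norm w)\<^sup>2"
  have N: "N > 0" by (simp add: N_def add_pos_nonneg)
  have "herm u w * herm w u = of_real ((cmod (herm u w))\<^sup>2)"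
    by (simp only: herm_commute[of w u] complex_norm_square)
  then have "fs_herm w u u = of_real ((norm u)\<^sup>2 / N - (cmod (herm u w))\<^sup>2 / N\<^sup>2)"
    by (simp add: fs_herm_def N_def herm_self)
  then have "Re (fs_herm w u u) = (norm u)\<^sup>2 / N - (cmod (herm u w))\<^sup>2 / N\<^sup>2"
    by (simp only: Re_complex_of_real)
  then have eq: "Re (fs_herm w u u) = (N * (norm u)\<^sup>2 - (cmod (herm u w))\<^sup>2) / N\<^sup>2"
    using N by (simp add: power2_eq_square divide_simps)
  have "(cmod (herm u w))\<^sup>2 \<le> (norm u * norm w)\<^sup>2"
    by (intro power_mono cmod_herm_le) auto
  also have "\<dots> < N * (norm u)\<^sup>2"
    using assms by (simp add: N_def algebra_simps power_mult_distrib)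
  finally show ?thesis using N unfolding eq by simp
qed

lemma inner_horizontal_part:
  assumes "norm z = 1"
  shows "horizontal_part z x \<bullet> horizontal_part z y = x \<bullet> y - (x \<bullet> (\<i> *s z)) * (y \<bullet> (\<i> *s z))"
proof -
  have "(\<i> *s z) \<bullet> (\<i> *s z) = 1"
    using assms by (simp add: power2_norm_eq_inner[symmetric] norm_smult)
  then show ?thesis
    by (simp add: horizontal_part_def inner_diff_left inner_diff_right inner_commute algebra_simps)
qed

lemma norm_join_1_eq: "norm (join w 1) = sqrt (1 + (norm w)\<^sup>2)"
  by (simp flip: norm_join_1)

lemma Re_of_real_mult: "Re (of_real r * z) = r * Re z"
  by simp

lemma aff_section_has_derivative:
  assumes A: "unitary A"
  defines "N \<equiv> \<lambda>w. sqrt (1 + (norm w)\<^sup>2)"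
  shows "(aff_section A has_derivative (\<lambda>u. (1 / N w) *\<^sub>R (A *v join u 0) -
    ((u \<bullet> w) / N w ^ 3) *\<^sub>R (A *v join w 1))) (at w)"
proof -
  have pos: "1 + w \<bullet> w > 0" by (simp add: add_pos_nonneg)
  have N: "N w > 0" "(N w)\<^sup>2 = 1 + w \<bullet> w"
    using pos by (auto simp: N_def power2_norm_eq_inner)
  have nrm: "aff_section A = (\<lambda>w. (1 / sqrt (1 + w \<bullet> w)) *\<^sub>R (A *v join w 1))"
    by (simp add: aff_section_def norm_unitary[OF A] fun_eq_iff norm_join_1_eq power2_norm_eq_inner)
  have s: "((\<lambda>w. 1 / sqrt (1 + w \<bullet> w)) has_derivative (\<lambda>u. - ((u \<bullet> w) / N w ^ 3))) (at w)"
  proof -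
    have "((\<lambda>w. 1 / sqrt (1 + w \<bullet> w)) has_derivative
      (\<lambda>u. - (inverse (N w) * ((u \<bullet> w + w \<bullet> u) * (inverse (N w) / 2)) * inverse (N w)))) (at w)"
      using pos unfolding divide_inverse N_def power2_norm_eq_inner
      by (auto intro!: derivative_eq_intros)
    then show ?thesis
      using N(1) by (elim has_derivative_eq_rhs)
        (auto simp: fun_eq_iff inner_commute field_simps power3_eq_cube)
  qed
  have j: "((\<lambda>w. A *v join w 1) has_derivative (\<lambda>u. A *v join u 0)) (at w)"
    by (rule bounded_linear.has_derivative[OF bounded_linear_matrix])
      (use bounded_linear.has_derivative[OF bounded_linear_join
          has_derivative_Pair[OF has_derivative_ident has_derivative_const]] in simp)
  show ?thesis
    unfolding nrm
    by (rule has_derivative_eq_rhs[OF has_derivative_scaleR[OF s j]])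
      (simp add: fun_eq_iff N_def power2_norm_eq_inner)
qed

text \<open>Normalising the section to unit length subtracts the product of the real parts of
  \<open>herm u w\<close> and \<open>herm v w\<close>; projecting away the Hopf fibre subtracts the
  product of the imaginary parts. Together they form the real part of
  \<open>herm u w * herm w v\<close>. The matrix drops out because it is unitary.\<close>

lemma fubini_study_eq:
  assumes A: "unitary A"
  shows "fubini_study A w u v = Re (fs_herm w u v)"
proof -
  define N where "N = sqrt (1 + (norm w)\<^sup>2)"
  have N: "N > 0" "N\<^sup>2 = 1 + (norm w)\<^sup>2"
    by (simp_all add: N_def add_pos_nonneg)
  define x where "x u = (1 / N) *\<^sub>R (A *v join u 0) - ((u \<bullet> w) / N ^ 3) *\<^sub>R (A *v join w 1)" for u
  have hd: "hor_diff A w u = horizontal_part (aff_section A w) (x u)" for u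
    unfolding hor_diff_def D_eq[OF aff_section_has_derivative[OF A]] x_def N_def by simp
  have sec: "aff_section A w = (1 / N) *\<^sub>R (A *v join w 1)"
    by (simp add: aff_section_def norm_unitary[OF A] N_def norm_join_1_eq)
  have ww: "herm w w = of_real (N\<^sup>2 - 1)" by (simp add: herm_self N)
  note hs = herm_simps herm_unitary[OF A] herm_join
  have xx: "x u \<bullet> x v = Re (herm u v) / N\<^sup>2 - Re (herm u w) * Re (herm v w) / N ^ 4"
  proof -
    have c: "Re (herm w v) = Re (herm v w)" by (simp add: herm_commute[of w v])
    have "x u \<bullet> x v = Re (herm u v) / N\<^sup>2 - 2 * Re (herm u w) * Re (herm v w) / N ^ 4
        + Re (herm u w) * Re (herm v w) * N\<^sup>2 / N ^ 6"
      unfolding x_def inner_eq_Re_herm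
      using N(1) by (simp add: hs ww c) (simp add: field_simps power_numeral_reduce)
    then show ?thesis using N(1) by (simp add: field_simps power_numeral_reduce)
  qed
  have xi: "x u \<bullet> (\<i> *s aff_section A w) = Im (herm u w) / N\<^sup>2" for u
    unfolding x_def sec inner_eq_Re_herm using N(1)
    by (simp add: hs ww) (simp add: field_simps power_numeral_reduce)
  have "fubini_study A w u v = Re (herm u v) / N\<^sup>2
      - (Re (herm u w) * Re (herm v w) + Im (herm u w) * Im (herm v w)) / N ^ 4"
    unfolding fubini_study_def hd inner_horizontal_part[OF aff_section_norm[OF A]] xx xi
    using N(1) by (simp add: field_simps power_numeral_reduce)
  also have "\<dots> = Re (fs_herm w u v)"
  proof -
    have "fs_herm w u v = of_real (1 / N\<^sup>2) * herm u v
        - of_real (1 / N ^ 4) * (herm u w * cnj (herm v w))"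
      unfolding fs_herm_def N(2)[symmetric] by (simp add: herm_commute[of w v])
    then show ?thesis by (simp only: minus_complex.sel Re_of_real_mult) (simp add: diff_divide_distrib)
  qed
  finally show ?thesis .
qed

lemma kaehler_form_eq: "unitary A \<Longrightarrow> kaehler_form A w u v = - Im (fs_herm w u v)"
  by (simp add: kaehler_form_def fubini_study_eq fs_herm_simps)

lemma fs_herm_Re_has_derivative:
  defines "q \<equiv> \<lambda>w. 1 / (1 + (norm w)\<^sup>2)"
  shows "((\<lambda>x. Re (fs_herm x v z)) has_derivative (\<lambda>u.
     - 2 * (q w)\<^sup>2 * Re (herm u w) * Re (herm v z)
     - (q w)\<^sup>2 * Re (herm v u * herm w z + herm v w * herm u z)
     + 4 * (q w) ^ 3 * Re (herm u w) * Re (herm v w * herm w z))) (at w)"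
proof -
  have f: "Re (fs_herm x v z) = q x * Re (herm v z) - (q x)\<^sup>2 * Re (herm v x * herm x z)" for x
  proof -
    have "fs_herm x v z = of_real (q x) * herm v z - of_real ((q x)\<^sup>2) * (herm v x * herm x z)"
      unfolding fs_herm_def q_def by (simp add: power_divide)
    then show ?thesis by (simp only: minus_complex.sel Re_of_real_mult)
  qed
  have pos: "1 + w \<bullet> w \<noteq> 0" using one_plus_norm_ne(1)[of w] by (simp add: power2_norm_eq_inner)
  have q: "(q has_derivative (\<lambda>u. - 2 * (q w)\<^sup>2 * Re (herm u w))) (at w)"
  proof -
    have "(q has_derivative (\<lambda>u. - (inverse (1 + w \<bullet> w) * (u \<bullet> w + w \<bullet> u) * inverse (1 + w \<bullet> w)))) (at w)"
      using pos unfolding q_def divide_inverse power2_norm_eq_inner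
      by (auto intro!: derivative_eq_intros)
    moreover have "- (inverse (1 + w \<bullet> w) * (u \<bullet> w + w \<bullet> u) * inverse (1 + w \<bullet> w))
        = - 2 * (q w)\<^sup>2 * Re (herm u w)" for u
    proof -
      have qw: "q w = inverse (1 + w \<bullet> w)"
        by (simp add: q_def power2_norm_eq_inner divide_inverse)
      show ?thesis
        unfolding qw inner_eq_Re_herm[symmetric] inner_commute[of w u] by (simp add: power2_eq_square)
    qed
    ultimately show ?thesis by simp
  qed
  have h: "((\<lambda>x. Re (herm v x * herm x z)) has_derivative
      (\<lambda>u. Re (herm v u * herm w z + herm v w * herm u z))) (at w)"
    using bounded_linear.has_derivative[OF bounded_linear_Re has_derivative_mult[OF
      bounded_bilinear.FDERIV[OF bounded_bilinear_herm has_derivative_const[of v] has_derivative_ident[of "at w"]]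
      bounded_bilinear.FDERIV[OF bounded_bilinear_herm has_derivative_ident[of "at w"] has_derivative_const[of z]]]]
    by (simp add: herm_simps add.commute)
  show ?thesis unfolding f
    by (rule has_derivative_eq_rhs[OF has_derivative_diff[OF
            has_derivative_mult_left[OF q] has_derivative_mult[OF has_derivative_power[OF q, of 2] h]]])
      (simp add: fun_eq_iff algebra_simps power2_eq_square power3_eq_cube)
qed

text \<open>Complex bilinear in \<open>u\<close> and \<open>v\<close>, as the Levi-Civita connection
  of a Kaehler metric is in holomorphic coordinates.\<close>

definition fs_christoffel :: "complex^'m::finite \<Rightarrow> complex^'m \<Rightarrow> complex^'m \<Rightarrow> complex^'m"
  where "fs_christoffel w u v =
    (- 1 / of_real (1 + (norm w)\<^sup>2)) *s (herm u w *s v + herm v w *s u)"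

text \<open>The Koszul formula is verified for the explicit symbols. Any other solution differs from
  them by a vector \<open>e\<close> orthogonal to everything, in particular to itself, and the
  metric is positive definite.\<close>

lemma christoffel_fubini_study:
  assumes A: "unitary A"
  shows "christoffel (fubini_study A) w u v = fs_christoffel w u v"
proof -
  define q where "q = 1 / (1 + (norm w)\<^sup>2)"
  let ?R = "\<lambda>z. D (\<lambda>x. fubini_study A x v z) w u + D (\<lambda>x. fubini_study A x u z) w v -
     D (\<lambda>x. fubini_study A x u v) w z"
  have ex: "2 * fubini_study A w (fs_christoffel w u v) z = ?R z" for z
  proof -
    define a b c p r t where abc: "a = herm u w" "b = herm v w" "c = herm z w"
      "p = herm u v" "r = herm v z" "t = herm u z"
    have comm: "herm w z = cnj c" "herm w u = cnj a" "herm w v = cnj b" "herm v u = cnj p"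
      "herm z u = cnj t" "herm z v = cnj r"
      unfolding abc by (rule herm_commute)+
    have "fs_herm w (fs_christoffel w u v) z = of_real (- (q\<^sup>2)) * (a * r + b * t) + of_real (2 * q ^ 3) * (a * b * cnj c)"
    proof -
      have fs: "fs_herm w x y = of_real q * herm x y - of_real (q\<^sup>2) * (herm x w * herm w y)" for x y
        unfolding fs_herm_def q_def by (simp add: power_divide)
      have ch: "fs_christoffel w u v = of_real (- q) *s (herm u w *s v + herm v w *s u)"
        unfolding fs_christoffel_def q_def by simp
      show ?thesis
        unfolding fs ch by (simp add: herm_simps abc[symmetric] comm algebra_simps
            power2_eq_square power3_eq_cube)
    qed
    then have "2 * fubini_study A w (fs_christoffel w u v) z
      = - 2 * q\<^sup>2 * Re (a * r + b * t) + 4 * q ^ 3 * Re (a * b * cnj c)"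
      unfolding fubini_study_eq[OF A] by (simp only: plus_complex.sel Re_of_real_mult) simp
    also have "\<dots> = ?R z"
      unfolding fubini_study_eq[OF A] D_eq[OF fs_herm_Re_has_derivative] q_def[symmetric]
        comm abc[symmetric]
      by (simp add: algebra_simps)
    finally show ?thesis .
  qed
  show ?thesis unfolding christoffel_def
  proof (rule the_equality)
    show "\<forall>z. 2 * fubini_study A w (fs_christoffel w u v) z = ?R z" using ex by blast
  next
    fix a' assume a': "\<forall>z. 2 * fubini_study A w a' z = ?R z"
    define e where "e = a' - fs_christoffel w u v"
    have "fubini_study A w a' e = fubini_study A w (fs_christoffel w u v) e"
      using a' ex by (metis mult_cancel_left zero_neq_numeral)
    then have "Re (fs_herm w e e) = 0"
      by (simp add: fubini_study_eq[OF A] e_def fs_herm_simps)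
    then have "e = 0" using fs_herm_pos[of e w] by force
    then show "a' = fs_christoffel w u v" by (simp add: e_def)
  qed
qed

section \<open>Local lifts to the sphere\<close>

text \<open>The right-hand side does not change when multiples of \<open>P\<close> are added to
  \<open>Pu\<close> or \<open>Pv\<close>, so the terms with \<open>fu\<close> and \<open>fv\<close>
  drop out. It is also homogeneous of degree 0 in the common factor \<open>f0\<close>, so
  \<open>P\<close> may have any length.\<close>

lemma fs_herm_lift_algebra:
  assumes "f0 \<noteq> 0"
    and P: "P = f0 *s join h 1"
    and Pu: "Pu = fu *s join h 1 + f0 *s join hu 0"
    and Pv: "Pv = fv *s join h 1 + f0 *s join hv 0"
  shows "fs_herm h hu hv = (herm Pu Pv * herm P P - herm Pu P * herm P Pv) / (herm P P)\<^sup>2"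
proof -
  define m where "m = complex_of_real (1 + (norm h)\<^sup>2)"
  have m: "m \<noteq> 0" "herm h h + 1 = m" by (auto simp: m_def herm_self)
  have e1: "herm P P = f0 * cnj f0 * m"
    unfolding P by (simp add: herm_simps herm_join m(2))
  have "herm Pu Pv * herm P P - herm Pu P * herm P Pv
    = (f0 * cnj f0)\<^sup>2 * (m * herm hu hv - herm hu h * herm h hv)"
    unfolding e1 unfolding P Pu Pv m(2)[symmetric]
    by (simp add: herm_simps herm_join algebra_simps power2_eq_square)
  also have "\<dots> / (herm P P)\<^sup>2 = (m * herm hu hv - herm hu h * herm h hv) / m\<^sup>2"
    using assms(1) m(1) by (simp add: e1 power_mult_distrib)
  also have "\<dots> = fs_herm h hu hv"
    unfolding fs_herm_def m_def[symmetric] using m(1) by (simp add: power2_eq_square diff_divide_distrib)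
  finally show ?thesis by simp
qed

text \<open>Horizontality forces \<open>fu = - f0 * herm hu h / (1 + \<bar>h\<bar>\<^sup>2)\<close>,
  and likewise for \<open>v\<close> and \<open>z\<close>. With these values the mixed terms of the
  second derivative are exactly the Christoffel correction, and the component along
  \<open>join h 1\<close> is invisible because \<open>Pz\<close> is orthogonal to
  \<open>P\<close>.\<close>

lemma fs_herm_christoffel_algebra:
  assumes unit: "norm P = 1"
    and P: "P = f0 *s join h 1"
    and Pu: "Pu = fu *s join h 1 + f0 *s join hu 0" "herm Pu P = 0"
    and Pv: "Pv = fv *s join h 1 + f0 *s join hv 0" "herm Pv P = 0"
    and Pz: "Pz = fz *s join h 1 + f0 *s join hz 0" "herm Pz P = 0"
    and Puv: "Puv = fuv *s join h 1 + fv *s join hu 0 + fu *s join hv 0 + f0 *s join huv 0"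
  shows "herm Puv Pz = fs_herm h (huv + fs_christoffel h hu hv) hz"
proof -
  define m where "m = complex_of_real (1 + (norm h)\<^sup>2)"
  have m: "m \<noteq> 0" "herm h h + 1 = m" "cnj m = m" by (auto simp: m_def herm_self)
  have f0m: "f0 * cnj f0 * m = 1"
    using unit herm_self[of P] unfolding P by (simp add: herm_simps herm_join m(2) mult_ac)
  then have f0: "f0 \<noteq> 0" by auto
  have hor: "f * m = - (f0 * herm X h)"
    if "Q = f *s join h 1 + f0 *s join X 0" "herm Q P = 0" for Q f X
  proof -
    have "cnj f0 * (f * m + f0 * herm X h) = 0"
      using that(2) unfolding that(1) P by (simp add: herm_simps herm_join m(2)[symmetric] algebra_simps)
    then show ?thesis using f0 by (simp add: eq_neg_iff_add_eq_0)
  qed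
  have coeff: "f = - (f0 * herm X h) / m"
    if "Q = f *s join h 1 + f0 *s join X 0" "herm Q P = 0" for Q f X
    unfolding hor[OF that, symmetric] using m(1) by simp
  note fu = coeff[OF Pu] and fv = coeff[OF Pv] and fz = coeff[OF Pz]
  have J: "herm (join h 1) Pz = 0"
  proof -
    have "f0 * herm (join h 1) Pz = cnj (herm Pz P)"
      unfolding P by (simp add: herm_simps herm_commute[of "join h 1" Pz])
    then show ?thesis using Pz(2) f0 by simp
  qed
  have X: "herm (join X 0) Pz = cnj f0 * m * fs_herm h X hz" for X
  proof -
    have "herm (join X 0) Pz = cnj f0 * (herm X hz - herm X h * herm h hz / m)"
      unfolding Pz(1) using m(1,3)
      by (simp add: herm_simps herm_join fz algebra_simps herm_commute[of hz h])
    also have "\<dots> = cnj f0 * m * fs_herm h X hz"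
      unfolding fs_herm_def m_def[symmetric] using m(1) by (simp add: field_simps power2_eq_square)
    finally show ?thesis .
  qed
  have "herm Puv Pz = fv * (cnj f0 * m * fs_herm h hu hz) + fu * (cnj f0 * m * fs_herm h hv hz)
      + f0 * (cnj f0 * m * fs_herm h huv hz)"
    unfolding Puv by (simp add: herm_simps J X)
  also have "\<dots> = (f0 * cnj f0 * m) * (fs_herm h huv hz
      - (herm hv h * fs_herm h hu hz + herm hu h * fs_herm h hv hz) / m)"
    unfolding fu fv using m(1) by (simp add: field_simps)
  also have "\<dots> = fs_herm h huv hz - (herm hv h * fs_herm h hu hz + herm hu h * fs_herm h hv hz) / m"
    by (simp add: f0m)
  also have "\<dots> = fs_herm h (huv + fs_christoffel h hu hv) hz"
    unfolding fs_christoffel_def m_def[symmetric] fs_herm_simps using m(1) by (simp add: field_simps)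
  finally show ?thesis .
qed

lemma has_derivative_vec_nth:
  "(f has_derivative f') F \<Longrightarrow> ((\<lambda>x. f x $ i) has_derivative (\<lambda>v. f' v $ i)) F"
  by (rule bounded_linear.has_derivative[OF bounded_linear_vec_nth])

lemma has_derivative_join:
  "(f has_derivative f') (at x within S) \<Longrightarrow> (g has_derivative g') (at x within S) \<Longrightarrow>
    ((\<lambda>x. join (f x) (g x)) has_derivative (\<lambda>v. join (f' v) (g' v))) (at x within S)"
  using bounded_linear.has_derivative[OF bounded_linear_join has_derivative_Pair] by fastforce

lemmas has_derivative_smult = bounded_bilinear.FDERIV[OF bounded_bilinear_smult]
lemmas has_derivative_herm = bounded_bilinear.FDERIV[OF bounded_bilinear_herm]

lemma smooth_on_vec_nth:
  fixes f :: "'a::real_normed_vector \<Rightarrow> 'b::euclidean_space^'k"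
  shows "open S \<Longrightarrow> smooth_on S f \<Longrightarrow> smooth_on S (\<lambda>x. f x $ i)"
  by (rule smooth_on_linear_compose[OF bounded_linear_vec_nth])

lemma smooth_on_quotients:
  fixes P :: "'e::euclidean_space \<Rightarrow> complex^('m::finite option)"
  assumes "open U" "smooth_on U P" "\<And>y. y \<in> U \<Longrightarrow> P y $ None \<noteq> 0"
  shows "smooth_on U (\<lambda>y. quotients (P y))"
proof (rule smooth_on_vec[OF assms(1)])
  show "smooth_on U (\<lambda>y. quotients (P y) $ i)" for i
    unfolding quotients_def using assms
    by (simp add: smooth_on_divide smooth_on_vec_nth)
qed

text \<open>The lift \<open>P\<close> may have any length: besides unit horizontal lifts, the linear
  expression of a unitary map in homogeneous coordinates is an instance.\<close>

locale homogeneous_lift =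
  fixes U :: "'e::euclidean_space set" and P :: "'e \<Rightarrow> complex^('m::finite option)"
    and f :: "'e \<Rightarrow> complex" and h :: "'e \<Rightarrow> complex^'m"
  assumes open_U: "open U" and smooth_P: "smooth_on U P" and smooth_h: "smooth_on U h"
    and f_eq: "f = (\<lambda>y. P y $ None)" and f_nz: "y \<in> U \<Longrightarrow> f y \<noteq> 0"
    and P_eq: "y \<in> U \<Longrightarrow> P y = f y *s join (h y) 1"
begin

lemma smooth_f: "smooth_on U f"
  unfolding f_eq by (intro smooth_on_vec_nth open_U smooth_P)

lemmas h_has_derivative = smooth_on_has_derivative[OF smooth_h]
  and f_has_derivative = smooth_on_has_derivative[OF smooth_f]

lemma D_P:
  assumes "y \<in> U"
  shows "D P y v = D f y v *s join (h y) 1 + f y *s join (D h y v) 0"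
proof -
  have "D P y = D (\<lambda>y. f y *s join (h y) 1) y"
    by (rule D_cong[OF open_U assms P_eq])
  also have "\<dots> = (\<lambda>v. f y *s join (D h y v) 0 + D f y v *s join (h y) 1)"
    by (intro D_eq has_derivative_smult has_derivative_join has_derivative_const
        f_has_derivative h_has_derivative assms)
  finally show ?thesis by (simp add: add.commute)
qed

lemma D_D_P:
  assumes "y \<in> U"
  shows "D (\<lambda>y. D P y v) y u = D (\<lambda>y. D f y v) y u *s join (h y) 1 + D f y v *s join (D h y u) 0
    + D f y u *s join (D h y v) 0 + f y *s join (D (\<lambda>y. D h y v) y u) 0"
proof -
  note hd = smooth_on_has_derivative[OF smooth_on_D[OF smooth_f]]
    smooth_on_has_derivative[OF smooth_on_D[OF smooth_h]]
  have "D (\<lambda>y. D P y v) y = D (\<lambda>y. D f y v *s join (h y) 1 + f y *s join (D h y v) 0) y"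
    by (rule D_cong[OF open_U assms D_P])
  also have "\<dots> = (\<lambda>u. (D f y v *s join (D h y u) 0 + D (\<lambda>y. D f y v) y u *s join (h y) 1)
     + (f y *s join (D (\<lambda>y. D h y v) y u) 0 + D f y u *s join (D h y v) 0))"
    by (intro D_eq has_derivative_add has_derivative_smult has_derivative_join has_derivative_const
        f_has_derivative h_has_derivative assms hd)
  finally show ?thesis by (simp add: algebra_simps)
qed

lemma fs_herm_D:
  assumes "y \<in> U"
  shows "fs_herm (h y) (D h y u) (D h y v) =
    (herm (D P y u) (D P y v) * herm (P y) (P y) - herm (D P y u) (P y) * herm (P y) (D P y v))
      / (herm (P y) (P y))\<^sup>2"
  by (rule fs_herm_lift_algebra[OF f_nz P_eq D_P D_P]) fact+

lemma fs_herm_cov_deriv: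
  assumes "y \<in> U" "norm (P y) = 1" "\<And>u. herm (D P y u) (P y) = 0" "unitary B"
  shows "fs_herm (h y) (cov_deriv (fubini_study B) h y u v) (D h y z) =
    herm (D (\<lambda>y. D P y v) y u) (D P y z)"
  unfolding cov_deriv_def christoffel_fubini_study[OF assms(4)]
  by (rule fs_herm_christoffel_algebra[symmetric, OF assms(2) P_eq[OF assms(1)] D_P[OF assms(1)] assms(3)
        D_P[OF assms(1)] assms(3) D_P[OF assms(1)] assms(3) D_D_P[OF assms(1)]])

end

section \<open>The mean curvature of a Lagrangian immersion\<close>

text \<open>The Hermitian form is real on the range of \<open>L\<close>, so the range is orthogonal
  to its multiple by \<open>\<i>\<close> and meets it only in 0. Their real dimensions add up to
  that of the whole space.\<close>

lemma range_plus_i_range: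
  fixes L :: "'e::euclidean_space \<Rightarrow> complex^'m::finite"
  assumes "linear L" "inj L" "DIM('e) = CARD('m)" "\<And>u v. Im (fs_herm x (L u) (L v)) = 0"
  obtains a b where "X = L a + \<i> *s L b"
proof -
  define T where "T p = L (fst p) + \<i> *s L (snd p)" for p
  have linT: "linear T"
    using assms(1) by (intro linearI)
      (auto simp: T_def linear_add linear_scale vec_eq_iff algebra_simps)
  have "inj T"
    unfolding linear_injective_0[OF linT]
  proof (intro allI impI)
    fix p assume p: "T p = 0"
    have re: "fs_herm x (L u) (L v) = of_real (Re (fs_herm x (L u) (L v)))" for u v
      using assms(4)[of u v] by (simp add: complex_eq_iff)
    have "fs_herm x (T p) (L (fst p)) = 0" by (simp add: p fs_herm_simps)
    then have "fs_herm x (L (fst p)) (L (fst p)) + \<i> * fs_herm x (L (snd p)) (L (fst p)) = 0"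
      by (simp add: T_def fs_herm_simps)
    then have "Re (fs_herm x (L (fst p)) (L (fst p))) = 0"
      using assms(4)[of "snd p" "fst p"] by (simp add: complex_eq_iff)
    then have 1: "L (fst p) = 0" using fs_herm_pos[of "L (fst p)" x] by force
    then have "\<i> *s L (snd p) = 0" using p by (simp add: T_def)
    then have "L (snd p) = 0" by (simp add: vec_eq_iff)
    with 1 show "p = 0" using assms(1,2) by (simp add: prod_eq_iff linear_injective_0)
  qed
  moreover have "dim (UNIV :: (complex^'m) set) = dim (UNIV :: ('e \<times> 'e) set)"
    by (simp add: assms(3))
  ultimately have "surj T" using linT by (intro linear_injective_imp_surjective) auto
  then obtain p where "X = T p" by (metis surjD)
  then show thesis using that by (simp add: T_def)
qed

text \<open>The normal space of a Lagrangian immersion is \<open>\<i>\<close> times the tangent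
  space. Hence the normal part of \<open>?L a + \<i> *s ?L b\<close> is its second summand, and
  pairing a vector with a normal vector amounts to taking the imaginary part of its Hermitian
  product with a tangent vector. No normal projection is left on the right.\<close>

lemma mean_curvature_eq_0_iff:
  fixes h :: "'e::euclidean_space \<Rightarrow> complex^'m::finite"
  assumes B: "unitary B" and dim: "DIM('e) = CARD('m)"
    and lin: "linear (D h y)" and inj: "inj (D h y)"
    and lag: "\<And>u v. Im (fs_herm (h y) (D h y u) (D h y v)) = 0"
  defines "G \<equiv> fubini_study B"
  shows "mean_curvature G h y = 0 \<longleftrightarrow>
    (\<forall>w. (\<Sum>b\<in>Basis. Im (fs_herm (h y) (cov_deriv G h y b (induced_sharp G h y b)) (D h y w))) = 0)"
proof -
  let ?L = "D h y" and ?f = "fs_herm (h y)"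
  have normal: "normal_part G h y (?L a + \<i> *s ?L b) = \<i> *s ?L b" for a b
  proof -
    have "(THE t. t \<in> range ?L \<and> (\<forall>v. G (h y) (?L a + \<i> *s ?L b - t) (?L v) = 0)) = ?L a"
    proof (rule the_equality)
      show "?L a \<in> range ?L \<and> (\<forall>v. G (h y) (?L a + \<i> *s ?L b - ?L a) (?L v) = 0)"
        by (simp add: G_def fubini_study_eq[OF B] fs_herm_simps lag)
    next
      fix t assume t: "t \<in> range ?L \<and> (\<forall>v. G (h y) (?L a + \<i> *s ?L b - t) (?L v) = 0)"
      then obtain c where c: "t = ?L c" by auto
      have "Re (?f (?L (a - c)) (?L v)) = 0" for v
        using t by (simp add: c G_def fubini_study_eq[OF B] fs_herm_simps lag linear_diff[OF lin])
      from this[of "a - c"] have "?L (a - c) = 0"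
        using fs_herm_pos[of "?L (a - c)" "h y"] by force
      then show "t = ?L a" by (simp add: c linear_diff[OF lin])
    qed
    then show ?thesis by (simp add: normal_part_def)
  qed
  define X where "X b = cov_deriv G h y b (induced_sharp G h y b)" for b
  have "\<exists>p. X b = ?L (fst p) + \<i> *s ?L (snd p)" for b
    using range_plus_i_range[OF lin inj dim lag, of "X b"] by (metis fst_conv snd_conv)
  then obtain p where p: "\<And>b. X b = ?L (fst (p b)) + \<i> *s ?L (snd (p b))" by metis
  define s where "s = (\<Sum>b\<in>Basis. snd (p b))"
  have "(\<Sum>b\<in>Basis. second_fund_form G h y b (induced_sharp G h y b)) = \<i> *s ?L s"
    unfolding second_fund_form_def X_def[symmetric] p normal s_def
    by (simp add: linear_sum[OF lin] vec_eq_iff sum_distrib_left)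
  then have 1: "mean_curvature G h y = 0 \<longleftrightarrow> ?L s = 0"
    by (simp add: mean_curvature_def)
  have 2: "(\<Sum>b\<in>Basis. Im (?f (X b) (?L w))) = Re (?f (?L s) (?L w))" for w
  proof -
    have "Im (?f (X b) (?L w)) = Re (?f (?L (snd (p b))) (?L w))" for b
      by (simp add: p fs_herm_simps lag)
    moreover have "?f (sum g S) z = (\<Sum>b\<in>S. ?f (g b) z)" for g :: "'e \<Rightarrow> _" and S z
      by (induction S rule: infinite_finite_induct) (auto simp: fs_herm_simps)
    ultimately show ?thesis by (simp add: s_def linear_sum[OF lin])
  qed
  have "?L s = 0 \<longleftrightarrow> (\<forall>w. Re (?f (?L s) (?L w)) = 0)"
    using fs_herm_pos[of "?L s" "h y"] by (auto simp: fs_herm_simps)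
      (metis less_irrefl)
  then show ?thesis unfolding 1 X_def[symmetric] 2 .
qed

section \<open>Minimality in terms of a horizontal lift\<close>

text \<open>The real part of the Hermitian condition is tangency to the sphere, the imaginary part
  is orthogonality to the Hopf fibre.\<close>

definition unit_horizontal :: "'e::euclidean_space set \<Rightarrow> ('e \<Rightarrow> complex^'k::finite) \<Rightarrow> bool"
  where "unit_horizontal W F \<longleftrightarrow> open W \<and> smooth_on W F \<and>
    (\<forall>y\<in>W. norm (F y) = 1 \<and> (\<forall>u. herm (D F y u) (F y) = 0))"

definition lift_sharp :: "('e::euclidean_space \<Rightarrow> complex^'k::finite) \<Rightarrow> 'e \<Rightarrow> 'e \<Rightarrow> 'e"
  where "lift_sharp F y b = (THE a. \<forall>v. D F y a \<bullet> D F y v = b \<bullet> v)"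

text \<open>\<open>lift_mean F y w\<close> is the product of \<open>\<i> D F y w\<close> with the trace of the second
  fundamental form; these vectors span the normal space of a Lagrangian immersion.\<close>

definition lift_mean :: "('e::euclidean_space \<Rightarrow> complex^'k::finite) \<Rightarrow> 'e \<Rightarrow> 'e \<Rightarrow> real"
  where "lift_mean F y w =
    (\<Sum>b\<in>Basis. Im (herm (D (\<lambda>z. D F z (lift_sharp F y b)) y b) (D F y w)))"

definition lift_minimal_at :: "('e::euclidean_space \<Rightarrow> complex^'k::finite) \<Rightarrow> 'e \<Rightarrow> bool"
  where "lift_minimal_at F y \<longleftrightarrow> inj (D F y) \<and> (\<forall>u v. Im (herm (D F y u) (D F y v)) = 0) \<and>
    (\<forall>w. lift_mean F y w = 0)"

lemma D_unitary:
  assumes "unitary A" "F differentiable (at y)"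
  shows "D (\<lambda>z. A *v F z) y u = A *v D F y u"
  using D_eq[OF bounded_linear.has_derivative[OF bounded_linear_matrix D_works[OF assms(2)]]] by metis

text \<open>In the chart of \<open>B\<close> the homogeneous lift is \<open>adj B *v F y\<close>. It
  has unit length and stays horizontal, so the correction terms in the formulas for homogeneous
  lifts vanish and the unitary factor cancels from all products.\<close>

lemma unit_horizontal_chart:
  fixes F :: "'e::euclidean_space \<Rightarrow> complex^('m::finite option)"
  assumes F: "unit_horizontal W F" and B: "unitary B" and f: "\<forall>y\<in>W. f y = hopf (F y)"
  defines "U \<equiv> {y \<in> W. f y \<in> range (aff B)}" and "h \<equiv> inv (aff B) \<circ> f"
  shows "U = {y \<in> W. (adj B *v F y) $ None \<noteq> 0}"
    and "homogeneous_lift U (\<lambda>y. adj B *v F y) (\<lambda>y. (adj B *v F y) $ None) h"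
    and "\<And>y u v. y \<in> U \<Longrightarrow> fs_herm (h y) (D h y u) (D h y v) = herm (D F y u) (D F y v)"
    and "\<And>y u v z. y \<in> U \<Longrightarrow> fs_herm (h y) (cov_deriv (fubini_study B) h y u v) (D h y z)
      = herm (D (\<lambda>z. D F z v) y u) (D F y z)"
proof -
  let ?P = "\<lambda>y. adj B *v F y"
  note W = F[unfolded unit_horizontal_def]
  note adjB = unitary_adj[OF B]
  have "f y \<in> range (aff B) \<longleftrightarrow> ?P y $ None \<noteq> 0" if "y \<in> W" for y
    unfolding bspec[OF f that] by (rule hopf_in_range_aff[OF B]) (use W that in blast)
  then show U: "U = {y \<in> W. ?P y $ None \<noteq> 0}"
    unfolding U_def by blast
  have sP: "smooth_on W ?P"
    using W by (intro smooth_on_linear_compose[OF bounded_linear_matrix]) auto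
  have oU: "open U"
  proof -
    have "continuous_on W (\<lambda>y. ?P y $ None)"
      by (intro continuous_on_component smooth_on_continuous[OF sP])
    then have "open (W \<inter> (\<lambda>y. ?P y $ None) -` (- {0}))"
      using W continuous_on_open_vimage[of W "\<lambda>y. ?P y $ None"] by (auto simp: Int_commute)
    moreover have "W \<inter> (\<lambda>y. ?P y $ None) -` (- {0}) = U" by (auto simp: U)
    ultimately show ?thesis by simp
  qed
  have sPU: "smooth_on U ?P" by (rule smooth_on_subset[OF sP]) (auto simp: U)
  have h: "h y = quotients (?P y)" if "y \<in> U" for y
    using that W f inv_aff_hopf[OF B, of "F y"] by (auto simp: h_def U)
  have sh: "smooth_on U h"
    using smooth_on_quotients[OF oU sPU] smooth_on_cong[OF oU h] by (auto simp: U)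
  show hl: "homogeneous_lift U ?P (\<lambda>y. ?P y $ None) h"
    by unfold_locales (use oU sPU sh h join_quotients in \<open>auto simp: U\<close>)
  interpret homogeneous_lift U ?P "\<lambda>y. ?P y $ None" h by (rule hl)
  have DP: "D ?P y u = adj B *v D F y u" if "y \<in> W" for y u
    by (rule D_unitary[OF adjB]) (use W that smooth_on_differentiable in auto)
  have DDP: "D (\<lambda>y. D ?P y v) y u = adj B *v D (\<lambda>y. D F y v) y u" if "y \<in> W" for y u v
  proof -
    have "D (\<lambda>y. D ?P y v) y = D (\<lambda>y. adj B *v D F y v) y"
      by (rule D_cong[of W]) (use W that DP in auto)
    moreover have "(\<lambda>y. D F y v) differentiable (at y)"
      using W that by (blast intro: smooth_on_differentiable smooth_on_D)
    ultimately show ?thesis by (simp add: D_unitary[OF adjB])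
  qed
  fix y u v z assume "y \<in> U"
  then have y: "y \<in> U" "y \<in> W" by (auto simp: U)
  have n: "norm (?P y) = 1" "\<And>u. herm (D ?P y u) (?P y) = 0"
    using W y by (auto simp: DP norm_unitary[OF adjB] herm_unitary[OF adjB])
  have "herm (?P y) (?P y) = 1" by (simp only: herm_self n) simp
  then show "fs_herm (h y) (D h y u) (D h y v) = herm (D F y u) (D F y v)"
    using fs_herm_D[OF y(1), of u v] n y by (simp add: DP herm_unitary[OF adjB])
  show "fs_herm (h y) (cov_deriv (fubini_study B) h y u v) (D h y z)
      = herm (D (\<lambda>z. D F z v) y u) (D F y z)"
    using fs_herm_cov_deriv[OF y(1) n B] y by (simp add: DP DDP herm_unitary[OF adjB])
qed

text \<open>Removes the affine charts of projective space from all later arguments. By the preceding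
  lemma no condition depends on the chart \<open>B\<close> once expressed through the lift, and
  every point lies in the domain of some \<open>B\<close>.\<close>

theorem minimal_lagrangian_immersion_iff_lift:
  fixes \<A> :: "('p, 'e::euclidean_space) atlas"
    and f :: "'p \<Rightarrow> (complex^('m::finite option)) set"
  assumes dim: "DIM('e) = CARD('m)"
    and inj_c: "\<And>U c. (U, c) \<in> \<A> \<Longrightarrow> inj_on c U"
    and lift: "\<And>U c. (U, c) \<in> \<A> \<Longrightarrow> unit_horizontal (c ` U) (F U c)"
    and hopf: "\<And>U c y. (U, c) \<in> \<A> \<Longrightarrow> y \<in> c ` U \<Longrightarrow> f (inv_into U c y) = hopf (F U c y)"
  shows "minimal_lagrangian_immersion \<A> f \<longleftrightarrow>
    (\<forall>(U, c)\<in>\<A>. \<forall>y\<in>c ` U. lift_minimal_at (F U c) y)"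
proof -
  have chart: "open (coord_dom f U c B)" "smooth_on (coord_dom f U c B) (coord_rep f U c B)"
    "y \<in> coord_dom f U c B \<longleftrightarrow> y \<in> c ` U \<and> (adj B *v F U c y) $ None \<noteq> 0"
    "y \<in> coord_dom f U c B \<Longrightarrow> inj (D (coord_rep f U c B) y) \<longleftrightarrow> inj (D (F U c) y)"
    "y \<in> coord_dom f U c B \<Longrightarrow> (\<forall>u v. kaehler_form B (coord_rep f U c B y)
            (D (coord_rep f U c B) y u) (D (coord_rep f U c B) y v) = 0) \<longleftrightarrow>
       (\<forall>u v. Im (herm (D (F U c) y u) (D (F U c) y v)) = 0)"
    "y \<in> coord_dom f U c B \<Longrightarrow> inj (D (F U c) y) \<Longrightarrow>
       (\<forall>u v. Im (herm (D (F U c) y u) (D (F U c) y v)) = 0) \<Longrightarrow>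
       mean_curvature (fubini_study B) (coord_rep f U c B) y = 0 \<longleftrightarrow> (\<forall>w. lift_mean (F U c) y w = 0)"
    if A: "(U, c) \<in> \<A>" and B: "unitary B" for U c B y
  proof -
    let ?W = "c ` U" and ?F = "F U c"
    define g where "g = f \<circ> inv_into U c"
    have g: "\<forall>y\<in>?W. g y = hopf (?F y)"
      using hopf[OF A] by (simp add: g_def)
    define V where "V = {y \<in> ?W. g y \<in> range (aff B)}"
    define h where "h = inv (aff B) \<circ> g"
    have V: "coord_dom f U c B = V" by (simp add: coord_dom_def V_def g_def)
    have h: "coord_rep f U c B = h" by (simp add: coord_rep_def h_def g_def comp_assoc)
    note uc = unit_horizontal_chart[OF lift[OF A] B g, folded V_def h_def]
    interpret homogeneous_lift V "\<lambda>y. adj B *v ?F y" "\<lambda>y. (adj B *v ?F y) $ None" h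
      by (rule uc(2))
    show "open (coord_dom f U c B)" "smooth_on (coord_dom f U c B) (coord_rep f U c B)"
      "y \<in> coord_dom f U c B \<longleftrightarrow> y \<in> c ` U \<and> (adj B *v F U c y) $ None \<noteq> 0"
      unfolding V h using open_U smooth_h uc(1) by auto
    assume "y \<in> coord_dom f U c B"
    then have y: "y \<in> V" "y \<in> ?W" unfolding V by (auto simp: V_def)
    have lh: "linear (D h y)"
      by (intro linear_frechet_derivative smooth_on_differentiable[OF smooth_h y(1)])
    have lF: "linear (D ?F y)"
      using lift[OF A] y(2)
      by (intro linear_frechet_derivative) (auto simp: unit_horizontal_def smooth_on_differentiable)
    \<comment> \<open>Both vectors have the same length, one in the Fubini-Study metric and the
      other in the Euclidean one, so the two differentials have the same kernel.\<close>
    have z: "D h y u = 0 \<longleftrightarrow> D ?F y u = 0" for u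
    proof -
      have "D h y u = 0 \<longleftrightarrow> Re (fs_herm (h y) (D h y u) (D h y u)) = 0"
        using fs_herm_pos[of "D h y u" "h y"] by (force simp: fs_herm_simps)
      also have "\<dots> \<longleftrightarrow> D ?F y u = 0"
        by (simp add: uc(3)[OF y(1)] herm_self)
      finally show ?thesis .
    qed
    show inj: "inj (D (coord_rep f U c B) y) \<longleftrightarrow> inj (D (F U c) y)"
      unfolding h linear_injective_0[OF lh] linear_injective_0[OF lF] z ..
    show "(\<forall>u v. kaehler_form B (coord_rep f U c B y)
            (D (coord_rep f U c B) y u) (D (coord_rep f U c B) y v) = 0) \<longleftrightarrow>
       (\<forall>u v. Im (herm (D (F U c) y u) (D (F U c) y v)) = 0)"
      unfolding h kaehler_form_eq[OF B] uc(3)[OF y(1)] by simp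
    assume injF: "inj (D ?F y)" and lagF: "\<forall>u v. Im (herm (D ?F y u) (D ?F y v)) = 0"
    have "induced_sharp (fubini_study B) h y b = lift_sharp ?F y b" for b
      unfolding induced_sharp_def lift_sharp_def fubini_study_eq[OF B] uc(3)[OF y(1)]
        inner_eq_Re_herm[symmetric] ..
    then show "mean_curvature (fubini_study B) (coord_rep f U c B) y = 0 \<longleftrightarrow>
        (\<forall>w. lift_mean (F U c) y w = 0)"
      using mean_curvature_eq_0_iff[OF B dim lh] inj injF lagF
      unfolding h lift_mean_def by (simp add: uc(3,4)[OF y(1)])
  qed
  have CP: "f ` U \<subseteq> CP" if A: "(U, c) \<in> \<A>" for U c
  proof
    fix q assume "q \<in> f ` U"
    then obtain x where x: "x \<in> U" "q = f x" by auto
    then have "q = hopf (F U c (c x))"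
      using hopf[OF A, of "c x"] inj_c[OF A] by (auto simp: inv_into_f_f)
    moreover have "norm (F U c (c x)) = 1"
      using lift[OF A] x by (auto simp: unit_horizontal_def)
    ultimately show "q \<in> CP" by (auto simp: CP_def)
  qed
  have cover: "\<exists>B. unitary B \<and> y \<in> coord_dom f U c B" if A: "(U, c) \<in> \<A>" and y: "y \<in> c ` U" for U c y
  proof -
    have "F U c y \<noteq> 0" using lift[OF A] y by (auto simp: unit_horizontal_def)
    then show ?thesis using exists_unitary_chart chart(3)[OF A] y by metis
  qed
  have pt: "(\<forall>B. unitary B \<longrightarrow> (\<forall>y\<in>coord_dom f U c B. inj (D (coord_rep f U c B) y) \<and>
      (\<forall>u v. kaehler_form B (coord_rep f U c B y)
            (D (coord_rep f U c B) y u) (D (coord_rep f U c B) y v) = 0) \<and>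
      mean_curvature (fubini_study B) (coord_rep f U c B) y = 0)) \<longleftrightarrow>
    (\<forall>y\<in>c ` U. lift_minimal_at (F U c) y)" (is "?l \<longleftrightarrow> ?r") if A: "(U, c) \<in> \<A>" for U c
  proof
    assume l: ?l
    show ?r
    proof
      fix y assume "y \<in> c ` U"
      then obtain B where B: "unitary B" "y \<in> coord_dom f U c B" using cover[OF A] by blast
      have i: "inj (D (F U c) y)" using l B chart(4)[OF A B] by blast
      have k: "\<forall>u v. Im (herm (D (F U c) y u) (D (F U c) y v)) = 0"
        using l B chart(5)[OF A B] by blast
      have "\<forall>w. lift_mean (F U c) y w = 0" using l B chart(6)[OF A B i k] by blast
      then show "lift_minimal_at (F U c) y" using i k by (simp add: lift_minimal_at_def)
    qed
  next
    assume r: ?r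
    show ?l
    proof (intro allI impI ballI)
      fix B y assume B: "unitary B" "y \<in> coord_dom f U c B"
      then have "y \<in> c ` U" using chart(3)[OF A] by blast
      then have m: "inj (D (F U c) y)" "\<forall>u v. Im (herm (D (F U c) y u) (D (F U c) y v)) = 0"
        "\<forall>w. lift_mean (F U c) y w = 0"
        using r by (auto simp: lift_minimal_at_def)
      show "inj (D (coord_rep f U c B) y) \<and>
          (\<forall>u v. kaehler_form B (coord_rep f U c B y)
            (D (coord_rep f U c B) y u) (D (coord_rep f U c B) y v) = 0) \<and>
          mean_curvature (fubini_study B) (coord_rep f U c B) y = 0"
        using chart(4)[OF A B] chart(5)[OF A B] chart(6)[OF A B m(1,2)] m by blast
    qed
  qed
  show ?thesis
  proof
    assume m: "minimal_lagrangian_immersion \<A> f"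
    show "\<forall>(U, c)\<in>\<A>. \<forall>y\<in>c ` U. lift_minimal_at (F U c) y"
    proof clarify
      fix U c x assume A: "(U, c) \<in> \<A>" and x: "x \<in> U"
      have "\<forall>y\<in>c ` U. lift_minimal_at (F U c) y"
        unfolding pt[OF A, symmetric]
        using m A unfolding minimal_lagrangian_immersion_def immersion_to_CP_def lagrangian_def
          minimal_def by fast
      then show "lift_minimal_at (F U c) (c x)" using x by blast
    qed
  next
    assume m: "\<forall>(U, c)\<in>\<A>. \<forall>y\<in>c ` U. lift_minimal_at (F U c) y"
    have *: "\<forall>B. unitary B \<longrightarrow> (\<forall>y\<in>coord_dom f U c B. inj (D (coord_rep f U c B) y) \<and>
      (\<forall>u v. kaehler_form B (coord_rep f U c B y)
            (D (coord_rep f U c B) y u) (D (coord_rep f U c B) y v) = 0) \<and>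
      mean_curvature (fubini_study B) (coord_rep f U c B) y = 0)" if A: "(U, c) \<in> \<A>" for U c
      unfolding pt[OF A] using m A by blast
    have CP': "f x \<in> CP" if "(U, c) \<in> \<A>" "x \<in> U" for U c x
      using CP that by blast
    show "minimal_lagrangian_immersion \<A> f"
      unfolding minimal_lagrangian_immersion_def immersion_to_CP_def lagrangian_def
        minimal_def smooth_to_CP_def
      using * dim CP' chart(1,2) by (auto intro: CP')
  qed
qed

section \<open>Horizontal lifts over a Legendre curve\<close>

lemma lift_sharp_unique:
  assumes "linear (D F y)" "inj (D F y)" "\<And>v. D F y a \<bullet> D F y v = b \<bullet> v"
  shows "lift_sharp F y b = a"
  unfolding lift_sharp_def
proof (rule the_equality)
  show "\<forall>v. D F y a \<bullet> D F y v = b \<bullet> v" using assms(3) by blast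
next
  fix a' assume a': "\<forall>v. D F y a' \<bullet> D F y v = b \<bullet> v"
  have "D F y a' \<bullet> D F y (a' - a) = D F y a \<bullet> D F y (a' - a)"
    using a' assms(3) by simp
  then have "(D F y a' - D F y a) \<bullet> D F y (a' - a) = 0"
    by (simp add: inner_diff_left)
  then have "D F y (a' - a) \<bullet> D F y (a' - a) = 0"
    by (simp add: linear_diff[OF assms(1)])
  then have "a' - a = 0" using assms(1,2) by (metis inner_eq_zero_iff linear_injective_0)
  then show "a' = a" by simp
qed

text \<open>The Gram operator \<open>T\<close> of the induced metric is injective, hence surjective
  in finite dimension; the vector with image \<open>b\<close> is the one described by
  \<open>lift_sharp\<close>.\<close>

lemma lift_sharp_works:
  fixes F :: "'e::euclidean_space \<Rightarrow> complex^'k::finite"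
  assumes "linear (D F y)" "inj (D F y)"
  shows "D F y (lift_sharp F y b) \<bullet> D F y v = b \<bullet> v"
proof -
  define T where "T a = (\<Sum>e\<in>Basis. (D F y a \<bullet> D F y e) *\<^sub>R e)" for a
  have T: "T a \<bullet> v = D F y a \<bullet> D F y v" for a v
  proof -
    have "D F y v = D F y (\<Sum>e\<in>Basis. (v \<bullet> e) *\<^sub>R e)" by (simp add: euclidean_representation)
    then show ?thesis
      by (simp add: T_def linear_sum[OF assms(1)] linear_scale[OF assms(1)] inner_sum_left
          inner_sum_right inner_commute mult.commute)
  qed
  have lT: "linear T"
    by (intro linearI) (auto simp: T_def linear_add[OF assms(1)] linear_scale[OF assms(1)]
        inner_add_left scaleR_add_left sum.distrib scaleR_sum_right)
  have "inj T"
    unfolding linear_injective_0[OF lT]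
  proof (intro allI impI)
    fix a assume "T a = 0"
    then have "D F y a \<bullet> D F y a = 0" using T[of a a] by simp
    then show "a = 0" using assms by (simp add: linear_injective_0)
  qed
  then have "surj T" using lT by (simp add: linear_injective_imp_surjective)
  then obtain a where "T a = b" by (metis surjD)
  then have "\<And>v. D F y a \<bullet> D F y v = b \<bullet> v" using T by auto
  with lift_sharp_unique[OF assms] show ?thesis by metis
qed

lemma sum_Basis_prod:
  fixes f :: "'a::euclidean_space \<times> 'b::euclidean_space \<Rightarrow> 'c::comm_monoid_add"
  shows "sum f Basis = (\<Sum>i\<in>Basis. f (i, 0)) + (\<Sum>i\<in>Basis. f (0, i))"
proof -
  have "inj_on (\<lambda>u. (u::'a, 0::'b)) Basis" "inj_on (\<lambda>u. (0::'a, u::'b)) Basis"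
    by (auto intro!: inj_onI)
  then show ?thesis
    unfolding Basis_prod_def
    by (subst sum.union_disjoint) (auto simp: Basis_prod_def sum.reindex)
qed

lemma of_real_cmod_square: "(complex_of_real (cmod z))\<^sup>2 = z * cnj z"
  by (simp add: complex_norm_square[symmetric] flip: of_real_power)

lemma Im_of_real_mult: "Im (of_real r * z) = r * Im z"
  by simp

text \<open>The first and second derivatives are parameters, so that the examples can supply them in
  closed form.\<close>

locale legendre_pair =
  fixes I :: "real set" and g1 g2 v1 v2 w1 w2 :: "real \<Rightarrow> complex"
  assumes open_I: "open I" and smooth_g: "smooth_on I g1" "smooth_on I g2"
    and v: "s \<in> I \<Longrightarrow> (g1 has_vector_derivative v1 s) (at s)"
      "s \<in> I \<Longrightarrow> (g2 has_vector_derivative v2 s) (at s)"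
    and w: "s \<in> I \<Longrightarrow> (v1 has_vector_derivative w1 s) (at s)"
      "s \<in> I \<Longrightarrow> (v2 has_vector_derivative w2 s) (at s)"
    and unit: "s \<in> I \<Longrightarrow> g1 s * cnj (g1 s) + g2 s * cnj (g2 s) = 1"
    and legendre: "s \<in> I \<Longrightarrow> v1 s * cnj (g1 s) + v2 s * cnj (g2 s) = 0"

lemma legendre_pair_subset:
  "legendre_pair J g1 g2 v1 v2 w1 w2 \<Longrightarrow> open I \<Longrightarrow> I \<subseteq> J \<Longrightarrow> legendre_pair I g1 g2 v1 v2 w1 w2"
  unfolding legendre_pair_def by (meson smooth_on_subset subsetD)

text \<open>The trace of the second fundamental form paired with \<open>\<i>\<close> times the curve
  direction. The first summand comes from the curve direction itself, the second from
  \<open>d\<close> equal contributions of the directions of the manifold.\<close>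

definition curve_minimal ::
    "real \<Rightarrow> complex \<Rightarrow> complex \<Rightarrow> complex \<Rightarrow> complex \<Rightarrow> complex \<Rightarrow> bool"
  where "curve_minimal d g1 v1 v2 w1 w2 \<longleftrightarrow>
    Im (w1 * cnj v1 + w2 * cnj v2) / ((cmod v1)\<^sup>2 + (cmod v2)\<^sup>2)
      + d * Im (v1 * cnj g1) / (cmod g1)\<^sup>2 = 0"

locale curve_lift = legendre_pair I g1 g2 v1 v2 w1 w2
  for I g1 g2 v1 v2 w1 w2 +
  fixes W :: "'e::euclidean_space set" and p :: "'e \<Rightarrow> complex^'k::finite"
  assumes p: "unit_horizontal W p"
begin

definition F :: "real \<times> 'e \<Rightarrow> complex^('k option)"
  where "F = (\<lambda>z. join (g1 (fst z) *s p (snd z)) (g2 (fst z)))"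

lemma open_W: "open W" and smooth_p: "smooth_on W p"
  and norm_p: "y \<in> W \<Longrightarrow> norm (p y) = 1"
  and herm_Dp_p: "y \<in> W \<Longrightarrow> herm (D p y u) (p y) = 0"
  using p by (auto simp: unit_horizontal_def)

lemma herm_p_p: "y \<in> W \<Longrightarrow> herm (p y) (p y) = 1"
  by (simp only: herm_self norm_p) simp

lemma herm_p_Dp: "y \<in> W \<Longrightarrow> herm (p y) (D p y u) = 0"
  using herm_Dp_p herm_commute by (metis complex_cnj_zero)

lemma linear_Dp: "y \<in> W \<Longrightarrow> linear (D p y)"
  by (intro linear_frechet_derivative smooth_on_differentiable[OF smooth_p])

lemma open_dom: "open (I \<times> W)"
  by (intro open_Times open_I open_W)

lemma smooth_F: "smooth_on (I \<times> W) F"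
proof -
  have sf: "smooth_on (I \<times> W) fst" and ss: "smooth_on (I \<times> W) snd"
    by (intro smooth_on_bounded_linear open_dom bounded_linear_fst bounded_linear_snd)+
  have "smooth_on (I \<times> W) (\<lambda>z. g1 (fst z))" "smooth_on (I \<times> W) (\<lambda>z. g2 (fst z))"
    "smooth_on (I \<times> W) (\<lambda>z. p (snd z))"
    by (auto intro!: smooth_on_compose[OF open_dom smooth_g(1) sf]
        smooth_on_compose[OF open_dom smooth_g(2) sf] smooth_on_compose[OF open_dom smooth_p ss])
  then have "smooth_on (I \<times> W) (\<lambda>z. (g1 (fst z) *s p (snd z), g2 (fst z)))"
    by (intro smooth_on_Pair open_dom smooth_on_bilinear[OF bounded_bilinear_smult])
  from smooth_on_linear_compose[OF bounded_linear_join open_dom this]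
  show ?thesis by (simp add: F_def)
qed

lemma has_derivative_fst_compose:
  "(g has_vector_derivative g') (at (fst z)) \<Longrightarrow>
    ((\<lambda>z. g (fst z)) has_derivative (\<lambda>h. fst h *\<^sub>R g')) (at (z :: real \<times> 'e))"
  unfolding has_vector_derivative_def
  by (rule has_derivative_compose[OF has_derivative_fst[OF has_derivative_ident]]) simp

lemma has_derivative_snd_compose:
  fixes z :: "real \<times> 'e"
  shows "g differentiable (at (snd z)) \<Longrightarrow>
    ((\<lambda>z. g (snd z)) has_derivative (\<lambda>h. D g (snd z) (snd h))) (at z)"
  by (rule has_derivative_compose[OF has_derivative_snd[OF has_derivative_ident]]) (simp add: D_works)

lemma D_F:
  assumes "s \<in> I" "y \<in> W"
  shows "D F (s, y) (a, u) =
    join ((of_real a * v1 s) *s p y + g1 s *s D p y u) (of_real a * v2 s)"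
proof -
  have "(F has_derivative (\<lambda>h. join (g1 s *s D p y (snd h) + (fst h *\<^sub>R v1 s) *s p y)
      (fst h *\<^sub>R v2 s))) (at (s, y))"
    unfolding F_def
    using has_derivative_join[OF has_derivative_smult[OF
        has_derivative_fst_compose[of g1 "v1 s" "(s, y)"]
        has_derivative_snd_compose[of p "(s, y)"]] has_derivative_fst_compose[of g2 "v2 s" "(s, y)"]]
      v[OF assms(1)] smooth_on_differentiable[OF smooth_p assms(2)] by simp
  from D_eq[OF this] show ?thesis by (simp add: add.commute scaleR_conv_of_real)
qed

lemma D_D_F:
  assumes "s \<in> I" "y \<in> W"
  shows "D (\<lambda>z. D F z (b, x)) (s, y) (a, u) =
    join ((of_real a * of_real b * w1 s) *s p y + (of_real b * v1 s) *s D p y u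
      + (of_real a * v1 s) *s D p y x + g1 s *s D (\<lambda>z. D p z x) y u)
      (of_real a * of_real b * w2 s)"
proof -
  let ?G = "\<lambda>z. join ((of_real b * v1 (fst z)) *s p (snd z) + g1 (fst z) *s D p (snd z) x)
    (of_real b * v2 (fst z))"
  have "D (\<lambda>z. D F z (b, x)) (s, y) = D ?G (s, y)"
    by (rule D_cong[OF open_dom]) (use assms D_F in auto)
  also have "\<dots> = (\<lambda>h. join (((of_real b * v1 s) *s D p y (snd h) + (of_real b * (fst h *\<^sub>R w1 s)) *s p y)
      + (g1 s *s D (\<lambda>z. D p z x) y (snd h) + (fst h *\<^sub>R v1 s) *s D p y x))
      (of_real b * (fst h *\<^sub>R w2 s)))"
    using has_derivative_join[OF has_derivative_add[OF has_derivative_smult[OF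
          has_derivative_mult_right[OF has_derivative_fst_compose[of v1 "w1 s" "(s, y)"], of "of_real b"]
          has_derivative_snd_compose[of p "(s, y)"]]
        has_derivative_smult[OF has_derivative_fst_compose[of g1 "v1 s" "(s, y)"]
          has_derivative_snd_compose[of "\<lambda>z. D p z x" "(s, y)"]]]
        has_derivative_mult_right[OF has_derivative_fst_compose[of v2 "w2 s" "(s, y)"], of "of_real b"]]
      v[OF assms(1)] w[OF assms(1)] smooth_on_differentiable[OF smooth_p assms(2)]
      smooth_on_differentiable[OF smooth_on_D[OF smooth_p] assms(2)]
    by (intro D_eq) simp
  finally show ?thesis by (simp add: scaleR_conv_of_real algebra_simps)
qed

text \<open>Horizontality of \<open>p\<close> removes the mixed terms: the induced metric is a
  warped product with warping factor \<open>cmod (g1 s)\<close>.\<close>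

lemma herm_D_F:
  assumes "s \<in> I" "y \<in> W"
  shows "herm (D F (s, y) (a, u)) (D F (s, y) (b, x)) =
    of_real (a * b * ((cmod (v1 s))\<^sup>2 + (cmod (v2 s))\<^sup>2))
      + of_real ((cmod (g1 s))\<^sup>2) * herm (D p y u) (D p y x)"
  using assms
  by (simp add: D_F herm_join herm_simps herm_p_p herm_p_Dp herm_Dp_p of_real_cmod_square algebra_simps)

lemma unit_horizontal_F: "unit_horizontal (I \<times> W) F"
  unfolding unit_horizontal_def
proof (intro conjI open_dom smooth_F ballI allI)
  fix z assume z: "z \<in> I \<times> W"
  obtain s y where sy: "z = (s, y)" "s \<in> I" "y \<in> W" using z by auto
  have "herm (F z) (F z) = 1"
    using sy unit[of s] by (simp add: F_def herm_join herm_simps herm_p_p mult.commute)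
  then have "(norm (F z))\<^sup>2 = 1" by (metis herm_self of_real_eq_1_iff)
  then show "norm (F z) = 1" by (simp add: power2_eq_1_iff) (metis norm_ge_zero not_one_le_zero neg_0_le_iff_le zero_le_one order.trans)
  fix u :: "real \<times> 'e"
  obtain a x where u: "u = (a, x)" by force
  have "herm (D F z u) (F z) = of_real a * (v1 s * cnj (g1 s) + v2 s * cnj (g2 s))"
  proof -
    have "F (s, y) = join (g1 s *s p y) (g2 s)" by (simp add: F_def)
    then show ?thesis
      using sy by (simp add: u D_F herm_join herm_simps herm_p_p herm_Dp_p algebra_simps)
  qed
  then show "herm (D F z u) (F z) = 0" by (simp add: legendre[OF sy(2)])
qed

text \<open>Differentiating the horizontality equation of \<open>p\<close> along \<open>u\<close>.
  This is how second derivatives of \<open>p\<close> acquire a component along \<open>p\<close>,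
  which couples the manifold to the curve.\<close>

lemma herm_D_D_p:
  assumes "y \<in> W"
  shows "herm (D (\<lambda>z. D p z x) y u) (p y) = - herm (D p y x) (D p y u)"
proof -
  have "((\<lambda>z. herm (D p z x) (p z)) has_derivative
      (\<lambda>u. herm (D p y x) (D p y u) + herm (D (\<lambda>z. D p z x) y u) (p y))) (at y)"
    by (intro has_derivative_herm smooth_on_has_derivative[OF smooth_p assms]
        smooth_on_has_derivative[OF smooth_on_D[OF smooth_p] assms])
  then have "D (\<lambda>z. herm (D p z x) (p z)) y u
      = herm (D p y x) (D p y u) + herm (D (\<lambda>z. D p z x) y u) (p y)"
    by (simp add: D_eq)
  moreover have "D (\<lambda>z. herm (D p z x) (p z)) y = D (\<lambda>z. 0) y"
    by (rule D_cong[OF open_W assms herm_Dp_p])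
  ultimately show ?thesis by (simp add: eq_neg_iff_add_eq_0 add.commute)
qed

lemma D_D_p_scaleR:
  assumes "y \<in> W"
  shows "D (\<lambda>z. D p z (r *\<^sub>R x)) y u = r *\<^sub>R D (\<lambda>z. D p z x) y u"
proof -
  have "D (\<lambda>z. D p z (r *\<^sub>R x)) y = D (\<lambda>z. r *\<^sub>R D p z x) y"
    by (rule D_cong[OF open_W assms]) (simp add: linear_scale linear_Dp)
  also have "\<dots> = (\<lambda>u. r *\<^sub>R D (\<lambda>z. D p z x) y u)"
    by (intro D_eq has_derivative_scaleR_right smooth_on_has_derivative[OF smooth_on_D[OF smooth_p] assms])
  finally show ?thesis by simp
qed

text \<open>The induced metric is block diagonal, so the trace splits. If \<open>g1 s = 0\<close>,
  the manifold directions are annihilated and the map is not an immersion. Otherwise the trace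
  paired with \<open>(k, x)\<close> is \<open>k\<close> times the curve expression plus the
  corresponding trace for \<open>p\<close>, and the latter is 0 by hypothesis.\<close>

theorem lift_minimal_at_iff:
  assumes s: "s \<in> I" and y: "y \<in> W" and p_min: "lift_minimal_at p y"
    and reg: "v1 s \<noteq> 0 \<or> v2 s \<noteq> 0"
  shows "lift_minimal_at F (s, y) \<longleftrightarrow>
    g1 s \<noteq> 0 \<and> curve_minimal DIM('e) (g1 s) (v1 s) (v2 s) (w1 s) (w2 s)"
proof -
  define l where "l = (cmod (v1 s))\<^sup>2 + (cmod (v2 s))\<^sup>2"
  define c where "c = (cmod (g1 s))\<^sup>2"
  have l: "l > 0" using reg by (auto simp: l_def add_pos_nonneg add_nonneg_pos)
  note hF = herm_D_F[OF s y, folded l_def c_def]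
  have inj_p: "inj (D p y)" and real_p: "\<And>u v. Im (herm (D p y u) (D p y v)) = 0"
    and mean_p: "\<And>w. lift_mean p y w = 0"
    using p_min by (auto simp: lift_minimal_at_def)
  have lin_F: "linear (D F (s, y))"
    by (intro linear_frechet_derivative smooth_on_differentiable[OF smooth_F]) (use s y in auto)
  have g1: "g1 s \<noteq> 0" if "inj (D F (s, y))"
  proof
    assume "g1 s = 0"
    then have c: "c = 0" by (simp add: c_def)
    obtain e :: 'e where e: "e \<in> Basis" using nonempty_Basis by blast
    have "D F (s, y) (0, e) \<bullet> D F (s, y) (0, e) = 0"
      unfolding inner_eq_Re_herm hF c by simp
    then have "(0::real, e) = 0" using that lin_F by (simp add: linear_injective_0)
    then show False using e by (simp add: zero_prod_def nonzero_Basis)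
  qed
  have main: "inj (D F (s, y)) \<and> (\<forall>w. lift_mean F (s, y) w = 0) \<longleftrightarrow>
    curve_minimal DIM('e) (g1 s) (v1 s) (v2 s) (w1 s) (w2 s)" if "g1 s \<noteq> 0"
  proof -
    have c: "c > 0" using that by (simp add: c_def)
    have inj_F: "inj (D F (s, y))"
      unfolding linear_injective_0[OF lin_F]
    proof (intro allI impI)
      fix q assume q: "D F (s, y) q = 0"
      obtain a u where au: "q = (a, u)" by force
      have "D F (s, y) q \<bullet> D F (s, y) q = a\<^sup>2 * l + c * (D p y u \<bullet> D p y u)"
        unfolding inner_eq_Re_herm au hF by (simp add: power2_eq_square)
      then have "a\<^sup>2 * l + c * (norm (D p y u))\<^sup>2 = 0" by (simp add: q power2_norm_eq_inner)
      then have "a\<^sup>2 * l = 0 \<and> c * (norm (D p y u))\<^sup>2 = 0"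
        using l c by (subst (asm) add_nonneg_eq_0_iff) auto
      then have "a = 0" "D p y u = 0" using l c by auto
      then show "q = 0" using inj_p linear_Dp[OF y] by (simp add: au linear_injective_0 zero_prod_def)
    qed
    have sharp: "lift_sharp F (s, y) (a, e) = (a / l, (1 / c) *\<^sub>R lift_sharp p y e)" for a e
    proof (rule lift_sharp_unique[OF lin_F inj_F])
      fix q :: "real \<times> 'e"
      obtain b x where q: "q = (b, x)" by force
      have "herm (D F (s, y) (a / l, (1 / c) *\<^sub>R lift_sharp p y e)) (D F (s, y) q)
          = of_real (a * b) + herm (D p y (lift_sharp p y e)) (D p y x)"
        unfolding q hF using l c
        by (simp add: linear_scale[OF linear_Dp[OF y]] herm_simps)
      then show "D F (s, y) (a / l, (1 / c) *\<^sub>R lift_sharp p y e) \<bullet> D F (s, y) q = (a, e) \<bullet> q"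
        using lift_sharp_works[OF linear_Dp[OF y] inj_p, of e x]
        by (simp add: inner_eq_Re_herm q inner_complex_def)
    qed
    have t1: "herm (D (\<lambda>z. D F z (b, 0)) (s, y) (1, 0)) (D F (s, y) (k, x)) =
        of_real (b * k) * (w1 s * cnj (v1 s) + w2 s * cnj (v2 s))" for b k x
    proof -
      have "D p y 0 = 0" by (rule linear_0[OF linear_Dp[OF y]])
      moreover have "D (\<lambda>z. D p z 0) y u = 0" for u
        using D_D_p_scaleR[OF y, of 0 0 u] by simp
      ultimately show ?thesis
        using s y by (simp add: D_D_F D_F herm_join herm_simps herm_p_p herm_p_Dp algebra_simps)
    qed
    have t2: "Im (herm (D (\<lambda>z. D F z (0, r *\<^sub>R lift_sharp p y e)) (s, y) (0, e)) (D F (s, y) (k, x))) =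
        k * r * Im (v1 s * cnj (g1 s)) + r * c * Im (herm (D (\<lambda>z. D p z (lift_sharp p y e)) y e) (D p y x))"
      if e: "e \<in> Basis" for r k x e
    proof -
      \<comment> \<open>Each basis vector is paired with its own dual vector, so each contributes
        the same amount and the sum over the basis produces the factor
        \<open>DIM('e)\<close>.\<close>
      have re: "herm (D p y (lift_sharp p y e)) (D p y e) = 1"
        using lift_sharp_works[OF linear_Dp[OF y] inj_p, of e e] real_p e
        by (simp add: complex_eq_iff inner_eq_Re_herm[symmetric])
      have "herm (D (\<lambda>z. D F z (0, r *\<^sub>R lift_sharp p y e)) (s, y) (0, e)) (D F (s, y) (k, x)) =
        of_real (k * r) * (- (g1 s * cnj (v1 s)))
          + of_real (r * c) * herm (D (\<lambda>z. D p z (lift_sharp p y e)) y e) (D p y x)"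
        using s y
        by (simp add: D_D_F D_F herm_join herm_simps D_D_p_scaleR herm_D_D_p re c_def
            of_real_cmod_square algebra_simps)
      then have "Im (herm (D (\<lambda>z. D F z (0, r *\<^sub>R lift_sharp p y e)) (s, y) (0, e)) (D F (s, y) (k, x))) =
        k * r * Im (- (g1 s * cnj (v1 s))) + r * c * Im (herm (D (\<lambda>z. D p z (lift_sharp p y e)) y e) (D p y x))"
        by (simp only: plus_complex.sel Im_of_real_mult)
      then show ?thesis by (simp add: algebra_simps)
    qed
    have mean: "lift_mean F (s, y) (k, x) = k * (Im (w1 s * cnj (v1 s) + w2 s * cnj (v2 s)) / l
        + DIM('e) * Im (v1 s * cnj (g1 s)) / c)" for k x
    proof -
      have z: "lift_sharp p y 0 = 0"
        by (rule lift_sharp_unique[OF linear_Dp[OF y] inj_p]) (simp add: linear_0[OF linear_Dp[OF y]])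
      have "lift_mean F (s, y) (k, x) =
        Im (herm (D (\<lambda>z. D F z (1 / l, 0)) (s, y) (1, 0)) (D F (s, y) (k, x)))
        + (\<Sum>e\<in>Basis. Im (herm (D (\<lambda>z. D F z (0, (1 / c) *\<^sub>R lift_sharp p y e)) (s, y) (0, e))
            (D F (s, y) (k, x))))"
        by (simp add: lift_mean_def sum_Basis_prod sharp z)
      also have "(\<Sum>e\<in>Basis. Im (herm (D (\<lambda>z. D F z (0, (1 / c) *\<^sub>R lift_sharp p y e)) (s, y) (0, e))
            (D F (s, y) (k, x)))) = (\<Sum>e\<in>Basis. k * (1 / c) * Im (v1 s * cnj (g1 s)) +
           1 / c * c * Im (herm (D (\<lambda>z. D p z (lift_sharp p y e)) y e) (D p y x)))"
        by (rule sum.cong[OF refl t2])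
      also have "Im (herm (D (\<lambda>z. D F z (1 / l, 0)) (s, y) (1, 0)) (D F (s, y) (k, x))) + \<dots>
        = k * Im (w1 s * cnj (v1 s) + w2 s * cnj (v2 s)) / l
        + DIM('e) * (k * (1 / c) * Im (v1 s * cnj (g1 s))) + lift_mean p y x"
        unfolding t1 lift_mean_def using c by (simp add: sum.distrib)
      finally show ?thesis using mean_p by (simp add: field_simps)
    qed
    have "(\<forall>q. lift_mean F (s, y) q = 0) \<longleftrightarrow>
        curve_minimal DIM('e) (g1 s) (v1 s) (v2 s) (w1 s) (w2 s)"
      unfolding split_paired_All mean curve_minimal_def l_def c_def
      by (metis mult_1 mult_zero_right)
    then show ?thesis using inj_F by blast
  qed
  have "Im (herm (D F (s, y) u) (D F (s, y) v)) = 0" for u v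
    by (cases u, cases v) (simp add: hF real_p)
  then show ?thesis unfolding lift_minimal_at_def using g1 main by blast
qed

end

section \<open>From charts of the product manifold to a condition on the curve alone\<close>

lemma unit_horizontal_cong:
  assumes "unit_horizontal W F" "\<And>y. y \<in> W \<Longrightarrow> F y = G y"
  shows "unit_horizontal W G"
proof -
  have W: "open W" using assms(1) by (simp add: unit_horizontal_def)
  have "D F y = D G y" if "y \<in> W" for y by (rule D_cong[OF W that assms(2)])
  then show ?thesis
    using assms W smooth_on_cong[OF W assms(2)] by (simp add: unit_horizontal_def)
qed

lemma lift_minimal_at_cong:
  assumes W: "open W" "y \<in> W" and eq: "\<And>y. y \<in> W \<Longrightarrow> F y = G y"
  shows "lift_minimal_at F y \<longleftrightarrow> lift_minimal_at G y"
proof -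
  have DF: "D F z = D G z" if "z \<in> W" for z by (rule D_cong[OF W(1) that eq])
  have "D (\<lambda>z. D F z x) y = D (\<lambda>z. D G z x) y" for x
    by (rule D_cong[OF W]) (simp add: DF)
  then show ?thesis
    by (simp add: lift_minimal_at_def lift_mean_def lift_sharp_def DF[OF W(2)])
qed

lemma inv_into_map_prod:
  assumes "inj_on c U" "s \<in> I" "y \<in> c ` U"
  shows "inv_into (I \<times> U) (map_prod id c) (s, y) = (s, inv_into U c y)"
  by (rule inv_into_f_eq)
    (use assms in \<open>auto intro!: map_prod_inj_on simp: inv_into_into f_inv_into_f\<close>)

lemma smooth_atlas_chart:
  assumes "smooth_atlas \<A>" "(U, c) \<in> \<A>"
  shows "inj_on c U" "open (c ` U)"
proof -
  from assms have h: "homeomorphism U (c ` U) c (inv_into U c)" and o: "open (c ` U)"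
    by (auto simp: smooth_atlas_def)
  show "open (c ` U)" by fact
  show "inj_on c U"
    using h unfolding homeomorphism_def by (metis inj_on_inverseI)
qed

text \<open>The definition of a horizontal lift supplies the imaginary part of the Hermitian
  condition; the real part follows by differentiating the constant norm.\<close>

lemma horizontal_lift_unit_horizontal:
  assumes "smooth_atlas \<A>" "horizontal_lift \<A> \<phi> \<psi>" "(U, c) \<in> \<A>"
  shows "unit_horizontal (c ` U) (\<psi> \<circ> inv_into U c)"
proof -
  let ?p = "\<psi> \<circ> inv_into U c" and ?W = "c ` U"
  have W: "open ?W" and sm: "smooth_on ?W ?p" and n: "\<And>y. norm (?p y) = 1"
    and im: "\<And>y u. y \<in> ?W \<Longrightarrow> Im (herm (D ?p y u) (?p y)) = 0"
    using assms smooth_atlas_chart[OF assms(1,3)]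
    by (auto simp: horizontal_lift_def inner_i_eq_Im_herm)
  have "herm (D ?p y u) (?p y) = 0" if y: "y \<in> ?W" for y u
  proof -
    have d: "(?p has_derivative D ?p y) (at y)" by (rule smooth_on_has_derivative[OF sm y])
    have const: "(\<lambda>y. ?p y \<bullet> ?p y) = (\<lambda>y. 1)"
      by (simp only: power2_norm_eq_inner[symmetric] n) simp
    have "((\<lambda>y. ?p y \<bullet> ?p y) has_derivative (\<lambda>u. 0)) (at y)"
      unfolding const by (rule has_derivative_const)
    from has_derivative_unique[OF has_derivative_inner[OF d d] this]
    have "?p y \<bullet> D ?p y u + D ?p y u \<bullet> ?p y = 0" by (rule fun_cong)
    then have "D ?p y u \<bullet> ?p y = 0" by (simp add: inner_commute)
    then show ?thesis using im[OF y] by (simp add: complex_eq_iff inner_eq_Re_herm)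
  qed
  then show ?thesis using W sm n by (simp add: unit_horizontal_def)
qed

lemma minimal_lagrangian_lift:
  fixes \<A> :: "('p::{t2_space, second_countable_topology}, 'e::euclidean_space) atlas"
    and \<psi> :: "'p \<Rightarrow> complex^('m::finite option)"
  assumes "smooth_atlas \<A>" "minimal_lagrangian_immersion \<A> \<phi>" "horizontal_lift \<A> \<phi> \<psi>"
    and "(U, c) \<in> \<A>" "y \<in> c ` U"
  shows "lift_minimal_at (\<psi> \<circ> inv_into U c) y"
proof -
  have dim: "DIM('e) = CARD('m)"
    using assms(2) by (simp add: minimal_lagrangian_immersion_def lagrangian_def)
  have "\<forall>(U, c)\<in>\<A>. \<forall>y\<in>c ` U. lift_minimal_at (\<psi> \<circ> inv_into U c) y"
    using assms(2)
    by (subst (asm) minimal_lagrangian_immersion_iff_lift[OF dim smooth_atlas_chart(1)[OF assms(1)]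
          horizontal_lift_unit_horizontal[OF assms(1,3)]])
      (use assms(3) in \<open>auto simp: horizontal_lift_def\<close>)
  then show ?thesis using assms(4,5) by blast
qed

text \<open>The pointwise criterion holds in every product chart and does not mention the point of
  the manifold, so it becomes a condition on the parameter only.\<close>

theorem (in legendre_pair) minimal_lagrangian_immersion_curve_map_iff:
  fixes \<A> :: "('p::{t2_space, second_countable_topology}, 'e::euclidean_space) atlas"
    and \<psi> :: "'p \<Rightarrow> complex^('m::finite option)"
  assumes atlas: "smooth_atlas \<A>" and min: "minimal_lagrangian_immersion \<A> \<phi>"
    and lift: "horizontal_lift \<A> \<phi> \<psi>"
    and reg: "\<And>s. s \<in> I \<Longrightarrow> v1 s \<noteq> 0 \<or> v2 s \<noteq> 0"
  shows "minimal_lagrangian_immersion (prod_atlas I \<A>) (curve_map g1 g2 \<psi>) \<longleftrightarrow>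
    (\<forall>s\<in>I. g1 s \<noteq> 0 \<and> curve_minimal DIM('e) (g1 s) (v1 s) (v2 s) (w1 s) (w2 s))"
proof -
  \<comment> \<open>\<open>F\<close> uses the inverse of the product chart, \<open>L\<close> the
    product of the inverses. They agree only on the image of the chart, since
    \<open>inv_into\<close> is unspecified outside, so later steps pass between them on that open
    set.\<close>
  define F where "F U' c' = (\<lambda>z. join (g1 (fst z) *s \<psi> (snd (inv_into U' c' z))) (g2 (fst z)))"
    for U' and c' :: "real \<times> 'p \<Rightarrow> real \<times> 'e"
  define L where "L U c = (\<lambda>z. join (g1 (fst z) *s (\<psi> \<circ> inv_into U c) (snd z)) (g2 (fst z)))"
    for U and c :: "'p \<Rightarrow> 'e"
  have dim: "DIM('e) = CARD('m)"
    using min by (simp add: minimal_lagrangian_immersion_def lagrangian_def)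
  then have dim': "DIM(real \<times> 'e) = CARD('m option)" by simp
  have image: "map_prod id c ` (I \<times> U) = I \<times> c ` U" for c :: "'p \<Rightarrow> 'e" and U
    by (auto simp: map_prod_def image_iff)
  have chart: "unit_horizontal (I \<times> c ` U) (L U c)"
    "s \<in> I \<Longrightarrow> y \<in> c ` U \<Longrightarrow> lift_minimal_at (L U c) (s, y) \<longleftrightarrow>
      g1 s \<noteq> 0 \<and> curve_minimal DIM('e) (g1 s) (v1 s) (v2 s) (w1 s) (w2 s)"
    if A: "(U, c) \<in> \<A>" for U c s y
  proof -
    interpret C: curve_lift I g1 g2 v1 v2 w1 w2 "c ` U" "\<psi> \<circ> inv_into U c"
      by unfold_locales (rule horizontal_lift_unit_horizontal[OF atlas lift A])
    have F: "C.F = L U c" by (simp add: C.F_def L_def)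
    show "unit_horizontal (I \<times> c ` U) (L U c)" using C.unit_horizontal_F by (simp add: F)
    assume "s \<in> I" "y \<in> c ` U"
    with C.lift_minimal_at_iff[OF _ _ minimal_lagrangian_lift[OF atlas min lift A] reg]
    show "lift_minimal_at (L U c) (s, y) \<longleftrightarrow>
      g1 s \<noteq> 0 \<and> curve_minimal DIM('e) (g1 s) (v1 s) (v2 s) (w1 s) (w2 s)" by (simp add: F)
  qed
  have eq: "L U c z = F (I \<times> U) (map_prod id c) z" if A: "(U, c) \<in> \<A>" and zI: "z \<in> I \<times> c ` U" for U c z
  proof -
    obtain s y where z: "z = (s, y)" "s \<in> I" "y \<in> c ` U" using zI by auto
    show ?thesis
      using inv_into_map_prod[OF smooth_atlas_chart(1)[OF atlas A] z(2,3)]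
      by (simp add: z(1) L_def F_def)
  qed
  have "minimal_lagrangian_immersion (prod_atlas I \<A>) (curve_map g1 g2 \<psi>) \<longleftrightarrow>
    (\<forall>(U', c')\<in>prod_atlas I \<A>. \<forall>z\<in>c' ` U'. lift_minimal_at (F U' c') z)"
  proof (rule minimal_lagrangian_immersion_iff_lift[OF dim'])
    fix U' and c' :: "real \<times> 'p \<Rightarrow> real \<times> 'e" assume "(U', c') \<in> prod_atlas I \<A>"
    then obtain U c where A: "(U, c) \<in> \<A>" and U': "U' = I \<times> U" "c' = map_prod id c"
      by (auto simp: prod_atlas_def)
    note inj = smooth_atlas_chart(1)[OF atlas A]
    show "inj_on c' U'" unfolding U' by (intro map_prod_inj_on inj) auto
    show "unit_horizontal (c' ` U') (F U' c')"
      unfolding U' image by (rule unit_horizontal_cong[OF chart(1)[OF A] eq[OF A]])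
    fix z assume "z \<in> c' ` U'"
    then obtain s y where z: "z = (s, y)" "s \<in> I" "y \<in> c ` U" unfolding U' image by auto
    show "curve_map g1 g2 \<psi> (inv_into U' c' z) = hopf (F U' c' z)"
      using inv_into_map_prod[OF inj z(2,3)] by (simp add: U' z(1) F_def curve_map_def)
  qed
  also have "\<dots> \<longleftrightarrow> (\<forall>(U, c)\<in>\<A>. \<forall>z\<in>I \<times> c ` U. lift_minimal_at (L U c) z)"
  proof -
    have "lift_minimal_at (F (I \<times> U) (map_prod id c)) z \<longleftrightarrow> lift_minimal_at (L U c) z"
      if "(U, c) \<in> \<A>" "z \<in> I \<times> c ` U" for U c z
      by (rule lift_minimal_at_cong[symmetric, OF _ that(2) eq[OF that(1)]])
        (use chart(1)[OF that(1)] in \<open>auto simp: unit_horizontal_def\<close>)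
    then show ?thesis by (fastforce simp: prod_atlas_def image)
  qed
  also have "\<dots> \<longleftrightarrow> (\<forall>s\<in>I. g1 s \<noteq> 0 \<and> curve_minimal DIM('e) (g1 s) (v1 s) (v2 s) (w1 s) (w2 s))"
    (is "?l \<longleftrightarrow> ?r")
  proof
    assume l: ?l
    show ?r
    proof
      fix s assume s: "s \<in> I"
      \<comment> \<open>Any point of the manifold will do: types are nonempty and the atlas covers
        the whole type.\<close>
      have "(undefined :: 'p) \<in> (\<Union>(U, c)\<in>\<A>. U)" using atlas by (simp add: smooth_atlas_def)
      then obtain U c where A: "(U, c) \<in> \<A>" "undefined \<in> U" by auto
      then have "lift_minimal_at (L U c) (s, c undefined)" using l s by fast
      then show "g1 s \<noteq> 0 \<and> curve_minimal DIM('e) (g1 s) (v1 s) (v2 s) (w1 s) (w2 s)"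
        using chart(2)[OF A(1) s, of "c undefined"] A(2) by blast
    qed
  next
    assume ?r
    then show ?l using chart(2) by fast
  qed
  finally show ?thesis .
qed

section \<open>Holomorphic isometries\<close>

text \<open>In affine coordinates near the two image points the equation \<open>eq\<close> reads
  \<open>h1 = k \<circ> h2 \<circ> \<sigma>\<close>, where \<open>k\<close> is the coordinate form
  of \<open>T\<close>. The claim follows from the chain rule, as \<open>k\<close> preserves the
  metric and a unit horizontal lift measures tangent vectors as its projection does.\<close>

lemma isometry_metric:
  fixes F1 :: "'e::euclidean_space \<Rightarrow> complex^('m::finite option)"
    and F2 :: "'f::euclidean_space \<Rightarrow> complex^('m option)"
  assumes iso: "holomorphic_isometry T"
    and F1: "unit_horizontal W1 F1" and F2: "unit_horizontal W2 F2"
    and \<sigma>: "\<sigma> ` W1 \<subseteq> W2" "\<And>y. y \<in> W1 \<Longrightarrow> \<sigma> differentiable (at y)"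
    and eq: "\<And>y. y \<in> W1 \<Longrightarrow> hopf (F1 y) = T (hopf (F2 (\<sigma> y)))"
    and y: "y \<in> W1"
  shows "norm (D F1 y u) = norm (D F2 (\<sigma> y) (D \<sigma> y u))"
proof -
  have "norm (F1 y) = 1" "norm (F2 (\<sigma> y)) = 1"
    using F1 F2 y \<sigma>(1) by (auto simp: unit_horizontal_def)
  then have nz: "F1 y \<noteq> 0" "F2 (\<sigma> y) \<noteq> 0" by auto
  obtain B where B: "unitary B" "(adj B *v F1 y) $ None \<noteq> 0" by (rule exists_unitary_chart[OF nz(1)])
  obtain A where A: "unitary A" "(adj A *v F2 (\<sigma> y)) $ None \<noteq> 0" by (rule exists_unitary_chart[OF nz(2)])
  define f1 where "f1 = (\<lambda>y. hopf (F1 y))"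
  define f2 where "f2 = (\<lambda>y. hopf (F2 y))"
  define h1 where "h1 = inv (aff B) \<circ> f1"
  define h2 where "h2 = inv (aff A) \<circ> f2"
  define U1 where "U1 = {y \<in> W1. f1 y \<in> range (aff B)}"
  define U2 where "U2 = {y \<in> W2. f2 y \<in> range (aff A)}"
  have f12: "\<forall>y\<in>W1. f1 y = hopf (F1 y)" "\<forall>y\<in>W2. f2 y = hopf (F2 y)"
    by (simp_all add: f1_def f2_def)
  note c1 = unit_horizontal_chart[OF F1 B(1) f12(1), folded U1_def h1_def]
  note c2 = unit_horizontal_chart[OF F2 A(1) f12(2), folded U2_def h2_def]
  interpret H1: homogeneous_lift U1 "\<lambda>y. adj B *v F1 y" "\<lambda>y. (adj B *v F1 y) $ None" h1 by (rule c1(2))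
  interpret H2: homogeneous_lift U2 "\<lambda>y. adj A *v F2 y" "\<lambda>y. (adj A *v F2 y) $ None" h2 by (rule c2(2))
  define V where "V = {w. T (aff A w) \<in> range (aff B)}"
  define k where "k = inv (aff B) \<circ> T \<circ> aff A"
  have V: "open V" "smooth_on V k" and
    k: "\<And>w u v. w \<in> V \<Longrightarrow> fubini_study B (k w) (D k w u) (D k w v) = fubini_study A w u v"
    using iso A(1) B(1) unfolding holomorphic_isometry_def Let_def V_def k_def by blast+
  have yU: "y \<in> U1" "\<sigma> y \<in> U2" using c1(1) c2(1) y \<sigma>(1) A(2) B(2) by auto
  \<comment> \<open>The coordinate identity holds only where both affine charts apply; it can be
    differentiated because this set is open.\<close>
  define S where "S = {z \<in> U1. \<sigma> z \<in> U2}"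
  have U1W: "U1 \<subseteq> W1" by (auto simp: U1_def)
  have "continuous_on U1 \<sigma>"
    using \<sigma>(2) U1W by (intro continuous_at_imp_continuous_on ballI differentiable_imp_continuous_within) auto
  then have "open (U1 \<inter> \<sigma> -` U2)"
    using H1.open_U H2.open_U by (simp add: continuous_on_open_vimage Int_commute)
  then have S: "open S" by (simp add: S_def Int_def vimage_def)
  have yS: "y \<in> S" using yU by (simp add: S_def)
  have aff_h2: "aff A (h2 (\<sigma> z)) = f2 (\<sigma> z)" if "z \<in> S" for z
    using that by (simp add: S_def U2_def h2_def f_inv_into_f)
  have T_f2: "f1 z = T (f2 (\<sigma> z))" if "z \<in> S" for z
    using that eq U1W by (auto simp: S_def f1_def f2_def)
  have hk: "h1 z = k (h2 (\<sigma> z))" if "z \<in> S" for z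
    using aff_h2[OF that] T_f2[OF that] by (simp add: h1_def k_def)
  have hV: "h2 (\<sigma> y) \<in> V"
    using aff_h2[OF yS] T_f2[OF yS] yU(1) by (simp add: V_def U1_def)
  have d\<sigma>: "(\<sigma> has_derivative D \<sigma> y) (at y)" using \<sigma>(2)[OF y] by (rule D_works)
  have "((\<lambda>z. k (h2 (\<sigma> z))) has_derivative (\<lambda>u. D k (h2 (\<sigma> y)) (D h2 (\<sigma> y) (D \<sigma> y u)))) (at y)"
    by (rule has_derivative_compose[OF has_derivative_compose[OF d\<sigma> H2.h_has_derivative[OF yU(2)]]
          smooth_on_has_derivative[OF V(2) hV]])
  moreover have "D h1 y = D (\<lambda>z. k (h2 (\<sigma> z))) y" by (rule D_cong[OF S yS hk])
  ultimately have dh: "D h1 y u = D k (h2 (\<sigma> y)) (D h2 (\<sigma> y) (D \<sigma> y u))" by (simp add: D_eq)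
  have "Re (fs_herm (h1 y) (D h1 y u) (D h1 y u)) =
      Re (fs_herm (h2 (\<sigma> y)) (D h2 (\<sigma> y) (D \<sigma> y u)) (D h2 (\<sigma> y) (D \<sigma> y u)))"
    unfolding dh hk[OF yS] using k[OF hV] by (simp add: fubini_study_eq[OF A(1)] fubini_study_eq[OF B(1)])
  then have "Re (herm (D F1 y u) (D F1 y u)) =
      Re (herm (D F2 (\<sigma> y) (D \<sigma> y u)) (D F2 (\<sigma> y) (D \<sigma> y u)))"
    by (simp add: c1(3)[OF yU(1)] c2(3)[OF yU(2)])
  then show ?thesis by (simp add: herm_self)
qed

lemma image_hopf: "(\<lambda>z. M *v z) ` hopf z = hopf (M *v z)"
  by (force simp: hopf_def matrix_smult)

text \<open>In the affine charts of \<open>A\<close> and \<open>B\<close> the map is fractional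
  linear, with the affine homogeneous lift \<open>P w = N *v join w 1\<close> and \<open>N\<close>
  unitary. Smoothness, holomorphy and isometry are read off from this lift.\<close>

lemma holomorphic_isometry_unitary:
  fixes M :: "complex^('m::finite option)^('m option)"
  assumes M: "unitary M"
  shows "holomorphic_isometry (\<lambda>q. (\<lambda>z. M *v z) ` q)"
  unfolding holomorphic_isometry_def
proof (intro conjI allI impI)
  let ?T = "\<lambda>q. (\<lambda>z. M *v z) ` q"
  show "bij_betw ?T CP CP"
  proof (rule bij_betwI[where g = "\<lambda>q. (\<lambda>z. adj M *v z) ` q"])
    show "?T \<in> CP \<rightarrow> CP" using M by (auto simp: CP_def image_hopf norm_unitary)
    show "(\<lambda>q. (\<lambda>z. adj M *v z) ` q) \<in> CP \<rightarrow> CP"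
      using unitary_adj[OF M] by (auto simp: CP_def image_hopf norm_unitary)
  qed (simp_all add: image_image unitary_adj_cancel[OF M])
  fix A B :: "complex^('m option)^('m option)"
  assume AB: "unitary A \<and> unitary B"
  then have A: "unitary A" and B: "unitary B" by auto
  define N where "N = adj B ** (M ** A)"
  have N: "unitary N" unfolding N_def by (intro unitary_mult unitary_adj M A B)
  have Nv: "adj B *v (M *v (A *v z)) = N *v z" for z
    by (simp add: N_def matrix_vector_mul_assoc)
  define P where "P w = N *v join w 1" for w
  define V where "V = {w. ?T (aff A w) \<in> range (aff B)}"
  define h where "h = inv (aff B) \<circ> ?T \<circ> aff A"
  have T: "?T (aff A w) = hopf (M *v aff_section A w)" for w
    by (simp add: aff_def image_hopf)
  have nrm: "norm (M *v aff_section A w) = 1" for w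
    by (simp add: norm_unitary[OF M] aff_section_norm[OF A])
  have sec: "adj B *v (M *v aff_section A w) = complex_of_real (1 / norm (join w 1)) *s P w" for w
    by (simp add: aff_section_def norm_unitary[OF A] P_def scaleR_eq_smult matrix_smult Nv)
  have V: "V = {w. P w $ None \<noteq> 0}"
    unfolding V_def T hopf_in_range_aff[OF B nrm] sec using norm_join_1_pos by (auto simp: less_imp_neq)
  have h: "h w = quotients (P w)" if "w \<in> V" for w
  proof -
    have nz: "(adj B *v (M *v aff_section A w)) $ None \<noteq> 0"
      using that unfolding V sec using norm_join_1_pos[of w] by auto
    have "h w = quotients (adj B *v (M *v aff_section A w))"
      unfolding h_def comp_apply T by (rule inv_aff_hopf[OF B nrm nz])
    then have "h w = quotients (complex_of_real (1 / norm (join w 1)) *s P w)"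
      unfolding sec .
    then show ?thesis using norm_join_1_pos[of w] by (simp add: quotients_def)
  qed
  have dP: "(P has_derivative (\<lambda>u. N *v join u 0)) (at w)" for w
    unfolding P_def
    by (intro bounded_linear.has_derivative[OF bounded_linear_matrix] has_derivative_join
        has_derivative_ident has_derivative_const)
  have sP: "smooth_on UNIV P"
    by (rule smooth_on_derivative[OF _ dP]) (auto intro: smooth_on_const)
  have oV: "open V"
  proof -
    have "continuous_on UNIV (\<lambda>w. P w $ None)"
      by (intro continuous_on_component smooth_on_continuous[OF sP])
    then have "open ((\<lambda>w. P w $ None) -` (- {0}))" by (intro open_vimage) auto
    then show ?thesis by (simp add: V vimage_def)
  qed
  have sPV: "smooth_on V P" by (rule smooth_on_subset[OF sP]) simp
  have sh: "smooth_on V h"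
    using smooth_on_quotients[OF oV sPV] smooth_on_cong[OF oV h] by (auto simp: V)
  interpret homogeneous_lift V P "\<lambda>w. P w $ None" h
    by unfold_locales (use oV sPV sh h join_quotients in \<open>auto simp: V\<close>)
  have DP: "D P w u = N *v join u 0" for w u using D_eq[OF dP] by simp
  have "D h w (\<i> *s u) = \<i> *s D h w u" if w: "w \<in> V" for w u
  proof -
    have f: "P w $ None \<noteq> 0" using w by (simp add: V)
    \<comment> \<open>The last coordinate gives complex linearity for the derivative of the
      homogeneous factor; its contribution then cancels from the other coordinates.\<close>
    have "D P w (\<i> *s u) = \<i> *s D P w u"
      by (simp add: DP matrix_smult[symmetric] smult_join)
    then have e: "D (\<lambda>w. P w $ None) w (\<i> *s u) *s join (h w) 1 + P w $ None *s join (D h w (\<i> *s u)) 0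
        = \<i> *s (D (\<lambda>w. P w $ None) w u *s join (h w) 1 + P w $ None *s join (D h w u) 0)"
      using D_P[OF w] by simp
    from arg_cong[OF e, of "\<lambda>x. x $ None"]
    have e0: "D (\<lambda>w. P w $ None) w (\<i> *s u) = \<i> * D (\<lambda>w. P w $ None) w u" by simp
    have "P w $ None * D h w (\<i> *s u) $ i = P w $ None * (\<i> * D h w u $ i)" for i
      using arg_cong[OF e, of "\<lambda>x. x $ Some i"] by (simp add: e0 algebra_simps)
    then show ?thesis using f by (simp add: vec_eq_iff)
  qed
  moreover have "fubini_study B (h w) (D h w u) (D h w v) = fubini_study A w u v" if w: "w \<in> V" for w u v
  proof -
    have "fs_herm (h w) (D h w u) (D h w v) =
      (herm (join u 0) (join v 0) * herm (join w 1) (join w 1)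
        - herm (join u 0) (join w 1) * herm (join w 1) (join v 0)) / (herm (join w 1) (join w 1))\<^sup>2"
      unfolding fs_herm_D[OF w] DP by (simp add: P_def herm_unitary[OF N])
    \<comment> \<open>The same formula for the standard lift \<open>join w 1\<close> of the
      identity, whose homogeneous factor is 1 and has derivative 0.\<close>
    also have "\<dots> = fs_herm w u v"
      by (rule fs_herm_lift_algebra[symmetric, of 1 _ w _ 0 u _ 0 v]) simp_all
    finally show ?thesis by (simp add: fubini_study_eq[OF A] fubini_study_eq[OF B])
  qed
  ultimately show "let V = {w. ?T (aff A w) \<in> range (aff B)}; h = inv (aff B) \<circ> ?T \<circ> aff A
    in open V \<and> smooth_on V h \<and>
      (\<forall>w\<in>V. \<forall>u v. D h w (\<i> *s u) = \<i> *s D h w u \<and>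
        fubini_study B (h w) (D h w u) (D h w v) = fubini_study A w u v)"
    unfolding Let_def V_def[symmetric] h_def[symmetric] using oV sh by blast
qed

text \<open>Independent phases on the two blocks of coordinates are the only isometries used to
  produce congruences.\<close>

lemma diagonal_isometry:
  assumes "cmod a = 1" "cmod b = 1"
  obtains T :: "(complex^('m::finite option)) set \<Rightarrow> (complex^('m option)) set"
  where "holomorphic_isometry T" "\<And>z c. T (hopf (join z c)) = hopf (join (a *s z) (b * c))"
proof -
  define M :: "complex^('m option)^('m option)"
    where "M = (\<chi> i j. if i = j then (case i of None \<Rightarrow> b | Some _ \<Rightarrow> a) else 0)"
  have ab: "cnj a * a = 1" "cnj b * b = 1"
    using assms complex_norm_square[of a] complex_norm_square[of b] by (auto simp: mult.commute)
  have "(\<Sum>k\<in>UNIV. cnj (M $ k $ i) * M $ k $ j) = (if i = j then 1 else 0)" for i j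
  proof -
    have "cnj (M $ k $ i) * M $ k $ j = (if k = i then (if i = j then 1 else 0) else 0)" for k
      using ab by (auto simp: M_def split: option.splits)
    then show ?thesis by simp
  qed
  then have M: "unitary M"
    by (simp add: unitary_def matrix_matrix_mult_def mat_def vec_eq_iff)
  have Mv: "M *v join z c = join (a *s z) (b * c)" for z c
    by (simp add: vec_option_eq_iff matrix_vector_mult_def M_def
        if_distrib[of "\<lambda>x. x * _"] cong: if_cong)
  show thesis
    by (rule that[OF holomorphic_isometry_unitary[OF M]]) (simp add: image_hopf Mv)
qed

section \<open>The minimality condition for Legendre curves\<close>

lemma Im_mult_cnj_divide: "Im (x * cnj y) / (cmod y)\<^sup>2 = Im (x / y)"
  by (simp add: complex_div_cnj[of x y] Im_divide_of_real flip: of_real_power)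

text \<open>The Hermitian complement of a unit vector \<open>(g1, g2)\<close> in the plane is
  spanned by \<open>(- cnj g2, cnj g1)\<close>; the coefficient of the velocity is the determinant
  \<open>l\<close> of position and velocity.\<close>

lemma legendre_algebra:
  assumes unit: "g1 * cnj g1 + g2 * cnj g2 = 1"
    and legendre: "v1 * cnj g1 + v2 * cnj g2 = 0"
  defines "l \<equiv> g1 * v2 - g2 * v1"
  shows "v1 = - l * cnj g2" "v2 = l * cnj g1"
    and "(cmod v1)\<^sup>2 + (cmod v2)\<^sup>2 = (cmod l)\<^sup>2"
    and "w1 * cnj v1 + w2 * cnj v2 = (g1 * w2 - g2 * w1) * cnj l"
proof -
  have "- l * cnj g2 = - g1 * (v2 * cnj g2) + g2 * cnj g2 * v1"
    by (simp add: l_def algebra_simps)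
  also have "v2 * cnj g2 = - (v1 * cnj g1)" using legendre by (simp add: add_eq_0_iff)
  also have "- g1 * - (v1 * cnj g1) + g2 * cnj g2 * v1 = (g1 * cnj g1 + g2 * cnj g2) * v1"
    by (simp add: algebra_simps)
  finally show v1: "v1 = - l * cnj g2" by (simp add: unit)
  have "l * cnj g1 = g1 * cnj g1 * v2 - g2 * (v1 * cnj g1)"
    by (simp add: l_def algebra_simps)
  also have "v1 * cnj g1 = - (v2 * cnj g2)" using legendre by (simp add: eq_neg_iff_add_eq_0)
  also have "g1 * cnj g1 * v2 - g2 * - (v2 * cnj g2) = (g1 * cnj g1 + g2 * cnj g2) * v2"
    by (simp add: algebra_simps)
  finally show v2: "v2 = l * cnj g1" by (simp add: unit)
  have "complex_of_real ((cmod v1)\<^sup>2 + (cmod v2)\<^sup>2) = v1 * cnj v1 + v2 * cnj v2"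
    by (simp add: of_real_cmod_square)
  also have "\<dots> = l * cnj l * (g1 * cnj g1 + g2 * cnj g2)"
    unfolding v1 v2 by (simp add: algebra_simps)
  also have "\<dots> = complex_of_real ((cmod l)\<^sup>2)" by (simp add: unit of_real_cmod_square)
  finally show "(cmod v1)\<^sup>2 + (cmod v2)\<^sup>2 = (cmod l)\<^sup>2" by (simp only: of_real_eq_iff)
  show "w1 * cnj v1 + w2 * cnj v2 = (g1 * w2 - g2 * w1) * cnj l"
    unfolding v1 v2 by (simp add: algebra_simps)
qed

text \<open>If the \<open>v\<close> and \<open>w\<close> are successive derivatives,
  \<open>g1 * w2 - g2 * w1\<close> is the derivative of the determinant
  \<open>l = g1 * v2 - g2 * v1\<close>. The condition then says that \<open>l * g1 ^ d\<close> has a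
  real logarithmic derivative. Division by 0 gives 0 on both sides.\<close>

lemma curve_minimal_iff:
  assumes "g1 * cnj g1 + g2 * cnj g2 = 1" "v1 * cnj g1 + v2 * cnj g2 = 0"
  shows "curve_minimal d g1 v1 v2 w1 w2 \<longleftrightarrow>
    Im ((g1 * w2 - g2 * w1) / (g1 * v2 - g2 * v1) + of_real d * (v1 / g1)) = 0"
proof -
  have "Im (w1 * cnj v1 + w2 * cnj v2) / ((cmod v1)\<^sup>2 + (cmod v2)\<^sup>2) =
      Im ((g1 * w2 - g2 * w1) / (g1 * v2 - g2 * v1))"
    unfolding legendre_algebra(3)[OF assms] legendre_algebra(4)[OF assms] by (rule Im_mult_cnj_divide)
  moreover have "d * Im (v1 * cnj g1) / (cmod g1)\<^sup>2 = d * Im (v1 / g1)"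
    by (simp only: Im_mult_cnj_divide[symmetric] times_divide_eq_right)
  ultimately show ?thesis
    unfolding curve_minimal_def plus_complex.sel Im_of_real_mult by simp
qed

text \<open>Here \<open>A\<close> and \<open>B\<close> play the role of logarithmic derivatives of
  \<open>g1\<close> and \<open>g2\<close>. The determinant is \<open>g1 * g2 * (B - A)\<close>, with
  logarithmic derivative \<open>A + B + (B' - A') / (B - A)\<close>; the rest is
  \<open>d * A\<close>.\<close>

lemma curve_minimal_log_iff:
  assumes "g1 * cnj g1 + g2 * cnj g2 = 1" "v1 * cnj g1 + v2 * cnj g2 = 0"
    and "g1 \<noteq> 0" "g2 \<noteq> 0" "A \<noteq> B"
    and "v1 = g1 * A" "v2 = g2 * B" "w1 = g1 * (A\<^sup>2 + A')" "w2 = g2 * (B\<^sup>2 + B')"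
  shows "curve_minimal d g1 v1 v2 w1 w2 \<longleftrightarrow>
    Im (of_real (d + 1) * A + B + (B' - A') / (B - A)) = 0"
proof -
  have "(g1 * w2 - g2 * w1) / (g1 * v2 - g2 * v1) = (g1 * g2 * (B\<^sup>2 + B' - A\<^sup>2 - A')) / (g1 * g2 * (B - A))"
    unfolding assms(6-9) by (simp add: algebra_simps)
  also have "\<dots> = (B\<^sup>2 + B' - A\<^sup>2 - A') / (B - A)"
    using assms(3,4) by simp
  also have "\<dots> = A + B + (B' - A') / (B - A)"
    using assms(5) by (simp add: field_simps power2_eq_square)
  finally have "(g1 * w2 - g2 * w1) / (g1 * v2 - g2 * v1) + of_real d * (v1 / g1) =
      of_real (d + 1) * A + B + (B' - A') / (B - A)"
    using assms(3) by (simp add: assms(6) algebra_simps)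
  then show ?thesis unfolding curve_minimal_iff[OF assms(1,2)] by simp
qed

section \<open>The examples\<close>

text \<open>The fundamental theorem gives a derivative within a closed interval. A margin around the
  base point \<open>c\<close> and the point \<open>x\<close>, available in the open
  \<open>I\<close>, makes \<open>x\<close> interior.\<close>

lemma interval_integral_has_vector_derivative:
  fixes f :: "real \<Rightarrow> 'a::euclidean_space"
  assumes "open I" "is_interval I" "continuous_on I f" "c \<in> I" "x \<in> I"
  shows "((\<lambda>u. LBINT y=ereal c..ereal u. f y) has_vector_derivative f x) (at x)"
proof -
  obtain e1 where e1: "e1 > 0" "cball c e1 \<subseteq> I"
    using assms(1,4) open_contains_cball by blast
  obtain e2 where e2: "e2 > 0" "cball x e2 \<subseteq> I"
    using assms(1,5) open_contains_cball by blast
  define e where "e = min e1 e2"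
  define a b where "a = min c x - e" and "b = max c x + e"
  have e: "e > 0" using e1 e2 by (simp add: e_def)
  have ab: "a \<in> I" "b \<in> I"
  proof -
    have "c - e \<in> I" "c + e \<in> I" "x - e \<in> I" "x + e \<in> I"
      using e1(2) e2(2) e by (auto simp: e_def dist_real_def subset_iff abs_if)
    then show "a \<in> I" "b \<in> I" by (auto simp: a_def b_def min_def max_def)
  qed
  have sub: "{a..b} \<subseteq> I"
    using mem_is_interval_1_I[OF assms(2) ab] by auto
  have "((\<lambda>u. LBINT y=ereal c..ereal u. f y) has_vector_derivative f x) (at x within {a..b})"
    by (rule interval_integral_FTC2)
      (use e sub assms(3) in \<open>auto simp: a_def b_def intro: continuous_on_subset\<close>)
  moreover have "at x within {a..b} = at x"
    by (rule at_within_interior) (use e in \<open>auto simp: a_def b_def\<close>)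
  ultimately show ?thesis by simp
qed

text \<open>Bootstrapping: if the solution is of class \<open>k\<close>, its derivative
  \<open>V (y x)\<close> is too, so the solution is of class \<open>k + 1\<close>.\<close>

lemma smooth_on_ode:
  fixes y :: "real \<Rightarrow> 'b::euclidean_space"
  assumes "open S" "\<And>x. x \<in> S \<Longrightarrow> (y has_vector_derivative V (y x)) (at x)"
    and "smooth_on T V" "y ` S \<subseteq> T"
  shows "smooth_on S y"
proof (rule smooth_onI)
  show "Ck_on k S y" for k
  proof (induction k)
    case 0
    show ?case using assms(2)
      by (auto intro!: continuous_at_imp_continuous_on has_vector_derivative_continuous)
  next
    case (Suc k)
    show ?case
    proof (rule Ck_on_SucI[OF assms(1)])
      show "(y has_derivative (\<lambda>v. v *\<^sub>R V (y x))) (at x)" if "x \<in> S" for x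
        using assms(2)[OF that] by (simp add: has_vector_derivative_def)
      show "Ck_on k S (\<lambda>x. v *\<^sub>R V (y x))" for v
        using assms(3) by (intro Ck_on_bilinear[OF bounded_bilinear_scaleR assms(1)] Ck_on_const
            Ck_on_compose[OF assms(1) Suc _ assms(4)]) (auto simp: smooth_on_def)
    qed
  qed
qed

lemma smooth_on_of_real:
  "open S \<Longrightarrow> smooth_on S f \<Longrightarrow> smooth_on S (\<lambda>x. complex_of_real (f x))"
  by (rule smooth_on_linear_compose[OF bounded_linear_of_real])

lemma smooth_on_cis:
  assumes "open S" "smooth_on S f"
  shows "smooth_on S (\<lambda>x. cis (f x))"
  unfolding cis_conv_exp
  by (rule smooth_on_exp[OF assms(1) smooth_on_mult[OF assms(1) smooth_on_const smooth_on_of_real[OF assms]]])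

lemma has_vector_derivative_of_real':
  "(f has_real_derivative f') (at x) \<Longrightarrow>
    ((\<lambda>x. complex_of_real (f x)) has_vector_derivative of_real f') (at x)"
  unfolding has_real_derivative_iff_has_vector_derivative
  by (rule bounded_linear.has_vector_derivative[OF bounded_linear_of_real])

lemma has_vector_derivative_cis:
  assumes "(f has_real_derivative f') (at x)"
  shows "((\<lambda>x. cis (f x)) has_vector_derivative (cis (f x) * (\<i> * of_real f'))) (at x)"
proof -
  have "((\<lambda>x. exp (\<i> * complex_of_real (f x))) has_vector_derivative
      (\<i> * of_real f' * exp (\<i> * of_real (f x)))) (at x)"
    using vector_derivative_chain_at DERIV_exp
      field_vector_diff_chain_at[OF has_vector_derivative_mult_right[OF has_vector_derivative_of_real'[OF assms]] DERIV_exp]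
    by (simp add: o_def)
  then show ?thesis by (simp add: cis_conv_exp mult.commute)
qed

section \<open>The profile equation, its first integral and the curve built from it\<close>

locale profile =
  fixes n :: nat and \<rho> :: real and r r' r'' :: "real \<Rightarrow> real"
  assumes n: "n > 0"
    and r: "(r has_real_derivative r' s) (at s)"
    and r': "(r' has_real_derivative r'' s) (at s)"
    and ode: "r'' s * sin (r s) * cos (r s) =
      (1 - (r' s)\<^sup>2) * (real n * (cos (r s))\<^sup>2 - (sin (r s))\<^sup>2)"
    and init: "r 0 = \<rho>" "r' 0 = 0"
begin

definition \<kappa> :: real where "\<kappa> = first_integral_const n \<rho>"

text \<open>If sine or cosine vanished at \<open>\<rho>\<close>, the equation at 0 would read
  \<open>n * (cos \<rho>)\<^sup>2 = (sin \<rho>)\<^sup>2\<close>, and then both would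
  vanish.\<close>

lemma \<kappa>_nz: "\<kappa> \<noteq> 0"
proof
  assume "\<kappa> = 0"
  then have sc: "cos \<rho> = 0 \<or> sin \<rho> = 0" by (auto simp: \<kappa>_def first_integral_const_def)
  then have "real n * (cos \<rho>)\<^sup>2 - (sin \<rho>)\<^sup>2 = 0" using ode[of 0] init by auto
  moreover have "\<not> (sin \<rho> = 0 \<and> cos \<rho> = 0)"
    using sin_zero_abs_cos_one[of \<rho>] by auto
  ultimately show False using sc n by auto
qed

lemma first_integral: "(1 - (r' s)\<^sup>2) * (cos (r s))\<^sup>2 * (sin (r s)) ^ (2 * n) = \<kappa>\<^sup>2"
proof -
  let ?E = "\<lambda>s. (1 - (r' s)\<^sup>2) * (cos (r s))\<^sup>2 * (sin (r s)) ^ (2 * n)"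
  have "(?E has_real_derivative 0) (at s)" for s
  proof -
    \<comment> \<open>Avoids natural subtraction in the derivative of the power. What remains is
      \<open>2 * r' * cos r * sin r ^ m\<close> times the defect of the profile equation.\<close>
    obtain m where m: "2 * n = Suc m" using n by (cases "2 * n") auto
    then have m': "n * 2 = Suc m" "real m = 2 * real n - 1" by simp_all
    have sn: "((\<lambda>s. sin (r s)) has_real_derivative cos (r s) * r' s) (at s)"
      by (auto intro!: derivative_eq_intros r)
    have pw: "((\<lambda>s. sin (r s) ^ (2 * n)) has_real_derivative
        real (2 * n) * (cos (r s) * r' s) * (sin (r s)) ^ m) (at s)"
      using DERIV_power[OF sn, of "2 * n"] by (simp add: m mult.assoc del: power_Suc)
    have q: "((\<lambda>s. (1 - (r' s)\<^sup>2) * (cos (r s))\<^sup>2) has_real_derivative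
        (- (2 * r' s * r'' s)) * (cos (r s))\<^sup>2
          + (1 - (r' s)\<^sup>2) * (2 * cos (r s) * (- sin (r s) * r' s))) (at s)"
      by (auto intro!: derivative_eq_intros r r')
    have "(?E has_real_derivative (- (2 * r' s * r'' s)) * (cos (r s))\<^sup>2 * (sin (r s)) ^ (2 * n)
       + (1 - (r' s)\<^sup>2) * (2 * cos (r s) * (- sin (r s) * r' s)) * (sin (r s)) ^ (2 * n)
       + (1 - (r' s)\<^sup>2) * (cos (r s))\<^sup>2 * (real (2 * n) * (cos (r s) * r' s) * (sin (r s)) ^ m)) (at s)"
      by (rule DERIV_cong[OF DERIV_mult[OF q pw]]) (simp only: algebra_simps)
    also have "(- (2 * r' s * r'' s)) * (cos (r s))\<^sup>2 * (sin (r s)) ^ (2 * n)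
       + (1 - (r' s)\<^sup>2) * (2 * cos (r s) * (- sin (r s) * r' s)) * (sin (r s)) ^ (2 * n)
       + (1 - (r' s)\<^sup>2) * (cos (r s))\<^sup>2 * (real (2 * n) * (cos (r s) * r' s) * (sin (r s)) ^ m)
       = 2 * r' s * cos (r s) * sin (r s) ^ m * ((1 - (r' s)\<^sup>2) * (real n * (cos (r s))\<^sup>2 - (sin (r s))\<^sup>2)
          - r'' s * sin (r s) * cos (r s))"
      by (simp add: m m' algebra_simps power2_eq_square)
    also have "\<dots> = 0" by (simp add: ode)
    finally show ?thesis .
  qed
  then have "?E s = ?E 0" using DERIV_isconst_all[of ?E s 0] by blast
  also have "\<dots> = \<kappa>\<^sup>2"
    by (simp add: init \<kappa>_def first_integral_const_def power_mult_distrib power_mult[symmetric] mult.commute)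
  finally show ?thesis .
qed

text \<open>The first integral contains both as factors and is a nonzero constant. Hence the
  equation can be solved for \<open>r''\<close> along the whole solution.\<close>

lemma sin_nz: "sin (r s) \<noteq> 0" and cos_nz: "cos (r s) \<noteq> 0"
  using first_integral[of s] \<kappa>_nz n by (auto simp: zero_power)

definition a :: "real \<Rightarrow> real" where "a t = 1 / sin (r t) ^ (n + 1)"
definition b :: "real \<Rightarrow> real" where "b t = (tan (r t))\<^sup>2 / sin (r t) ^ (n + 1)"
definition \<alpha> :: "real \<Rightarrow> real" where "\<alpha> s = (LBINT t=0..ereal s. a t)"
definition \<beta> :: "real \<Rightarrow> real" where "\<beta> s = (LBINT t=0..ereal s. b t)"
definition e1 :: "real \<Rightarrow> complex" where "e1 s = of_real (sin (r s)) * cis (- (\<kappa> * \<alpha> s))"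
definition e2 :: "real \<Rightarrow> complex" where "e2 s = of_real (cos (r s)) * cis (\<kappa> * \<beta> s)"
text \<open>The logarithmic derivatives of \<open>e1\<close> and \<open>e2\<close> are
  \<open>A\<close> and \<open>B\<close>: the real parts come from the radii, the imaginary parts
  from the phases.\<close>

definition A :: "real \<Rightarrow> complex" where "A s = Complex (r' s * cos (r s) / sin (r s)) (- \<kappa> * a s)"
definition B :: "real \<Rightarrow> complex" where "B s = Complex (- r' s * sin (r s) / cos (r s)) (\<kappa> * b s)"

lemma example_a_eq: "example_a n \<rho> r \<psi> = curve_map e1 e2 \<psi>"
  unfolding example_a_def e1_def[abs_def] e2_def[abs_def] \<alpha>_def \<beta>_def a_def b_def \<kappa>_def[symmetric] cis_conv_exp
  by (simp add: mult.assoc)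

text \<open>The equation is a first-order system for \<open>(r, r')\<close> with a smooth field
  where \<open>sin r * cos r\<close> is nonzero, a set that the solution never leaves.\<close>

lemma smooth_r: "smooth_on UNIV r"
proof -
  define V :: "real \<times> real \<Rightarrow> real \<times> real" where
    "V = (\<lambda>z. (snd z, (1 - (snd z)\<^sup>2) * (real n * (cos (fst z))\<^sup>2 - (sin (fst z))\<^sup>2)
       / (sin (fst z) * cos (fst z))))"
  define T :: "(real \<times> real) set" where "T = {z. sin (fst z) * cos (fst z) \<noteq> 0}"
  have T: "open T"
    unfolding T_def by (intro open_Collect_neq continuous_intros)
  have fs: "smooth_on T fst" "smooth_on T snd"
    by (intro smooth_on_bounded_linear T bounded_linear_fst bounded_linear_snd)+
  have "smooth_on T V"
    unfolding V_def
    by (intro smooth_on_Pair smooth_on_divide smooth_on_mult smooth_on_diff smooth_on_power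
        smooth_on_sin_cos smooth_on_const T fs) (auto simp: T_def)
  moreover have "((\<lambda>s. (r s, r' s)) has_vector_derivative V (r s, r' s)) (at s)" for s
  proof -
    have "r'' s = (1 - (r' s)\<^sup>2) * (real n * (cos (r s))\<^sup>2 - (sin (r s))\<^sup>2) / (sin (r s) * cos (r s))"
      using ode[of s] sin_nz[of s] cos_nz[of s] by (simp add: field_simps)
    then show ?thesis
      using has_vector_derivative_Pair[OF r[of s, unfolded has_real_derivative_iff_has_vector_derivative]
          r'[of s, unfolded has_real_derivative_iff_has_vector_derivative]]
      by (simp add: V_def)
  qed
  ultimately have sm: "smooth_on UNIV (\<lambda>s. (r s, r' s))"
    using sin_nz cos_nz by (intro smooth_on_ode[where V = V and T = T]) (auto simp: T_def)
  show ?thesis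
    using smooth_on_linear_compose[OF bounded_linear_fst open_UNIV sm] by simp
qed

lemma smooth_a: "smooth_on UNIV a" and smooth_b: "smooth_on UNIV b"
proof -
  note sc = smooth_on_sin_cos[OF open_UNIV smooth_r]
  show "smooth_on UNIV a"
    unfolding a_def[abs_def] using sin_nz
    by (intro smooth_on_divide smooth_on_power smooth_on_const sc) auto
  show "smooth_on UNIV b"
    unfolding b_def[abs_def] tan_def using sin_nz cos_nz
    by (intro smooth_on_divide smooth_on_power smooth_on_const sc) auto
qed

lemma \<alpha>: "(\<alpha> has_real_derivative a s) (at s)" and \<beta>: "(\<beta> has_real_derivative b s) (at s)"
  unfolding has_real_derivative_iff_has_vector_derivative \<alpha>_def[abs_def] \<beta>_def[abs_def] zero_ereal_def
  by (auto intro!: interval_integral_has_vector_derivative[of UNIV] smooth_on_continuous smooth_a smooth_b)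

lemma smooth_e: "smooth_on UNIV e1" "smooth_on UNIV e2"
proof -
  have "smooth_on UNIV \<alpha>" "smooth_on UNIV \<beta>"
    using smooth_on_real_curve[OF open_UNIV \<alpha>[unfolded has_real_derivative_iff_has_vector_derivative] smooth_a]
      smooth_on_real_curve[OF open_UNIV \<beta>[unfolded has_real_derivative_iff_has_vector_derivative] smooth_b]
    by simp_all
  then have ph: "smooth_on UNIV (\<lambda>s. - (\<kappa> * \<alpha> s))" "smooth_on UNIV (\<lambda>s. \<kappa> * \<beta> s)"
    by (simp_all add: smooth_on_minus smooth_on_mult smooth_on_const)
  note sc = smooth_on_sin_cos[OF open_UNIV smooth_r]
  show "smooth_on UNIV e1" "smooth_on UNIV e2"
    unfolding e1_def[abs_def] e2_def[abs_def]
    by (rule smooth_on_mult[OF open_UNIV smooth_on_of_real[OF open_UNIV sc(1)] smooth_on_cis[OF open_UNIV ph(1)]])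
      (rule smooth_on_mult[OF open_UNIV smooth_on_of_real[OF open_UNIV sc(2)] smooth_on_cis[OF open_UNIV ph(2)]])
qed

lemma e_nz: "e1 s \<noteq> 0" "e2 s \<noteq> 0"
  using sin_nz[of s] cos_nz[of s] by (auto simp: e1_def e2_def)

lemma e1_deriv: "(e1 has_vector_derivative e1 s * A s) (at s)"
proof -
  have "(e1 has_vector_derivative of_real (sin (r s)) * (cis (- (\<kappa> * \<alpha> s)) * (\<i> * of_real (- (\<kappa> * a s))))
      + of_real (cos (r s) * r' s) * cis (- (\<kappa> * \<alpha> s))) (at s)"
    unfolding e1_def[abs_def]
    by (intro has_vector_derivative_mult has_vector_derivative_of_real' has_vector_derivative_cis)
      (auto intro!: derivative_eq_intros r \<alpha>)
  also have "of_real (sin (r s)) * (cis (- (\<kappa> * \<alpha> s)) * (\<i> * of_real (- (\<kappa> * a s))))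
      + of_real (cos (r s) * r' s) * cis (- (\<kappa> * \<alpha> s)) = e1 s * A s"
    using sin_nz[of s] by (simp add: e1_def A_def Complex_eq field_simps)
  finally show ?thesis .
qed

lemma e2_deriv: "(e2 has_vector_derivative e2 s * B s) (at s)"
proof -
  have "(e2 has_vector_derivative of_real (cos (r s)) * (cis (\<kappa> * \<beta> s) * (\<i> * of_real (\<kappa> * b s)))
      + of_real (- sin (r s) * r' s) * cis (\<kappa> * \<beta> s)) (at s)"
    unfolding e2_def[abs_def]
    by (intro has_vector_derivative_mult has_vector_derivative_of_real' has_vector_derivative_cis)
      (auto intro!: derivative_eq_intros r \<beta>)
  also have "of_real (cos (r s)) * (cis (\<kappa> * \<beta> s) * (\<i> * of_real (\<kappa> * b s)))
      + of_real (- sin (r s) * r' s) * cis (\<kappa> * \<beta> s) = e2 s * B s"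
    using cos_nz[of s] by (simp add: e2_def B_def Complex_eq field_simps)
  finally show ?thesis .
qed

definition A' :: "real \<Rightarrow> complex" where
  "A' s = Complex (r'' s * cos (r s) / sin (r s) - (r' s)\<^sup>2 / (sin (r s))\<^sup>2)
    (\<kappa> * a s * (n + 1) * cos (r s) * r' s / sin (r s))"

definition B' :: "real \<Rightarrow> complex" where
  "B' s = Complex (- r'' s * sin (r s) / cos (r s) - (r' s)\<^sup>2 / (cos (r s))\<^sup>2)
    (\<kappa> * a s * (2 * sin (r s) * r' s / cos (r s) ^ 3 - (n + 1) * sin (r s) * r' s / cos (r s)))"

lemma b_eq: "b s = a s * (sin (r s))\<^sup>2 / (cos (r s))\<^sup>2"
  by (simp add: a_def b_def tan_def power_divide)

lemma a_deriv: "(a has_real_derivative - (a s * (n + 1) * cos (r s) * r' s / sin (r s))) (at s)"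
proof -
  have sn: "((\<lambda>s. sin (r s)) has_real_derivative cos (r s) * r' s) (at s)"
    by (auto intro!: derivative_eq_intros r)
  have "(a has_real_derivative
      - (real (n + 1) * (cos (r s) * r' s * sin (r s) ^ n)) / (sin (r s) ^ (n + 1) * sin (r s) ^ (n + 1))) (at s)"
    using DERIV_divide[OF DERIV_const[of 1] DERIV_power[OF sn, of "n + 1"]] sin_nz[of s]
    by (simp add: a_def[abs_def])
  then show ?thesis
    by (rule DERIV_cong) (use sin_nz[of s] in \<open>simp add: a_def field_simps\<close>)
qed

lemma has_vector_derivative_Complex:
  assumes "(f has_real_derivative f') (at x)" "(g has_real_derivative g') (at x)"
  shows "((\<lambda>x. Complex (f x) (g x)) has_vector_derivative Complex f' g') (at x)"
  unfolding Complex_eq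
  by (intro has_vector_derivative_add has_vector_derivative_mult_right has_vector_derivative_of_real' assms)

lemma A_deriv: "(A has_vector_derivative A' s) (at s)"
  unfolding A_def[abs_def] A'_def
proof (rule has_vector_derivative_Complex)
  show "((\<lambda>s. r' s * cos (r s) / sin (r s)) has_real_derivative
      r'' s * cos (r s) / sin (r s) - (r' s)\<^sup>2 / (sin (r s))\<^sup>2) (at s)"
  proof -
    have d: "((\<lambda>s. r' s * cos (r s) / sin (r s)) has_real_derivative
      ((r'' s * cos (r s) - r' s * sin (r s) * r' s) * sin (r s) - r' s * cos (r s) * (cos (r s) * r' s))
        / (sin (r s) * sin (r s))) (at s)"
      using sin_nz[of s] by (auto intro!: derivative_eq_intros r r' simp: algebra_simps)
    have "(r'' s * cos (r s) - r' s * sin (r s) * r' s) * sin (r s) - r' s * cos (r s) * (cos (r s) * r' s)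
      = r'' s * cos (r s) * sin (r s) - (r' s)\<^sup>2 * ((sin (r s))\<^sup>2 + (cos (r s))\<^sup>2)"
      by (simp add: algebra_simps power2_eq_square del: sin_cos_squared_add sin_cos_squared_add2 sin_cos_squared_add3)
    then have key: "(r'' s * cos (r s) - r' s * sin (r s) * r' s) * sin (r s) - r' s * cos (r s) * (cos (r s) * r' s)
      = r'' s * cos (r s) * sin (r s) - (r' s)\<^sup>2" by simp
    show ?thesis
      by (rule DERIV_cong[OF d[unfolded key]])
        (use sin_nz[of s] in \<open>simp add: diff_divide_distrib power2_eq_square\<close>)
  qed
  show "((\<lambda>s. - \<kappa> * a s) has_real_derivative \<kappa> * a s * (n + 1) * cos (r s) * r' s / sin (r s)) (at s)"
    by (auto intro!: derivative_eq_intros a_deriv)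
qed

lemma B_deriv: "(B has_vector_derivative B' s) (at s)"
  unfolding B_def[abs_def] B'_def
proof (rule has_vector_derivative_Complex)
  show "((\<lambda>s. - r' s * sin (r s) / cos (r s)) has_real_derivative
      - r'' s * sin (r s) / cos (r s) - (r' s)\<^sup>2 / (cos (r s))\<^sup>2) (at s)"
  proof -
    have d: "((\<lambda>s. - r' s * sin (r s) / cos (r s)) has_real_derivative
      ((- r'' s * sin (r s) - r' s * cos (r s) * r' s) * cos (r s) - r' s * sin (r s) * (sin (r s) * r' s))
        / (cos (r s) * cos (r s))) (at s)"
      using cos_nz[of s] by (auto intro!: derivative_eq_intros r r' simp: field_simps)
    have "(- r'' s * sin (r s) - r' s * cos (r s) * r' s) * cos (r s) - r' s * sin (r s) * (sin (r s) * r' s)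
      = - r'' s * sin (r s) * cos (r s) - (r' s)\<^sup>2 * ((sin (r s))\<^sup>2 + (cos (r s))\<^sup>2)"
      by (simp add: algebra_simps power2_eq_square del: sin_cos_squared_add sin_cos_squared_add2 sin_cos_squared_add3)
    then have key: "(- r'' s * sin (r s) - r' s * cos (r s) * r' s) * cos (r s) - r' s * sin (r s) * (sin (r s) * r' s)
      = - r'' s * sin (r s) * cos (r s) - (r' s)\<^sup>2" by simp
    show ?thesis
      by (rule DERIV_cong[OF d[unfolded key]])
        (use cos_nz[of s] in \<open>simp add: diff_divide_distrib power2_eq_square\<close>)
  qed
  have "((\<lambda>s. (sin (r s))\<^sup>2 / (cos (r s))\<^sup>2) has_real_derivative 2 * sin (r s) * r' s / cos (r s) ^ 3) (at s)"
  proof -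
    have "((\<lambda>s. (sin (r s))\<^sup>2 / (cos (r s))\<^sup>2) has_real_derivative
      ((2 * sin (r s) * (cos (r s) * r' s)) * (cos (r s))\<^sup>2 - (sin (r s))\<^sup>2 * (2 * cos (r s) * (- sin (r s) * r' s)))
       / ((cos (r s))\<^sup>2 * (cos (r s))\<^sup>2)) (at s)"
      using cos_nz[of s] by (auto intro!: derivative_eq_intros r simp: algebra_simps)
    also have "(2 * sin (r s) * (cos (r s) * r' s)) * (cos (r s))\<^sup>2 - (sin (r s))\<^sup>2 * (2 * cos (r s) * (- sin (r s) * r' s))
      = 2 * sin (r s) * cos (r s) * r' s * ((sin (r s))\<^sup>2 + (cos (r s))\<^sup>2)"
      by (simp add: algebra_simps power2_eq_square del: sin_cos_squared_add sin_cos_squared_add2 sin_cos_squared_add3)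
    also have "\<dots> = 2 * sin (r s) * cos (r s) * r' s" by simp
    finally show ?thesis using cos_nz[of s] by (simp add: field_simps power2_eq_square power3_eq_cube)
  qed
  note d = DERIV_cmult[OF DERIV_mult[OF a_deriv[of s] this], of \<kappa>]
  have "(\<lambda>s. \<kappa> * b s) = (\<lambda>s. \<kappa> * (a s * ((sin (r s))\<^sup>2 / (cos (r s))\<^sup>2)))"
    by (simp add: b_eq)
  then show "((\<lambda>s. \<kappa> * b s) has_real_derivative
    \<kappa> * a s * (2 * sin (r s) * r' s / cos (r s) ^ 3 - (n + 1) * sin (r s) * r' s / cos (r s))) (at s)"
    using DERIV_cong[OF d] sin_nz[of s] cos_nz[of s]
    by (simp add: field_simps power2_eq_square power3_eq_cube)
qed

text \<open>The Legendre condition in logarithmic form. The real parts cancel because the squared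
  radii add up to 1, the imaginary parts because \<open>b = a * tan\<^sup>2 r\<close>.\<close>

lemma A_B_orthogonal: "of_real ((sin (r s))\<^sup>2) * A s + of_real ((cos (r s))\<^sup>2) * B s = 0"
  using sin_nz[of s] cos_nz[of s] by (simp add: complex_eq_iff A_def B_def b_eq power2_eq_square)

lemma unit_e: "e1 s * cnj (e1 s) + e2 s * cnj (e2 s) = 1"
  and legendre_e: "e1 s * A s * cnj (e1 s) + e2 s * B s * cnj (e2 s) = 0"
proof -
  have c: "cis x * cnj (cis x) = 1" for x by (simp add: cis_cnj cis_mult)
  have n1: "e1 s * cnj (e1 s) = of_real ((sin (r s))\<^sup>2)"
    using c[of "- (\<kappa> * \<alpha> s)"] by (simp add: e1_def power2_eq_square mult_ac del: cis_cnj)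
  have n2: "e2 s * cnj (e2 s) = of_real ((cos (r s))\<^sup>2)"
    using c[of "\<kappa> * \<beta> s"] by (simp add: e2_def power2_eq_square mult_ac del: cis_cnj)
  show "e1 s * cnj (e1 s) + e2 s * cnj (e2 s) = 1"
    unfolding n1 n2 of_real_add[symmetric] by simp
  have "e1 s * A s * cnj (e1 s) + e2 s * B s * cnj (e2 s)
      = (e1 s * cnj (e1 s)) * A s + (e2 s * cnj (e2 s)) * B s" by (simp add: algebra_simps)
  also have "\<dots> = of_real ((sin (r s))\<^sup>2) * A s + of_real ((cos (r s))\<^sup>2) * B s"
    by (simp only: n1 n2)
  also have "\<dots> = 0" by (rule A_B_orthogonal)
  finally show "e1 s * A s * cnj (e1 s) + e2 s * B s * cnj (e2 s) = 0" .
qed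

lemma sum_ratio: "sin (r s) / cos (r s) + cos (r s) / sin (r s) = 1 / (sin (r s) * cos (r s))"
  using sin_nz[of s] cos_nz[of s] sin_cos_squared_add[of "r s"]
  by (simp add: field_simps power2_eq_square del: sin_cos_squared_add)

lemma B_minus_A:
  "B s - A s = Complex (- r' s / (sin (r s) * cos (r s))) (\<kappa> * a s / (cos (r s))\<^sup>2)"
proof -
  have "- r' s * sin (r s) / cos (r s) - r' s * cos (r s) / sin (r s)
      = - r' s * (sin (r s) / cos (r s) + cos (r s) / sin (r s))"
    by (simp add: algebra_simps)
  also have "\<dots> = - r' s / (sin (r s) * cos (r s))" by (simp add: sum_ratio)
  finally have re: "- r' s * sin (r s) / cos (r s) - r' s * cos (r s) / sin (r s)
      = - r' s / (sin (r s) * cos (r s))" .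
  have "\<kappa> * b s + \<kappa> * a s = \<kappa> * a s * ((sin (r s))\<^sup>2 + (cos (r s))\<^sup>2) / (cos (r s))\<^sup>2"
    using cos_nz[of s] unfolding b_eq
    by (simp add: field_simps del: sin_cos_squared_add sin_cos_squared_add2 sin_cos_squared_add3)
  then show ?thesis using re by (simp add: complex_eq_iff A_def B_def)
qed

lemma A_neq_B: "A s \<noteq> B s"
proof
  assume "A s = B s"
  then have "\<kappa> * a s / (cos (r s))\<^sup>2 = 0" using B_minus_A[of s] by (simp add: complex_eq_iff)
  then show False using \<kappa>_nz sin_nz[of s] cos_nz[of s] by (simp add: a_def)
qed

text \<open>The first integral rewrites the phase contribution
  \<open>(\<kappa> * a s * sin (r s))\<^sup>2\<close> as
  \<open>(1 - (r' s)\<^sup>2) * (cos (r s))\<^sup>2\<close>, and \<open>r'\<close> disappears. This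
  is where the factor \<open>\<kappa>\<close> in the phases makes the speed 1.\<close>

lemma norm_B_minus_A: "(cmod (B s - A s))\<^sup>2 = 1 / ((sin (r s))\<^sup>2 * (cos (r s))\<^sup>2)"
proof -
  have "(1 - (r' s)\<^sup>2) * (cos (r s))\<^sup>2 = \<kappa>\<^sup>2 / (sin (r s)) ^ (2 * n)"
    using first_integral[of s] sin_nz[of s] by (simp add: field_simps)
  also have "\<dots> = (\<kappa> * (1 / sin (r s) ^ n))\<^sup>2"
    by (simp add: power_mult_distrib power_divide power_mult[symmetric] mult.commute)
  also have "1 / sin (r s) ^ n = a s * sin (r s)"
    using sin_nz[of s] by (simp add: a_def)
  finally have fi: "(\<kappa> * a s * sin (r s))\<^sup>2 = (1 - (r' s)\<^sup>2) * (cos (r s))\<^sup>2" by (simp add: mult.assoc)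
  have "(cmod (B s - A s))\<^sup>2 * ((sin (r s))\<^sup>2 * (cos (r s))\<^sup>2) =
     (r' s)\<^sup>2 + (\<kappa> * a s * sin (r s))\<^sup>2 / (cos (r s))\<^sup>2"
    unfolding B_minus_A cmod_power2 complex.sel using sin_nz[of s] cos_nz[of s]
    by (simp add: power_mult_distrib power_divide field_simps power2_eq_square)
  also have "\<dots> = 1" using cos_nz[of s] by (simp add: fi)
  finally show ?thesis using sin_nz[of s] cos_nz[of s] by (simp add: field_simps)
qed

lemma norm_e: "cmod (e1 s) = \<bar>sin (r s)\<bar>" "cmod (e2 s) = \<bar>cos (r s)\<bar>"
  by (simp_all add: e1_def e2_def norm_mult)

lemma unit_speed_e: "(cmod (e1 s * A s))\<^sup>2 + (cmod (e2 s * B s))\<^sup>2 = 1"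
proof -
  have "(cmod (e1 s * A s))\<^sup>2 + (cmod (e2 s * B s))\<^sup>2 = (cmod (e1 s * (e2 s * B s) - e2 s * (e1 s * A s)))\<^sup>2"
    by (rule legendre_algebra(3)[OF unit_e legendre_e])
  also have "e1 s * (e2 s * B s) - e2 s * (e1 s * A s) = e1 s * e2 s * (B s - A s)"
    by (simp add: algebra_simps)
  also have "(cmod (e1 s * e2 s * (B s - A s)))\<^sup>2 = (sin (r s))\<^sup>2 * (cos (r s))\<^sup>2 * (cmod (B s - A s))\<^sup>2"
    by (simp add: e1_def e2_def norm_mult power_mult_distrib)
  also have "\<dots> = 1" using sin_nz[of s] cos_nz[of s] by (simp add: norm_B_minus_A)
  finally show ?thesis .
qed

text \<open>By the norm of \<open>B - A\<close>, dividing by it means multiplying by its conjugate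
  and \<open>S\<^sup>2 * C\<^sup>2\<close>. After the profile equation is inserted for
  \<open>r''\<close>, the quotient has imaginary part
  \<open>k * (n - S\<^sup>2 / C\<^sup>2)\<close>, the exact opposite of the contributions of
  \<open>n * A\<close> and \<open>B\<close>.\<close>

lemma log_condition: "Im (of_real (real n) * A s + B s + (B' s - A' s) / (B s - A s)) = 0"
proof -
  define S C p k where SC: "S = sin (r s)" "C = cos (r s)" "p = r' s" "k = \<kappa> * a s"
  have nz: "S \<noteq> 0" "C \<noteq> 0" using sin_nz cos_nz by (auto simp: SC)
  have r2: "r'' s = (1 - p\<^sup>2) * (real n * C\<^sup>2 - S\<^sup>2) / (S * C)"
    using ode[of s] nz by (simp add: SC field_simps)
  have SC1: "S / C + C / S = 1 / (S * C)" using sum_ratio[of s] by (simp add: SC)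
  have im': "Im (B' s - A' s) = k * p * (2 * S / C ^ 3 - (n + 1) / (S * C))"
  proof -
    have "Im (B' s - A' s) = k * p * (2 * S / C ^ 3 - (n + 1) * (S / C + C / S))"
      using nz by (simp add: A'_def B'_def SC[symmetric] algebra_simps add_divide_distrib)
    then show ?thesis by (simp add: SC1)
  qed
  have re': "Re (B' s - A' s) = - (r'' s / (S * C)) - p\<^sup>2 / C\<^sup>2 + p\<^sup>2 / S\<^sup>2"
  proof -
    have "Re (B' s - A' s) = - (r'' s * (S / C + C / S)) - p\<^sup>2 / C\<^sup>2 + p\<^sup>2 / S\<^sup>2"
      using nz by (simp add: A'_def B'_def SC[symmetric] algebra_simps add_divide_distrib)
    then show ?thesis by (simp add: SC1)
  qed
  have "Im ((B' s - A' s) / (B s - A s)) = Im ((B' s - A' s) * cnj (B s - A s)) * (S\<^sup>2 * C\<^sup>2)"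
    unfolding Im_mult_cnj_divide[symmetric] norm_B_minus_A SC[symmetric] by simp
  also have "\<dots> = (Im (B' s - A' s) * (- p / (S * C)) - Re (B' s - A' s) * (k / C\<^sup>2)) * (S\<^sup>2 * C\<^sup>2)"
    by (simp add: B_minus_A SC[symmetric])
  also have "\<dots> = k * (- p\<^sup>2 * S\<^sup>2 / C\<^sup>2 + real n * p\<^sup>2 + S * r'' s / C)"
    unfolding im' re' using nz by (simp add: field_simps power2_eq_square power3_eq_cube)
  also have "\<dots> = k * (real n - S\<^sup>2 / C\<^sup>2)"
    unfolding r2 using nz by (simp add: field_simps power2_eq_square)
  finally have im: "Im ((B' s - A' s) / (B s - A s)) = k * (real n - S\<^sup>2 / C\<^sup>2)" .
  have "Im (A s) = - k" "Im (B s) = k * S\<^sup>2 / C\<^sup>2"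
    by (simp_all add: A_def B_def b_eq SC)
  then show ?thesis
    unfolding plus_complex.sel Im_of_real_mult im by (simp add: algebra_simps)
qed

sublocale legendre_pair UNIV e1 e2 "\<lambda>s. e1 s * A s" "\<lambda>s. e2 s * B s"
  "\<lambda>s. e1 s * ((A s)\<^sup>2 + A' s)" "\<lambda>s. e2 s * ((B s)\<^sup>2 + B' s)"
proof
  fix s
  have "((\<lambda>s. e1 s * A s) has_vector_derivative e1 s * A' s + e1 s * A s * A s) (at s)"
    by (rule has_vector_derivative_mult[OF e1_deriv A_deriv])
  then show "((\<lambda>s. e1 s * A s) has_vector_derivative e1 s * ((A s)\<^sup>2 + A' s)) (at s)"
    by (simp add: algebra_simps power2_eq_square)
  have "((\<lambda>s. e2 s * B s) has_vector_derivative e2 s * B' s + e2 s * B s * B s) (at s)"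
    by (rule has_vector_derivative_mult[OF e2_deriv B_deriv])
  then show "((\<lambda>s. e2 s * B s) has_vector_derivative e2 s * ((B s)\<^sup>2 + B' s)) (at s)"
    by (simp add: algebra_simps power2_eq_square)
qed (simp_all add: e1_deriv e2_deriv unit_e legendre_e smooth_e)

lemma curve_minimal_e:
  "curve_minimal (real n - 1) (e1 s) (e1 s * A s) (e2 s * B s)
    (e1 s * ((A s)\<^sup>2 + A' s)) (e2 s * ((B s)\<^sup>2 + B' s))"
  by (subst curve_minimal_log_iff[OF unit_e legendre_e e_nz A_neq_B])
    (use log_condition[of s] in simp_all)

end

lemma profile_solutionE:
  assumes "profile_solution n \<rho> r" "n > 0"
  obtains r' r'' where "profile n \<rho> r r' r''"
  using assms unfolding profile_solution_def profile_def by blast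

lemma legendre_pair_sin_cos:
  "legendre_pair UNIV (\<lambda>s. of_real (sin s)) (\<lambda>s. of_real (cos s)) (\<lambda>s. of_real (cos s))
    (\<lambda>s. of_real (- sin s)) (\<lambda>s. of_real (- sin s)) (\<lambda>s. of_real (- cos s))"
proof
  have "smooth_on UNIV (\<lambda>x::real. x)" by (rule smooth_on_bounded_linear) auto
  then show "smooth_on UNIV (\<lambda>s. complex_of_real (sin s))" "smooth_on UNIV (\<lambda>s. complex_of_real (cos s))"
    by (auto intro!: smooth_on_of_real smooth_on_sin_cos)
  show "complex_of_real (sin s) * cnj (of_real (sin s)) + of_real (cos s) * cnj (of_real (cos s)) = 1" for s
    using sin_cos_squared_add[of s]
    by (simp flip: of_real_mult of_real_add add: power2_eq_square)
  show "complex_of_real (cos s) * cnj (of_real (sin s)) + of_real (- sin s) * cnj (of_real (cos s)) = 0" for s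
    by simp
qed (auto intro!: has_vector_derivative_of_real' derivative_eq_intros)

section \<open>Curves congruent to an example\<close>

locale regular_legendre = legendre_pair I g1 g2 v1 v2 w1 w2 for I g1 g2 v1 v2 w1 w2 +
  assumes interval: "is_interval I"
    and smooth_v: "smooth_on I v1" "smooth_on I v2"
    and smooth_w: "smooth_on I w1" "smooth_on I w2"
    and regular: "s \<in> I \<Longrightarrow> v1 s \<noteq> 0 \<or> v2 s \<noteq> 0"

lemma smooth_curve_derivative:
  assumes "smooth_on I f" "s \<in> I"
  shows "(f has_vector_derivative D f s 1) (at s)"
proof -
  have lin: "linear (D f s)"
    by (intro linear_frechet_derivative smooth_on_differentiable[OF assms])
  have "x *\<^sub>R D f s 1 = D f s x" for x
    using linear_scale[OF lin, of x 1] by simp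
  then have eq: "(\<lambda>x. x *\<^sub>R D f s 1) = D f s" by (rule ext)
  show ?thesis
    unfolding has_vector_derivative_def eq by (rule smooth_on_has_derivative[OF assms])
qed

lemma smooth_on_deriv:
  assumes "open I" "smooth_on I (h :: real \<Rightarrow> real)"
  obtains h'' where "\<And>s. s \<in> I \<Longrightarrow> (h has_real_derivative deriv h s) (at s)"
    "\<And>s. s \<in> I \<Longrightarrow> (deriv h has_real_derivative h'' s) (at s)"
proof -
  have h: "(h has_real_derivative D h s 1) (at s)" if "s \<in> I" for s
    using smooth_curve_derivative[OF assms(2) that]
    by (simp add: has_real_derivative_iff_has_vector_derivative)
  have h': "((\<lambda>s. D h s 1) has_real_derivative D (\<lambda>s. D h s 1) s 1) (at s)" if "s \<in> I" for s
    using smooth_curve_derivative[OF smooth_on_D[OF assms(2)] that]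
    by (simp add: has_real_derivative_iff_has_vector_derivative)
  have eq: "D h s 1 = deriv h s" if "s \<in> I" for s using DERIV_imp_deriv[OF h[OF that]] by simp
  show thesis
  proof (rule that)
    show "(h has_real_derivative deriv h s) (at s)" if "s \<in> I" for s
      using h[OF that] by (simp only: eq[OF that])
    show "(deriv h has_real_derivative D (\<lambda>s. D h s 1) s 1) (at s)" if "s \<in> I" for s
      by (rule has_field_derivative_transform_within_open[OF h'[OF that] assms(1) that eq])
  qed
qed

lemma legendre_curve_regular:
  assumes "open I" "is_interval I" "legendre_curve I \<gamma>"
  defines "g \<equiv> \<lambda>i s. \<gamma> s $ i"
  defines "v \<equiv> \<lambda>i s. D (g i) s 1"
  defines "w \<equiv> \<lambda>i s. D (v i) s 1"
  shows "regular_legendre I (g 1) (g 2) (v 1) (v 2) (w 1) (w 2)"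
proof
  have smooth_\<gamma>: "smooth_on I \<gamma>" using assms(3) by (simp add: legendre_curve_def)
  have sg: "smooth_on I (g i)" for i
    unfolding g_def by (intro smooth_on_vec_nth assms(1) smooth_\<gamma>)
  have sv: "smooth_on I (v i)" for i unfolding v_def by (intro smooth_on_D sg)
  have sw: "smooth_on I (w i)" for i unfolding w_def by (intro smooth_on_D sv)
  show "open I" "is_interval I" by fact+
  show "smooth_on I (g 1)" "smooth_on I (g 2)" "smooth_on I (v 1)" "smooth_on I (v 2)"
    "smooth_on I (w 1)" "smooth_on I (w 2)" by (fact sg sv sw)+
  fix s assume s: "s \<in> I"
  show "(g 1 has_vector_derivative v 1 s) (at s)" "(g 2 has_vector_derivative v 2 s) (at s)"
    unfolding v_def by (intro smooth_curve_derivative[OF sg s])+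
  show "(v 1 has_vector_derivative w 1 s) (at s)" "(v 2 has_vector_derivative w 2 s) (at s)"
    unfolding w_def by (intro smooth_curve_derivative[OF sv s])+
  have vd: "vector_derivative \<gamma> (at s) $ i = v i s" for i
  proof -
    have "(\<gamma> has_vector_derivative D \<gamma> s 1) (at s)" by (rule smooth_curve_derivative[OF smooth_\<gamma> s])
    then have "vector_derivative \<gamma> (at s) = D \<gamma> s 1" by (rule vector_derivative_at)
    moreover have "(g i has_derivative (\<lambda>u. D \<gamma> s u $ i)) (at s)"
      unfolding g_def by (intro has_derivative_vec_nth smooth_on_has_derivative[OF smooth_\<gamma> s])
    ultimately show ?thesis by (simp add: v_def D_eq)
  qed
  have leg: "norm (\<gamma> s) = 1" "vector_derivative \<gamma> (at s) \<noteq> 0"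
    "vector_derivative \<gamma> (at s) $ 1 * cnj (\<gamma> s $ 1) + vector_derivative \<gamma> (at s) $ 2 * cnj (\<gamma> s $ 2) = 0"
    using assms(3) s by (auto simp: legendre_curve_def)
  have "herm (\<gamma> s) (\<gamma> s) = 1" by (simp only: herm_self leg) simp
  then show "g 1 s * cnj (g 1 s) + g 2 s * cnj (g 2 s) = 1"
    by (simp add: herm_def g_def sum_2)
  show "v 1 s * cnj (g 1 s) + v 2 s * cnj (g 2 s) = 0" using leg(3) by (simp add: vd g_def)
  show "v 1 s \<noteq> 0 \<or> v 2 s \<noteq> 0"
    using leg(2) by (auto simp: vec_eq_iff vd forall_2)
qed

text \<open>Both pulled-back metrics are warped products over the same manifold. Testing on a vector
  tangent to the manifold gives the radii, testing on the parameter direction gives the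
  speeds.\<close>

lemma congruent_speed:
  fixes \<A> :: "('p::{t2_space, second_countable_topology}, 'e::euclidean_space) atlas"
    and \<psi> :: "'p \<Rightarrow> complex^('m::finite option)"
  assumes atlas: "smooth_atlas \<A>" and min: "minimal_lagrangian_immersion \<A> \<phi>"
    and lift: "horizontal_lift \<A> \<phi> \<psi>"
    and g: "legendre_pair I g1 g2 v1 v2 w1 w2"
    and e: "legendre_pair UNIV e1 e2 a1 a2 b1 b2"
    and cong: "congruent_on I J (curve_map g1 g2 \<psi>) (curve_map e1 e2 \<psi>)"
  obtains h where "smooth_on I h" "\<And>s. s \<in> I \<Longrightarrow> deriv h s \<noteq> 0" "h ` I \<subseteq> J"
    "\<And>s. s \<in> I \<Longrightarrow> cmod (g1 s) = cmod (e1 (h s))"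
    "\<And>s. s \<in> I \<Longrightarrow> (cmod (v1 s))\<^sup>2 + (cmod (v2 s))\<^sup>2 =
      (deriv h s)\<^sup>2 * ((cmod (a1 (h s)))\<^sup>2 + (cmod (a2 (h s)))\<^sup>2)"
proof -
  from cong obtain T h where T: "holomorphic_isometry T" and h: "smooth_on I h"
    "\<And>s. s \<in> I \<Longrightarrow> deriv h s \<noteq> 0" "h ` I \<subseteq> J"
    and eq: "\<And>s x. s \<in> I \<Longrightarrow> curve_map g1 g2 \<psi> (s, x) = T (curve_map e1 e2 \<psi> (h s, x))"
    unfolding congruent_on_def by auto
  have "(undefined :: 'p) \<in> (\<Union>(U, c)\<in>\<A>. U)" using atlas by (simp add: smooth_atlas_def)
  then obtain U c where A: "(U, c) \<in> \<A>" and x0: "undefined \<in> U" by auto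
  define y where "y = c undefined"
  have y: "y \<in> c ` U" using x0 by (simp add: y_def)
  have uh: "unit_horizontal (c ` U) (\<psi> \<circ> inv_into U c)"
    by (rule horizontal_lift_unit_horizontal[OF atlas lift A])
  interpret C1: curve_lift I g1 g2 v1 v2 w1 w2 "c ` U" "\<psi> \<circ> inv_into U c"
    by (intro curve_lift.intro g curve_lift_axioms.intro uh)
  interpret C2: curve_lift UNIV e1 e2 a1 a2 b1 b2 "c ` U" "\<psi> \<circ> inv_into U c"
    by (intro curve_lift.intro e curve_lift_axioms.intro uh)
  define \<sigma> where "\<sigma> = (\<lambda>z :: real \<times> 'e. (h (fst z), snd z))"
  have hd: "(h has_vector_derivative deriv h s) (at s)" if "s \<in> I" for s
    using smooth_curve_derivative[OF h(1) that]
    by (metis DERIV_imp_deriv has_real_derivative_iff_has_vector_derivative)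
  have d\<sigma>: "(\<sigma> has_derivative (\<lambda>q. (fst q *\<^sub>R deriv h (fst z), snd q))) (at z)" if "z \<in> I \<times> c ` U" for z
    unfolding \<sigma>_def
    by (intro has_derivative_Pair C1.has_derivative_fst_compose hd has_derivative_snd has_derivative_ident)
      (use that in auto)
  have metric: "norm (D C1.F (s, y) (a, u)) = norm (D C2.F (h s, y) (a * deriv h s, u))" if s: "s \<in> I" for s a u
  proof -
    have "norm (D C1.F (s, y) (a, u)) = norm (D C2.F (\<sigma> (s, y)) (D \<sigma> (s, y) (a, u)))"
    proof (rule isometry_metric[OF T C1.unit_horizontal_F C2.unit_horizontal_F])
      show "\<sigma> ` (I \<times> c ` U) \<subseteq> UNIV \<times> c ` U" by (auto simp: \<sigma>_def)
      show "\<sigma> differentiable (at z)" if "z \<in> I \<times> c ` U" for z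
        using d\<sigma>[OF that] by (auto simp: differentiable_def)
      show "(s, y) \<in> I \<times> c ` U" using s y by simp
      fix z assume "z \<in> I \<times> c ` U"
      then have "fst z \<in> I" by auto
      then show "hopf (C1.F z) = T (hopf (C2.F (\<sigma> z)))"
        using eq[of "fst z" "inv_into U c (snd z)"]
        by (simp add: curve_map_def C1.F_def C2.F_def \<sigma>_def)
    qed
    also have "D \<sigma> (s, y) (a, u) = (a * deriv h s, u)"
      using D_eq[OF d\<sigma>[of "(s, y)"]] s y by simp
    finally show ?thesis by (simp only: \<sigma>_def fst_conv snd_conv)
  qed
  let ?p = "\<psi> \<circ> inv_into U c"
  have sq: "(norm (D C1.F (s, y) (a, u)))\<^sup>2 = a\<^sup>2 * ((cmod (v1 s))\<^sup>2 + (cmod (v2 s))\<^sup>2)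
      + (cmod (g1 s))\<^sup>2 * (norm (D ?p y u))\<^sup>2" if "s \<in> I" for s a u
  proof -
    have "Re (herm (D C1.F (s, y) (a, u)) (D C1.F (s, y) (a, u))) = a\<^sup>2 * ((cmod (v1 s))\<^sup>2 + (cmod (v2 s))\<^sup>2)
      + (cmod (g1 s))\<^sup>2 * (norm (D ?p y u))\<^sup>2"
      unfolding C1.herm_D_F[OF that y] plus_complex.sel Re_of_real_mult
      by (simp only: herm_self Re_complex_of_real) (simp add: power2_eq_square)
    then show ?thesis by (simp only: herm_self Re_complex_of_real)
  qed
  have sq': "(norm (D C2.F (s, y) (a, u)))\<^sup>2 = a\<^sup>2 * ((cmod (a1 s))\<^sup>2 + (cmod (a2 s))\<^sup>2)
      + (cmod (e1 s))\<^sup>2 * (norm (D ?p y u))\<^sup>2" for s a u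
  proof -
    have "Re (herm (D C2.F (s, y) (a, u)) (D C2.F (s, y) (a, u))) = a\<^sup>2 * ((cmod (a1 s))\<^sup>2 + (cmod (a2 s))\<^sup>2)
      + (cmod (e1 s))\<^sup>2 * (norm (D ?p y u))\<^sup>2"
      unfolding C2.herm_D_F[OF UNIV_I y] plus_complex.sel Re_of_real_mult
      by (simp only: herm_self Re_complex_of_real) (simp add: power2_eq_square)
    then show ?thesis by (simp only: herm_self Re_complex_of_real)
  qed
  have lin: "linear (D ?p y)" by (rule C1.linear_Dp[OF y])
  have inj: "inj (D ?p y)"
    using minimal_lagrangian_lift[OF atlas min lift A y] by (simp add: lift_minimal_at_def)
  obtain u :: 'e where u: "u \<in> Basis" using nonempty_Basis by blast
  have nz: "D ?p y u \<noteq> 0"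
    using lin inj u nonzero_Basis by (auto simp: linear_injective_0)
  show thesis
  proof (rule that[OF h])
    fix s assume s: "s \<in> I"
    have "(cmod (g1 s))\<^sup>2 * (norm (D ?p y u))\<^sup>2 = (cmod (e1 (h s)))\<^sup>2 * (norm (D ?p y u))\<^sup>2"
      using sq[OF s, of 0 u] sq'[of "h s" 0 u] metric[OF s, of 0 u] by auto
    then show "cmod (g1 s) = cmod (e1 (h s))" using nz by (simp add: power2_eq_iff_nonneg)
    show "(cmod (v1 s))\<^sup>2 + (cmod (v2 s))\<^sup>2 =
      (deriv h s)\<^sup>2 * ((cmod (a1 (h s)))\<^sup>2 + (cmod (a2 (h s)))\<^sup>2)"
      using sq[OF s, of 1 0] sq'[of "h s" "deriv h s" 0] metric[OF s, of 1 0]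
      by (simp add: linear_0[OF lin])
  qed
qed

section \<open>Recovering the minimality condition from radius and speed\<close>

context regular_legendre
begin

lemma g1_norm_derivative:
  assumes "s \<in> I"
  shows "((\<lambda>s. (cmod (g1 s))\<^sup>2) has_real_derivative 2 * Re (v1 s * cnj (g1 s))) (at s)"
proof -
  have "((\<lambda>s. Re (g1 s * cnj (g1 s))) has_vector_derivative
      Re (g1 s * cnj (v1 s) + v1 s * cnj (g1 s))) (at s)"
    by (intro bounded_linear.has_vector_derivative[OF bounded_linear_Re] has_vector_derivative_mult
        bounded_linear.has_vector_derivative[OF bounded_linear_cnj] v assms)
  moreover have "Re (g1 s * cnj (g1 s)) = (cmod (g1 s))\<^sup>2" for s
    by (simp flip: of_real_cmod_square)
  ultimately show ?thesis
    by (simp add: has_real_derivative_iff_has_vector_derivative mult.commute)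
qed

text \<open>Radius and speed determine the modulus of \<open>v1 s * cnj (g1 s)\<close>. Its real
  part is half the derivative of the squared radius, so its imaginary part is known up to
  sign.\<close>

lemma momentum_square:
  assumes s: "s \<in> I"
  shows "(Re (v1 s * cnj (g1 s)))\<^sup>2 + (Im (v1 s * cnj (g1 s)))\<^sup>2 =
    ((cmod (v1 s))\<^sup>2 + (cmod (v2 s))\<^sup>2) * (cmod (g1 s))\<^sup>2 * (1 - (cmod (g1 s))\<^sup>2)"
proof -
  note la = legendre_algebra[OF unit[OF s] legendre[OF s]]
  have "complex_of_real ((cmod (g1 s))\<^sup>2 + (cmod (g2 s))\<^sup>2) = 1"
    using unit[OF s] by (simp add: of_real_cmod_square)
  then have g2: "(cmod (g2 s))\<^sup>2 = 1 - (cmod (g1 s))\<^sup>2"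
    by (simp only: of_real_eq_1_iff)
  have "(Re (v1 s * cnj (g1 s)))\<^sup>2 + (Im (v1 s * cnj (g1 s)))\<^sup>2 = (cmod (v1 s * cnj (g1 s)))\<^sup>2"
    by (simp only: cmod_power2)
  also have "\<dots> = (cmod (g1 s * v2 s - g2 s * v1 s))\<^sup>2 * (cmod (g2 s))\<^sup>2 * (cmod (g1 s))\<^sup>2"
    by (subst la(1)) (simp add: norm_mult power_mult_distrib norm_minus_commute)
  finally show ?thesis by (simp add: la(3) g2)
qed

text \<open>Radius and speed are those of the example run through by \<open>h\<close>, which fixes
  the logarithmic derivatives up to conjugation; the condition proved for the example then
  transfers. The radii are compared as squares because \<open>sin (r (h s))\<close> may be
  negative.\<close>

theorem curve_minimal_profile:
  assumes P: "profile n \<rho> r r' r''"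
    and h: "\<And>s. s \<in> I \<Longrightarrow> (h has_real_derivative h' s) (at s)"
    and h': "\<And>s. s \<in> I \<Longrightarrow> (h' has_real_derivative h'' s) (at s)"
    and h'_nz: "\<And>s. s \<in> I \<Longrightarrow> h' s \<noteq> 0"
    and radius: "\<And>s. s \<in> I \<Longrightarrow> (cmod (g1 s))\<^sup>2 = (sin (r (h s)))\<^sup>2"
    and speed: "\<And>s. s \<in> I \<Longrightarrow> (cmod (v1 s))\<^sup>2 + (cmod (v2 s))\<^sup>2 = (h' s)\<^sup>2"
    and s: "s \<in> I"
  shows "g1 s \<noteq> 0" "curve_minimal (real n - 1) (g1 s) (v1 s) (v2 s) (w1 s) (w2 s)"
proof -
  interpret P: profile n \<rho> r r' r'' by fact
  let ?S = "\<lambda>s. sin (r (h s))" and ?C = "\<lambda>s. cos (r (h s))"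
  have g1_nz: "g1 s \<noteq> 0" if "s \<in> I" for s
    using radius[OF that] P.sin_nz[of "h s"] by auto
  have gg1: "g1 s * cnj (g1 s) = of_real ((?S s)\<^sup>2)" if "s \<in> I" for s
    by (simp only: complex_norm_square[symmetric] radius[OF that])
  have gg2: "g2 s * cnj (g2 s) = of_real ((?C s)\<^sup>2)" if "s \<in> I" for s
  proof -
    have "g2 s * cnj (g2 s) = 1 - of_real ((?S s)\<^sup>2)"
      using unit[OF that] unfolding gg1[OF that] by (simp add: algebra_simps)
    also have "\<dots> = of_real (1 - (?S s)\<^sup>2)" by simp
    also have "1 - (?S s)\<^sup>2 = (?C s)\<^sup>2" by (simp add: cos_squared_eq)
    finally show ?thesis .
  qed
  have g2_nz: "g2 s \<noteq> 0" if "s \<in> I" for s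
    using gg2[OF that] P.cos_nz[of "h s"] by auto
  have re: "Re (v1 s * cnj (g1 s)) = h' s * (?S s)\<^sup>2 * Re (P.A (h s))" if s: "s \<in> I" for s
  proof -
    have d: "((\<lambda>s. (?S s)\<^sup>2) has_real_derivative 2 * ?S s * (?C s * (r' (h s) * h' s))) (at s)"
      by (auto intro!: derivative_eq_intros DERIV_chain2[OF P.r h] s)
    have "((\<lambda>s. (cmod (g1 s))\<^sup>2) has_real_derivative 2 * ?S s * (?C s * (r' (h s) * h' s))) (at s)"
      by (rule has_field_derivative_transform_within_open[OF d open_I s]) (simp add: radius)
    from DERIV_unique[OF this g1_norm_derivative[OF s]]
    have "Re (v1 s * cnj (g1 s)) = ?S s * (?C s * (r' (h s) * h' s))" by linarith
    also have "\<dots> = h' s * (?S s)\<^sup>2 * Re (P.A (h s))"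
      using P.sin_nz[of "h s"] by (simp add: P.A_def power2_eq_square)
    finally show ?thesis .
  qed
  have im: "(Im (v1 s * cnj (g1 s)))\<^sup>2 = (h' s * (?S s)\<^sup>2 * Im (P.A (h s)))\<^sup>2" if s: "s \<in> I" for s
  proof -
    have n: "(cmod (P.A t - P.B t))\<^sup>2 = 1 / ((sin (r t))\<^sup>2 * (cos (r t))\<^sup>2)" for t
      using P.norm_B_minus_A[of t] by (simp add: norm_minus_commute)
    have "of_real ((cos (r t))\<^sup>2) * (P.A t - P.B t) = P.A t" for t
    proof -
      have "of_real ((sin (r t))\<^sup>2) = 1 - complex_of_real ((cos (r t))\<^sup>2)"
        by (simp add: sin_squared_eq)
      then have "(1 - complex_of_real ((cos (r t))\<^sup>2)) * P.A t + of_real ((cos (r t))\<^sup>2) * P.B t = 0"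
        using P.A_B_orthogonal[of t] by metis
      then show ?thesis by algebra
    qed
    from this[of "h s"]
    have "(cmod (P.A (h s)))\<^sup>2 = (?C s ^ 2)\<^sup>2 * (cmod (P.A (h s) - P.B (h s)))\<^sup>2"
      by (metis norm_mult norm_of_real power_mult_distrib power2_abs)
    also have "\<dots> = (?C s)\<^sup>2 / (?S s)\<^sup>2"
      using P.cos_nz[of "h s"] unfolding n by (simp add: power2_eq_square)
    finally have A: "(Re (P.A (h s)))\<^sup>2 + (Im (P.A (h s)))\<^sup>2 = (?C s)\<^sup>2 / (?S s)\<^sup>2"
      by (simp only: cmod_power2)
    have "(Im (v1 s * cnj (g1 s)))\<^sup>2 = (h' s)\<^sup>2 * (?S s)\<^sup>2 * (?C s)\<^sup>2 - (h' s * (?S s)\<^sup>2 * Re (P.A (h s)))\<^sup>2"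
      using momentum_square[OF s] unfolding re[OF s] speed[OF s] radius[OF s]
      by (simp add: cos_squared_eq)
    also have "(h' s)\<^sup>2 * (?S s)\<^sup>2 * (?C s)\<^sup>2 =
        (h' s * (?S s)\<^sup>2)\<^sup>2 * ((Re (P.A (h s)))\<^sup>2 + (Im (P.A (h s)))\<^sup>2)"
      unfolding A using P.sin_nz[of "h s"] by (simp add: power2_eq_square)
    finally show ?thesis by (simp add: power_mult_distrib algebra_simps)
  qed
  have sq_nz: "h' s * (?S s)\<^sup>2 * Im (P.A (h s)) \<noteq> 0" if "s \<in> I" for s
    using h'_nz[OF that] P.sin_nz[of "h s"] P.\<kappa>_nz by (simp add: P.A_def P.a_def)
  \<comment> \<open>The ratio of the imaginary parts of the curve and the example. It takes only the
    values 1 and -1 and is continuous on an interval, so the conjugation cannot be switched on the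
    way.\<close>
  define q where "q = (\<lambda>s. Im (v1 s * cnj (g1 s)) / (h' s * (?S s)\<^sup>2 * Im (P.A (h s))))"
  have q1: "q s = 1 \<or> q s = - 1" if "s \<in> I" for s
  proof -
    have "(q s)\<^sup>2 = 1" using im[OF that] sq_nz[OF that] by (simp add: q_def power_divide)
    then show ?thesis by (simp add: power2_eq_1_iff)
  qed
  have "continuous_on I q"
  proof -
    have ch: "continuous_on I h"
      by (intro continuous_at_imp_continuous_on ballI DERIV_isCont[OF h])
    have ch': "continuous_on I h'"
      by (intro continuous_at_imp_continuous_on ballI DERIV_isCont[OF h'])
    have "continuous_on UNIV P.A"
      by (intro continuous_at_imp_continuous_on ballI has_vector_derivative_continuous[OF P.A_deriv])
    then have cA: "continuous_on I (\<lambda>s. Im (P.A (h s)))"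
      by (rule continuous_on_Im[OF continuous_on_compose2[OF _ ch subset_UNIV]])
    have cr: "continuous_on I (\<lambda>s. r (h s))"
      by (rule continuous_on_compose2[OF smooth_on_continuous[OF P.smooth_r] ch subset_UNIV])
    have cm: "continuous_on I (\<lambda>s. Im (v1 s * cnj (g1 s)))"
      by (intro continuous_on_Im continuous_on_mult continuous_on_cnj
          smooth_on_continuous[OF smooth_v(1)] smooth_on_continuous[OF smooth_g(1)])
    show ?thesis
      unfolding q_def
      by (intro continuous_on_divide continuous_on_mult continuous_on_power continuous_on_sin
          cm ch' cr cA ballI sq_nz)
  qed
  moreover have "connected I" using interval by (simp add: is_interval_connected)
  ultimately have "connected (q ` I)" by (rule connected_continuous_image)
  have "(\<forall>s\<in>I. q s = 1) \<or> (\<forall>s\<in>I. q s = - 1)"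
  proof (rule ccontr)
    assume "\<not> ?thesis"
    then obtain t1 t2 where "t1 \<in> I" "t2 \<in> I" "q t1 = 1" "q t2 = - 1" using q1 by metis
    then have "0 \<in> q ` I"
      using connectedD_interval[OF \<open>connected (q ` I)\<close>, of "- 1" 1 0] by (metis imageI neg_le_0_iff_le zero_le_one)
    then show False using q1 by force
  qed
  text \<open>Up to complex conjugation the logarithmic derivatives are those of the example.\<close>
  then obtain j :: "complex \<Rightarrow> complex" where j: "j = (\<lambda>z. z) \<or> j = cnj"
    and v1g1: "\<And>s. s \<in> I \<Longrightarrow> v1 s * cnj (g1 s) = of_real (h' s * (?S s)\<^sup>2) * j (P.A (h s))"
  proof
    assume q: "\<forall>s\<in>I. q s = 1"
    have "v1 s * cnj (g1 s) = of_real (h' s * (?S s)\<^sup>2) * P.A (h s)" if "s \<in> I" for s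
    proof -
      have "Im (v1 s * cnj (g1 s)) = h' s * (?S s)\<^sup>2 * Im (P.A (h s))"
        using q that sq_nz[OF that] by (simp add: q_def)
      then show ?thesis
        using re[OF that] by (intro complex_eqI) (simp_all only: Re_of_real_mult Im_of_real_mult)
    qed
    then show thesis using that[of "\<lambda>z. z"] by blast
  next
    assume q: "\<forall>s\<in>I. q s = - 1"
    have "v1 s * cnj (g1 s) = of_real (h' s * (?S s)\<^sup>2) * cnj (P.A (h s))" if "s \<in> I" for s
    proof -
      have "Im (v1 s * cnj (g1 s)) = - (h' s * (?S s)\<^sup>2 * Im (P.A (h s)))"
        using q that sq_nz[OF that] by (auto simp: q_def divide_eq_eq)
      then show ?thesis
        using re[OF that] by (intro complex_eqI) (simp_all only: Re_of_real_mult Im_of_real_mult, simp_all)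
    qed
    then show thesis using that[of cnj] by blast
  qed
  have jl: "bounded_linear j" using j bounded_linear_cnj bounded_linear_ident by auto
  have jm: "j (of_real x * z) = of_real x * j z" "j (z / y) = j z / j y" "j (z + y) = j z + j y"
    "j (z - y) = j z - j y" "Im z = 0 \<Longrightarrow> Im (j z) = 0" "j z = j y \<longleftrightarrow> z = y" for x z y
    using j by auto
  define A B where "A s = of_real (h' s) * j (P.A (h s))" and "B s = of_real (h' s) * j (P.B (h s))" for s
  define A' B' where "A' s = of_real ((h' s)\<^sup>2) * j (P.A' (h s)) + of_real (h'' s) * j (P.A (h s))"
    and "B' s = of_real ((h' s)\<^sup>2) * j (P.B' (h s)) + of_real (h'' s) * j (P.B (h s))" for s
  have v1: "v1 s = g1 s * A s" if s: "s \<in> I" for s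
  proof -
    have "v1 s * of_real ((?S s)\<^sup>2) = (v1 s * cnj (g1 s)) * g1 s"
      unfolding gg1[OF s, symmetric] by (simp add: mult_ac)
    also have "\<dots> = (g1 s * A s) * of_real ((?S s)\<^sup>2)"
      unfolding v1g1[OF s] by (simp add: A_def mult_ac)
    finally show ?thesis using P.sin_nz[of "h s"] by simp
  qed
  have v2: "v2 s = g2 s * B s" if s: "s \<in> I" for s
  proof -
    have "j (of_real ((?S s)\<^sup>2) * P.A (h s) + of_real ((?C s)\<^sup>2) * P.B (h s)) = 0"
      unfolding P.A_B_orthogonal using j by auto
    then have jAB: "of_real ((?C s)\<^sup>2) * j (P.B (h s)) = - (of_real ((?S s)\<^sup>2) * j (P.A (h s)))"
      by (simp only: jm) (simp add: eq_neg_iff_add_eq_0 add.commute)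
    have "v2 s * of_real ((?C s)\<^sup>2) = (v2 s * cnj (g2 s)) * g2 s"
      unfolding gg2[OF s, symmetric] by (simp add: mult_ac)
    also have "v2 s * cnj (g2 s) = - (v1 s * cnj (g1 s))"
      using legendre[OF s] by (simp add: eq_neg_iff_add_eq_0 add.commute)
    also have "\<dots> = of_real (h' s) * (of_real ((?C s)\<^sup>2) * j (P.B (h s)))"
      unfolding v1g1[OF s] jAB by simp
    finally have "v2 s * of_real ((?C s)\<^sup>2) = (g2 s * B s) * of_real ((?C s)\<^sup>2)"
      by (simp add: B_def mult_ac)
    then show ?thesis using P.cos_nz[of "h s"] by simp
  qed
  have deriv: "((\<lambda>s. of_real (h' s) * j (X (h s))) has_vector_derivative
      of_real ((h' s)\<^sup>2) * j (X' (h s)) + of_real (h'' s) * j (X (h s))) (at s)"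
    if s: "s \<in> I" and X: "\<And>t. (X has_vector_derivative X' t) (at t)" for X X' s
  proof -
    have "((\<lambda>s. X (h s)) has_vector_derivative h' s *\<^sub>R X' (h s)) (at s)"
      using vector_diff_chain_at[OF _ X, of h "h' s" s] h[OF s]
      by (simp add: has_real_derivative_iff_has_vector_derivative o_def)
    from has_vector_derivative_mult[OF has_vector_derivative_of_real'[OF h'[OF s]]
        bounded_linear.has_vector_derivative[OF jl this]]
    have "((\<lambda>s. of_real (h' s) * j (X (h s))) has_vector_derivative
      of_real (h' s) * j (of_real (h' s) * X' (h s)) + of_real (h'' s) * j (X (h s))) (at s)"
      by (simp add: scaleR_conv_of_real)
    then show ?thesis by (simp only: jm) (simp add: power2_eq_square mult.assoc)
  qed
  have w: "W s = g s * ((X s)\<^sup>2 + X' s)"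
    if s: "s \<in> I" and g: "(g has_vector_derivative V s) (at s)" and V: "(V has_vector_derivative W s) (at s)"
      and VX: "\<And>s. s \<in> I \<Longrightarrow> V s = g s * X s" and X: "(X has_vector_derivative X' s) (at s)"
    for g V W X X' :: "real \<Rightarrow> complex" and s
  proof -
    have "((\<lambda>s. g s * X s) has_vector_derivative g s * X' s + V s * X s) (at s)"
      by (rule has_vector_derivative_mult[OF g X])
    then have "(V has_vector_derivative g s * X' s + V s * X s) (at s)"
      by (rule has_vector_derivative_transform_within_open[OF _ open_I s]) (simp add: VX)
    from vector_derivative_unique_at[OF V this]
    show ?thesis by (simp add: VX[OF s] power2_eq_square algebra_simps)
  qed
  have dA: "(A has_vector_derivative A' s) (at s)" and dB: "(B has_vector_derivative B' s) (at s)"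
    unfolding A_def[abs_def] B_def[abs_def] A'_def B'_def
    by (rule deriv[OF s P.A_deriv] deriv[OF s P.B_deriv])+
  have AB: "A s \<noteq> B s"
    using h'_nz[OF s] P.A_neq_B[of "h s"] by (simp add: A_def B_def jm)
  show "g1 s \<noteq> 0" by (rule g1_nz[OF s])
  have BA: "B s - A s = of_real (h' s) * j (P.B (h s) - P.A (h s))"
    by (simp add: A_def B_def jm algebra_simps)
  have BA_nz: "j (P.B (h s) - P.A (h s)) \<noteq> 0"
    using AB BA by auto
  \<comment> \<open>The change of parameter contributes only the real number
    \<open>h'' / h'\<close>, which has no influence on the imaginary part.\<close>
  have "(B' s - A' s) / (B s - A s) = of_real (h' s) * j ((P.B' (h s) - P.A' (h s)) / (P.B (h s) - P.A (h s)))
      + of_real (h'' s / h' s)"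
  proof -
    have "B' s - A' s = of_real ((h' s)\<^sup>2) * j (P.B' (h s) - P.A' (h s)) + of_real (h'' s) * j (P.B (h s) - P.A (h s))"
      by (simp add: A'_def B'_def jm algebra_simps)
    then show ?thesis
      unfolding BA jm(2) using BA_nz h'_nz[OF s] by (simp add: field_simps power2_eq_square)
  qed
  then have "of_real (real n) * A s + B s + (B' s - A' s) / (B s - A s) =
      of_real (h' s) * j (of_real (real n) * P.A (h s) + P.B (h s)
        + (P.B' (h s) - P.A' (h s)) / (P.B (h s) - P.A (h s))) + of_real (h'' s / h' s)"
    using jm(1)[of "real n"] by (simp only: jm(3)) (simp add: A_def B_def jm algebra_simps)
  then have "Im (of_real (real n) * A s + B s + (B' s - A' s) / (B s - A s)) =
      h' s * Im (j (of_real (real n) * P.A (h s) + P.B (h s)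
        + (P.B' (h s) - P.A' (h s)) / (P.B (h s) - P.A (h s))))"
    by (simp only: plus_complex.sel Im_of_real_mult Im_complex_of_real add_0_right)
  then have "Im (of_real (real n) * A s + B s + (B' s - A' s) / (B s - A s)) = 0"
    using jm(5)[OF P.log_condition[of "h s"]] by simp
  then show "curve_minimal (real n - 1) (g1 s) (v1 s) (v2 s) (w1 s) (w2 s)"
    by (subst curve_minimal_log_iff[OF unit[OF s] legendre[OF s] g1_nz[OF s] g2_nz[OF s] AB
          v1[OF s] v2[OF s] w[of s g1 v1 w1 A A', OF s v(1)[OF s] legendre_pair.w(1)[OF legendre_pair_axioms s] v1 dA]
          w[of s g2 v2 w2 B B', OF s v(2)[OF s] legendre_pair.w(2)[OF legendre_pair_axioms s] v2 dB]])
      simp_all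
qed

text \<open>With radius \<open>sin h\<close> and speed \<open>\<bar>h'\<bar>\<close> the radial
  motion uses up all of \<open>momentum_square\<close>, so \<open>v1\<close> is a real multiple of
  \<open>g1\<close> and, where \<open>g2\<close> is nonzero, \<open>v2\<close> of \<open>g2\<close>.
  Differentiating shows the same for the second derivatives, and both summands of
  \<open>curve_minimal\<close> vanish.\<close>

theorem curve_minimal_great_circle:
  assumes h: "\<And>s. s \<in> I \<Longrightarrow> (h has_real_derivative h' s) (at s)"
    and pos: "\<And>s. s \<in> I \<Longrightarrow> sin (h s) > 0"
    and radius: "\<And>s. s \<in> I \<Longrightarrow> cmod (g1 s) = sin (h s)"
    and speed: "\<And>s. s \<in> I \<Longrightarrow> (cmod (v1 s))\<^sup>2 + (cmod (v2 s))\<^sup>2 = (h' s)\<^sup>2"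
    and s: "s \<in> I"
  shows "g1 s \<noteq> 0" "curve_minimal d (g1 s) (v1 s) (v2 s) (w1 s) (w2 s)"
proof -
  show g1: "g1 s \<noteq> 0" using radius[OF s] pos[OF s] by auto
  have im1: "Im (v1 s * cnj (g1 s)) = 0" if s: "s \<in> I" for s
  proof -
    have d: "((\<lambda>s. (sin (h s))\<^sup>2) has_real_derivative 2 * sin (h s) * (cos (h s) * h' s)) (at s)"
      by (auto intro!: derivative_eq_intros h s)
    have "((\<lambda>s. (cmod (g1 s))\<^sup>2) has_real_derivative 2 * sin (h s) * (cos (h s) * h' s)) (at s)"
      by (rule has_field_derivative_transform_within_open[OF d open_I s]) (simp add: radius)
    from DERIV_unique[OF this g1_norm_derivative[OF s]]
    have "Re (v1 s * cnj (g1 s)) = sin (h s) * cos (h s) * h' s" by linarith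
    then have "(Im (v1 s * cnj (g1 s)))\<^sup>2 = 0"
      using momentum_square[OF s] unfolding speed[OF s] radius[OF s]
      by (simp add: power_mult_distrib cos_squared_eq[symmetric] mult_ac)
    then show ?thesis by simp
  qed
  have im2: "Im (v2 s * cnj (g2 s)) = 0" if s: "s \<in> I" for s
  proof -
    have "v2 s * cnj (g2 s) = - (v1 s * cnj (g1 s))"
      using legendre[OF s] by (simp add: eq_neg_iff_add_eq_0 add.commute)
    then show ?thesis using im1[OF s] by (simp del: complex_cnj_cnj)
  qed
  have im_deriv: "Im (y' * cnj g + y s * cnj (x')) = 0"
    if s: "s \<in> I" and z: "\<And>s. s \<in> I \<Longrightarrow> Im (y s * cnj (x s)) = 0"
      and y: "(y has_vector_derivative y') (at s)" and x: "(x has_vector_derivative x') (at s)" and g: "g = x s"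
    for x y :: "real \<Rightarrow> complex" and y' x' g s
  proof -
    have "((\<lambda>s. Im (y s * cnj (x s))) has_vector_derivative Im (y s * cnj x' + y' * cnj (x s))) (at s)"
      by (intro bounded_linear.has_vector_derivative[OF bounded_linear_Im] has_vector_derivative_mult
          bounded_linear.has_vector_derivative[OF bounded_linear_cnj] x y)
    then have "((\<lambda>s. 0) has_vector_derivative Im (y s * cnj x' + y' * cnj (x s))) (at s)"
      by (rule has_vector_derivative_transform_within_open[OF _ open_I s]) (rule z)
    from vector_derivative_unique_at[OF this has_vector_derivative_const]
    show ?thesis by (simp add: g add.commute)
  qed
  have self: "Im (z * cnj z) = 0" for z by (simp add: complex_norm_square[symmetric])
  have w1: "Im (w1 s * cnj (g1 s)) = 0" if s: "s \<in> I" for s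
    using im_deriv[OF s im1 w(1)[OF s] v(1)[OF s] refl] self[of "v1 s"] by simp
  have w2: "Im (w2 s * cnj (g2 s)) = 0" if s: "s \<in> I" for s
    using im_deriv[OF s im2 w(2)[OF s] v(2)[OF s] refl] self[of "v2 s"] by simp
  \<comment> \<open>Two real multiples of the same nonzero \<open>g\<close> have a real Hermitian
    product.\<close>
  have quot: "Im (a * cnj b) = 0" if a: "Im (a * cnj g) = 0" and b: "Im (b * cnj g) = 0" and g: "g \<noteq> 0" for a b g
  proof -
    have real: "c = g * of_real (Re (c / g))" if "Im (c * cnj g) = 0" for c
    proof -
      have "Im (c / g) = 0" using that by (simp only: Im_mult_cnj_divide[symmetric])
      then have "c / g = of_real (Re (c / g))" by (intro complex_eqI) simp_all
      then have "g * (c / g) = g * of_real (Re (c / g))" by (rule arg_cong)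
      then show ?thesis using g by simp
    qed
    obtain x y where xy: "a = g * of_real x" "b = g * of_real y"
      using real[OF a] real[OF b] by blast
    have "a * cnj b = of_real (x * y) * (g * cnj g)" by (simp add: xy mult_ac)
    then show ?thesis by (simp only: Im_of_real_mult self)
  qed
  have m1: "Im (w1 s * cnj (v1 s)) = 0"
    by (rule quot[OF w1[OF s] im1[OF s] g1])
  have m2: "Im (w2 s * cnj (v2 s)) = 0"
  proof (cases "g2 s = 0")
    case False
    then show ?thesis by (rule quot[OF w2[OF s] im2[OF s]])
  next
    \<comment> \<open>At a zero of \<open>g2\<close> there is nothing to divide by. Differentiating
      \<open>Im (w2 * cnj g2) = 0\<close> once more gives the claim there; this takes third
      derivatives of the curve.\<close>
    case True
    then show ?thesis
      using im_deriv[OF s w2 smooth_curve_derivative[OF smooth_w(2) s] v(2)[OF s] refl] by simp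
  qed
  show "curve_minimal d (g1 s) (v1 s) (v2 s) (w1 s) (w2 s)"
    unfolding curve_minimal_def plus_complex.sel m1 m2 im1[OF s] by simp
qed

end

section \<open>Global solutions of Lipschitz differential equations\<close>

text \<open>The bound on \<open>g\<close> is integrated separately to the right and to the left of
  0, because \<open>\<bar>t\<bar>\<close> is not differentiable there.\<close>

lemma norm_le_exp_of_derivative:
  fixes F :: "real \<Rightarrow> 'a::real_normed_vector"
  assumes F: "\<And>t. (F has_vector_derivative g t) (at t)" "F 0 = 0"
    and g: "\<And>t. norm (g t) \<le> K * exp (c * \<bar>t\<bar>)" and "c > 0"
  shows "norm (F t) \<le> K / c * exp (c * \<bar>t\<bar>)"
proof -
  have K: "K \<ge> 0" using order_trans[OF norm_ge_zero g[of 0]] by simp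
  have cF: "continuous_on S F" for S
    by (intro continuous_at_imp_continuous_on ballI has_vector_derivative_continuous[OF F(1)])
  have dexp: "((\<lambda>t. a / (e * c) * exp (e * c * t)) has_vector_derivative a * exp (e * c * t)) (at t)"
    if "e \<noteq> 0" for a e t
    unfolding has_real_derivative_iff_has_vector_derivative[symmetric]
    using that \<open>c > 0\<close> by (auto intro!: derivative_eq_intros)
  consider "t = 0" | "t > 0" | "t < 0" by linarith
  then show ?thesis
  proof cases
    case 1
    then show ?thesis using F(2) K \<open>c > 0\<close> by simp
  next
    case 2
    have "norm (F t - F 0) \<le> K / (1 * c) * exp (1 * c * t) - K / (1 * c) * exp (1 * c * 0)"
    proof (rule differentiable_bound_general[OF 2 cF _ F(1) dexp])
      show "norm (g x) \<le> K * exp (1 * c * x)" if "0 < x" for x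
        using g[of x] that by simp
    qed (use \<open>c > 0\<close> in \<open>auto intro!: continuous_intros\<close>)
    also have "\<dots> \<le> K / c * exp (c * \<bar>t\<bar>)" using 2 K \<open>c > 0\<close> by simp
    finally show ?thesis by (simp add: F(2))
  next
    case 3
    have "norm (F 0 - F t) \<le> K / (- 1 * c) * exp (- 1 * c * 0) - K / (- 1 * c) * exp (- 1 * c * t)"
    proof (rule differentiable_bound_general[OF 3 cF _ F(1) dexp])
      show "norm (g x) \<le> K * exp (- 1 * c * x)" if "x < 0" for x
        using g[of x] that by simp
    qed (use \<open>c > 0\<close> in \<open>auto intro!: continuous_intros\<close>)
    also have "\<dots> \<le> K / c * exp (c * \<bar>t\<bar>)" using 3 K \<open>c > 0\<close> by simp
    finally show ?thesis by (simp add: F(2))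
  qed
qed

text \<open>Picard iteration as a contraction of the bounded functions \<open>u\<close>, where the candidate
  solution is \<open>x0 + exp (c \<bar>t\<bar>) u t\<close> for a large \<open>c\<close>.\<close>

theorem lipschitz_ode_exists:
  fixes V :: "'a::euclidean_space \<Rightarrow> 'a"
  assumes lip: "L-lipschitz_on UNIV V"
  obtains X where "X 0 = x0" "\<And>t. (X has_vector_derivative V (X t)) (at t)"
proof -
  \<comment> \<open>The 1 keeps \<open>M\<close> positive when \<open>L = 0\<close>. With weight
    exponent \<open>c = 2 * M\<close> the integral operator has contraction factor
    \<open>M / c = 1 / 2\<close>.\<close>
  define M where "M = L + 1"
  define c where "c = 2 * M"
  have M: "M > 0" using lipschitz_on_nonneg[OF lip] by (simp add: M_def)
  have c: "c > 0" using M by (simp add: c_def)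
  have V: "norm (V x - V y) \<le> M * norm (x - y)" for x y
  proof -
    have "norm (V x - V y) \<le> L * norm (x - y)" by (rule lipschitz_on_normD[OF lip]) auto
    also have "\<dots> \<le> M * norm (x - y)" by (simp add: M_def algebra_simps)
    finally show ?thesis .
  qed
  have cV: "continuous_on UNIV V" by (rule lipschitz_on_continuous_on[OF lip])
  define Y where "Y u t = x0 + exp (c * \<bar>t\<bar>) *\<^sub>R apply_bcontfun u t" for u :: "real \<Rightarrow>\<^sub>C 'a" and t
  define J where "J u t = (LBINT s=ereal 0..ereal t. V (Y u s))" for u t
  define \<Phi> where "\<Phi> u = Bcontfun (\<lambda>t. exp (- c * \<bar>t\<bar>) *\<^sub>R J u t)" for u
  have cg: "continuous_on UNIV (\<lambda>t. V (Y u t))" for u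
    unfolding Y_def by (intro continuous_on_compose2[OF cV] continuous_intros) auto
  have J': "(J u has_vector_derivative V (Y u t)) (at t)" for u t
    unfolding J_def[abs_def] by (rule interval_integral_has_vector_derivative[OF _ _ cg]) auto
  have J0: "J u 0 = 0" for u by (simp add: J_def)
  have Jb: "norm (J u t) \<le> (norm (V x0) + M * norm u) / c * exp (c * \<bar>t\<bar>)" for u t
  proof (rule norm_le_exp_of_derivative[OF J' J0 _ c])
    fix t
    have "norm (V (Y u t)) \<le> norm (V x0) + norm (V (Y u t) - V x0)"
      using norm_triangle_sub[of "V (Y u t)" "V x0"] by simp
    also have "\<dots> \<le> norm (V x0) + M * (exp (c * \<bar>t\<bar>) * norm u)"
      using V[of "Y u t" x0] M norm_bounded[of u t]
      by (smt (verit) Y_def add_diff_cancel_left' exp_gt_zero mult_left_mono norm_scaleR abs_of_pos)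
    also have "\<dots> \<le> norm (V x0) * exp (c * \<bar>t\<bar>) + M * (exp (c * \<bar>t\<bar>) * norm u)"
      using c by (simp add: mult_le_cancel_left1)
    finally show "norm (V (Y u t)) \<le> (norm (V x0) + M * norm u) * exp (c * \<bar>t\<bar>)"
      by (simp add: algebra_simps)
  qed
  have \<Phi>: "apply_bcontfun (\<Phi> u) t = exp (- c * \<bar>t\<bar>) *\<^sub>R J u t" for u t
  proof -
    have "(\<lambda>t. exp (- c * \<bar>t\<bar>) *\<^sub>R J u t) \<in> bcontfun"
    proof (rule bcontfun_normI)
      have "continuous_on UNIV (J u)"
        by (intro continuous_at_imp_continuous_on ballI has_vector_derivative_continuous[OF J'])
      then show "continuous_on UNIV (\<lambda>t. exp (- c * \<bar>t\<bar>) *\<^sub>R J u t)" by (intro continuous_intros)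
      show "norm (exp (- c * \<bar>t\<bar>) *\<^sub>R J u t) \<le> (norm (V x0) + M * norm u) / c" for t
        using Jb[of u t] by (simp add: exp_minus field_simps)
    qed
    then show ?thesis by (simp add: \<Phi>_def Bcontfun_inverse)
  qed
  have contr: "dist (\<Phi> u) (\<Phi> u') \<le> 1 / 2 * dist u u'" for u u'
  proof (rule dist_bound)
    fix t
    have "norm (J u t - J u' t) \<le> (M * dist u u') / c * exp (c * \<bar>t\<bar>)"
    proof (rule norm_le_exp_of_derivative[OF has_vector_derivative_diff[OF J' J'] _ _ c])
      fix t
      have "norm (V (Y u t) - V (Y u' t)) \<le> M * norm (Y u t - Y u' t)" by (rule V)
      also have "Y u t - Y u' t = exp (c * \<bar>t\<bar>) *\<^sub>R (apply_bcontfun u t - apply_bcontfun u' t)"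
        by (simp add: Y_def algebra_simps)
      also have "M * norm \<dots> \<le> M * (exp (c * \<bar>t\<bar>) * dist u u')"
        using M dist_bounded[of u t u'] by (simp add: dist_norm)
      finally show "norm (V (Y u t) - V (Y u' t)) \<le> M * dist u u' * exp (c * \<bar>t\<bar>)"
        by (simp add: mult_ac)
    qed (simp add: J0)
    also have "M * dist u u' / c = 1 / 2 * dist u u'" using M by (simp add: c_def)
    finally have le: "norm (J u t - J u' t) \<le> 1 / 2 * dist u u' * exp (c * \<bar>t\<bar>)" .
    have "dist (apply_bcontfun (\<Phi> u) t) (apply_bcontfun (\<Phi> u') t) = norm (exp (- c * \<bar>t\<bar>) *\<^sub>R (J u t - J u' t))"
      by (simp only: \<Phi> dist_norm scaleR_diff_right)
    also have "\<dots> = exp (- c * \<bar>t\<bar>) * norm (J u t - J u' t)" by simp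
    also have "\<dots> \<le> exp (- c * \<bar>t\<bar>) * (1 / 2 * dist u u' * exp (c * \<bar>t\<bar>))"
      by (rule mult_left_mono[OF le]) simp
    also have "\<dots> = 1 / 2 * dist u u'" by (simp add: exp_minus)
    finally show "dist (apply_bcontfun (\<Phi> u) t) (apply_bcontfun (\<Phi> u') t) \<le> 1 / 2 * dist u u'" .
  qed
  obtain u where u: "\<Phi> u = u"
    using banach_fix_type[of "1 / 2" \<Phi>] contr by auto
  have "Y u t = x0 + J u t" for t
  proof -
    have "apply_bcontfun u t = exp (- c * \<bar>t\<bar>) *\<^sub>R J u t" using \<Phi>[of u t] by (simp add: u)
    then show ?thesis by (simp add: Y_def exp_minus)
  qed
  then have Y: "Y u = (\<lambda>t. x0 + J u t)" by auto
  show thesis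
  proof (rule that[of "Y u"])
    show "Y u 0 = x0" by (simp add: Y J0)
    have "((\<lambda>t. x0 + J u t) has_vector_derivative 0 + V (Y u t)) (at t)" for t
      by (intro has_vector_derivative_add has_vector_derivative_const J')
    then show "(Y u has_vector_derivative V (Y u t)) (at t)" for t by (simp flip: Y)
  qed
qed

text \<open>Gronwall's argument for curves that follow \<open>V\<close> with speed \<open>l\<close>:
  the squared distance \<open>E\<close> satisfies \<open>\<bar>E'\<bar> \<le> 2 * L * l * E\<close>,
  and the antiderivative \<open>\<sigma>\<close> of the speed supplies the integrating
  factor.\<close>

theorem lipschitz_ode_unique:
  fixes V :: "'a::real_inner \<Rightarrow> 'a" and l :: "real \<Rightarrow> real"
  assumes lip: "L-lipschitz_on UNIV V" and I: "is_interval I" "s0 \<in> I" "s \<in> I"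
    and \<sigma>: "\<And>s. s \<in> I \<Longrightarrow> (\<sigma> has_real_derivative l s) (at s)" "\<And>s. s \<in> I \<Longrightarrow> l s \<ge> 0"
    and y: "\<And>s. s \<in> I \<Longrightarrow> (y has_vector_derivative l s *\<^sub>R V (y s)) (at s)"
    and z: "\<And>s. s \<in> I \<Longrightarrow> (z has_vector_derivative l s *\<^sub>R V (z s)) (at s)"
    and init: "y s0 = z s0"
  shows "y s = z s"
proof -
  define E where "E s = (y s - z s) \<bullet> (y s - z s)" for s
  define E' where "E' s = 2 * (l s * ((y s - z s) \<bullet> (V (y s) - V (z s))))" for s
  have E: "(E has_real_derivative E' s) (at s)" if "s \<in> I" for s
  proof -
    have d: "((\<lambda>s. y s - z s) has_vector_derivative l s *\<^sub>R (V (y s) - V (z s))) (at s)"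
      using has_vector_derivative_diff[OF y[OF that] z[OF that]] by (simp add: scaleR_diff_right)
    have "(E has_derivative (\<lambda>h. (y s - z s) \<bullet> (h *\<^sub>R l s *\<^sub>R (V (y s) - V (z s))) +
        (h *\<^sub>R l s *\<^sub>R (V (y s) - V (z s))) \<bullet> (y s - z s))) (at s)"
      unfolding E_def[abs_def] using d unfolding has_vector_derivative_def
      by (intro has_derivative_inner)
    then show ?thesis
      unfolding has_field_derivative_def E'_def
      by (rule has_derivative_eq_rhs) (simp add: fun_eq_iff inner_commute)
  qed
  have E'b: "\<bar>E' s\<bar> \<le> 2 * L * l s * E s" if "s \<in> I" for s
  proof -
    have "\<bar>(y s - z s) \<bullet> (V (y s) - V (z s))\<bar> \<le> norm (y s - z s) * norm (V (y s) - V (z s))"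
      by (rule Cauchy_Schwarz_ineq2)
    also have "\<dots> \<le> norm (y s - z s) * (L * norm (y s - z s))"
      by (intro mult_left_mono lipschitz_on_normD[OF lip]) auto
    also have "\<dots> = L * E s" by (simp add: E_def dot_square_norm power2_eq_square)
    finally have "l s * \<bar>(y s - z s) \<bullet> (V (y s) - V (z s))\<bar> \<le> l s * (L * E s)"
      using \<sigma>(2)[OF that] by (rule mult_left_mono)
    then show ?thesis using \<sigma>(2)[OF that] by (simp add: E'_def abs_mult mult_ac)
  qed
  have E0: "E s0 = 0" by (simp add: E_def init)
  \<comment> \<open>Used with \<open>e = -1\<close> to the right of \<open>s0\<close>, where the
    product decreases, and with \<open>e = 1\<close> to the left, where it increases.\<close>
  have G: "((\<lambda>s. E s * exp (e * 2 * L * \<sigma> s)) has_real_derivative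
      (E' s + e * (2 * L * l s * E s)) * exp (e * 2 * L * \<sigma> s)) (at s)" if "s \<in> I" for e s
    using that by (auto intro!: derivative_eq_intros E \<sigma>(1) simp: algebra_simps)
  have "E s \<le> 0"
  proof (cases "s0 \<le> s")
    case True
    have "E s * exp (- 1 * 2 * L * \<sigma> s) \<le> E s0 * exp (- 1 * 2 * L * \<sigma> s0)"
    proof (rule DERIV_nonpos_imp_nonincreasing[OF True, where f = "\<lambda>s. E s * exp (- 1 * 2 * L * \<sigma> s)"])
      fix t assume "s0 \<le> t" "t \<le> s"
      then have t: "t \<in> I" using mem_is_interval_1_I[OF I] by blast
      have "E' t + - 1 * (2 * L * l t * E t) \<le> 0" using E'b[OF t] by linarith
      then show "\<exists>D. ((\<lambda>s. E s * exp (- 1 * 2 * L * \<sigma> s)) has_real_derivative D) (at t) \<and> D \<le> 0"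
        using G[OF t, of "- 1"] by (intro exI conjI) (auto simp: mult_nonpos_nonneg)
    qed
    then show ?thesis by (simp add: E0 mult_le_0_iff)
  next
    case False
    have "E s * exp (1 * 2 * L * \<sigma> s) \<le> E s0 * exp (1 * 2 * L * \<sigma> s0)"
    proof (rule DERIV_nonneg_imp_nondecreasing[where f = "\<lambda>s. E s * exp (1 * 2 * L * \<sigma> s)"])
      show "s \<le> s0" using False by simp
      fix t assume "s \<le> t" "t \<le> s0"
      then have t: "t \<in> I" using mem_is_interval_1_I[OF I(1,3,2)] by blast
      have "E' t + 1 * (2 * L * l t * E t) \<ge> 0" using E'b[OF t] by linarith
      then show "\<exists>D. ((\<lambda>s. E s * exp (1 * 2 * L * \<sigma> s)) has_real_derivative D) (at t) \<and> D \<ge> 0"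
        using G[OF t, of 1]
        by (intro exI[of _ "(E' t + 1 * (2 * L * l t * E t)) * exp (1 * 2 * L * \<sigma> t)"] conjI
            mult_nonneg_nonneg) auto
    qed
    then show ?thesis by (simp add: E0 mult_le_0_iff)
  qed
  then have "(y s - z s) \<bullet> (y s - z s) = 0"
    using inner_ge_zero[of "y s - z s"] unfolding E_def by linarith
  then show ?thesis by simp
qed

section \<open>The profile of a minimal curve\<close>

text \<open>Along a minimal curve parametrised by arc length the square \<open>x\<close> of \<open>\<bar>g1\<bar>\<close> solves
  \<open>x'' = radial_force d K x\<close>; the constant \<open>K\<close> is the conserved quantity \<open>Im Z\<close> of
  the locale \<open>minimal_legendre\<close>, and \<open>radial_level\<close> is the level set of the energy of this
  equation that belongs to it.\<close>

definition radial_force :: "nat \<Rightarrow> real \<Rightarrow> real \<Rightarrow> real"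
  where "radial_force d K x = 2 * (1 - 2 * x) + 2 * real d * K\<^sup>2 / x ^ (d + 1)"

definition radial_level :: "nat \<Rightarrow> real \<Rightarrow> real \<Rightarrow> real \<Rightarrow> bool"
  where "radial_level d K x p \<longleftrightarrow> 0 < x \<and> p\<^sup>2 / 4 = x * (1 - x) - K\<^sup>2 / x ^ d"

text \<open>The square \<open>p\<^sup>2\<close> is nonnegative, so the potential confines
  \<open>x\<close>. The bound \<open>K\<^sup>2 \<le> x\<close> is the explicit distance from the
  pole of the force that the truncation needs.\<close>

lemma radial_level_bound:
  assumes "radial_level d K x p" "K \<noteq> 0"
  shows "x < 1" "K\<^sup>2 \<le> x ^ (d + 1) * (1 - x)" "K\<^sup>2 \<le> x"
proof -
  have x: "x > 0" using assms by (simp add: radial_level_def)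
  have "K\<^sup>2 / x ^ d \<le> x * (1 - x)"
    using assms(1) zero_le_power2[of p] unfolding radial_level_def by linarith
  then show 1: "K\<^sup>2 \<le> x ^ (d + 1) * (1 - x)" using x by (simp add: field_simps)
  moreover have "K\<^sup>2 > 0" using assms(2) by simp
  ultimately have "x ^ (d + 1) * (1 - x) > 0" by linarith
  then have "0 < 1 - x" using zero_less_mult_pos[of "x ^ (d + 1)" "1 - x"] x by simp
  then show 2: "x < 1" by simp
  have "x ^ (d + 1) * (1 - x) \<le> x ^ (d + 1) * 1" using x by (intro mult_left_mono) auto
  also have "\<dots> \<le> x" using x 2 power_decreasing[of 1 "d + 1" x] by simp
  finally show "K\<^sup>2 \<le> x" using 1 by simp
qed

text \<open>Composition of the 1-Lipschitz truncation at \<open>\<delta>\<close> with an inverse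
  power whose derivative is bounded on the half-line from \<open>\<delta>\<close>.\<close>

lemma lipschitz_inverse_power_max:
  assumes "\<delta> > (0::real)"
  shows "\<exists>C. C-lipschitz_on UNIV (\<lambda>x. 1 / (max x \<delta>) ^ m)"
proof -
  have "1-lipschitz_on UNIV (\<lambda>x. max x \<delta>)"
    by (rule lipschitz_onI) (auto simp: dist_real_def max_def)
  moreover have "(real m / \<delta> ^ (m + 1))-lipschitz_on ((\<lambda>x. max x \<delta>) ` UNIV) (\<lambda>y. 1 / y ^ m)"
  proof (rule lipschitz_on_subset)
    show "(real m / \<delta> ^ (m + 1))-lipschitz_on {\<delta>..} (\<lambda>y. 1 / y ^ m)"
    proof (rule bounded_derivative_imp_lipschitz)
      fix x assume x: "x \<in> {\<delta>..}"
      then have xp: "x > 0" using assms by auto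
      have "((\<lambda>y. 1 / y ^ m) has_real_derivative - (real m / x ^ (m + 1))) (at x)"
      proof -
        have "((\<lambda>y. 1 / y ^ m) has_real_derivative - (real m * x ^ (m - 1)) / (x ^ m * x ^ m)) (at x)"
          using xp by (auto intro!: derivative_eq_intros)
        also have "- (real m * x ^ (m - 1)) / (x ^ m * x ^ m) = - (real m / x ^ (m + 1))"
          using xp by (cases m) (simp_all add: field_simps)
        finally show ?thesis .
      qed
      then show "((\<lambda>y. 1 / y ^ m) has_derivative (\<lambda>h. - (real m / x ^ (m + 1)) * h)) (at x within {\<delta>..})"
        unfolding has_field_derivative_def by (rule has_derivative_at_withinI)
      have "real m / x ^ (m + 1) \<le> real m / \<delta> ^ (m + 1)"
        using x assms by (intro divide_left_mono power_mono mult_pos_pos) auto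
      note le = this
      show "onorm (\<lambda>h. - (real m / x ^ (m + 1)) * h) \<le> real m / \<delta> ^ (m + 1)"
      proof (rule onorm_le)
        fix h :: real
        have "norm (- (real m / x ^ (m + 1)) * h) = real m / x ^ (m + 1) * norm h"
          using xp by (simp add: abs_mult)
        also have "\<dots> \<le> real m / \<delta> ^ (m + 1) * norm h"
          by (rule mult_right_mono[OF le norm_ge_zero])
        finally show "norm (- (real m / x ^ (m + 1)) * h) \<le> real m / \<delta> ^ (m + 1) * norm h" .
      qed
    qed (use assms in auto)
  qed auto
  ultimately show ?thesis using lipschitz_on_compose2 by blast
qed

text \<open>Existence and uniqueness are stated together because both come from the same truncated
  field. The last clause admits arbitrary speed \<open>l\<close>, so that it applies directly to a
  Legendre curve with its own parameter.\<close>

theorem radial_solution_exists: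
  assumes K: "K \<noteq> 0" and level0: "radial_level d K x0 p0"
  obtains X P where
    "\<And>t. (X has_real_derivative P t) (at t)"
    "\<And>t. (P has_real_derivative radial_force d K (X t)) (at t)"
    "\<And>t. radial_level d K (X t) (P t)"
    "\<And>I s0 s \<sigma> l x p. is_interval I \<Longrightarrow> s0 \<in> I \<Longrightarrow> s \<in> I \<Longrightarrow>
      (\<And>s. s \<in> I \<Longrightarrow> (\<sigma> has_real_derivative l s) (at s) \<and> l s \<ge> 0 \<and> radial_level d K (x s) (p s) \<and>
        (x has_real_derivative l s * p s) (at s) \<and>
        (p has_real_derivative l s * radial_force d K (x s)) (at s)) \<Longrightarrow>
      \<sigma> s0 = 0 \<Longrightarrow> x s0 = x0 \<Longrightarrow> p s0 = p0 \<Longrightarrow> x s = X (\<sigma> s)"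
proof -
  \<comment> \<open>Points of the level have \<open>x \<ge> K\<^sup>2\<close>. The barrier
    \<open>\<beta>\<close> lies below that, hence off the level, and the truncation point
    \<open>\<delta>\<close> lies below the barrier, so the true potential is available in a
    neighbourhood of \<open>\<beta>\<close>.\<close>
  define \<delta> where "\<delta> = K\<^sup>2 / 4"
  define \<beta> where "\<beta> = K\<^sup>2 / 2"
  have \<delta>: "0 < \<delta>" "\<delta> < \<beta>" "\<beta> < K\<^sup>2" using K by (auto simp: \<delta>_def \<beta>_def)
  define F where "F x = 2 * (1 - 2 * x) + 2 * real d * K\<^sup>2 * (1 / (max x \<delta>) ^ (d + 1))" for x
  have F_eq: "F x = radial_force d K x" if "x \<ge> \<delta>" for x
    using that by (simp add: F_def radial_force_def max_def)
  obtain C where C: "C-lipschitz_on UNIV (\<lambda>x. 1 / (max x \<delta>) ^ (d + 1))"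
    using lipschitz_inverse_power_max[OF \<delta>(1)] by blast
  have "\<exists>B. B-lipschitz_on UNIV F"
    unfolding F_def[abs_def]
    by (rule exI, rule lipschitz_on_add[OF lipschitz_on_cmult_real[OF lipschitz_on_diff[OF
            lipschitz_on_constant lipschitz_on_cmult_real[OF lipschitz_on_id]]] lipschitz_on_cmult_real[OF C]])
  then obtain B where B: "B-lipschitz_on UNIV F" by blast
  define V :: "real \<times> real \<Rightarrow> real \<times> real" where "V z = (snd z, F (fst z))" for z
  have lipV: "(1 + B)-lipschitz_on UNIV V"
  proof (rule lipschitz_onI)
    fix z z' :: "real \<times> real"
    have "dist (V z) (V z') \<le> dist (snd z) (snd z') + dist (F (fst z)) (F (fst z'))"
      using sqrt_sum_squares_le_sum[of "dist (snd z) (snd z')" "dist (F (fst z)) (F (fst z'))"]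
      by (simp add: V_def dist_Pair_Pair)
    also have "\<dots> \<le> dist z z' + B * dist z z'"
    proof (intro add_mono)
      have "dist (F (fst z)) (F (fst z')) \<le> B * dist (fst z) (fst z')" by (rule lipschitz_onD[OF B]) auto
      also have "\<dots> \<le> B * dist z z'"
        by (intro mult_left_mono dist_fst_le lipschitz_on_nonneg[OF B])
      finally show "dist (F (fst z)) (F (fst z')) \<le> B * dist z z'" .
    qed (rule dist_snd_le)
    finally show "dist (V z) (V z') \<le> (1 + B) * dist z z'" by (simp add: algebra_simps)
  qed (use lipschitz_on_nonneg[OF B] in auto)
  obtain Z where Z0: "Z 0 = (x0, p0)" and Z: "\<And>t. (Z has_vector_derivative V (Z t)) (at t)"
    using lipschitz_ode_exists[OF lipV, of "(x0, p0)"] by blast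
  define X P where "X t = fst (Z t)" and "P t = snd (Z t)" for t
  have dX: "(X has_real_derivative P t) (at t)" for t
    using bounded_linear.has_vector_derivative[OF bounded_linear_fst Z[of t]]
    by (simp add: X_def[abs_def] P_def V_def has_real_derivative_iff_has_vector_derivative)
  have dP: "(P has_real_derivative F (X t)) (at t)" for t
    using bounded_linear.has_vector_derivative[OF bounded_linear_snd Z[of t]]
    by (simp add: X_def P_def[abs_def] V_def has_real_derivative_iff_has_vector_derivative)
  have init: "X 0 = x0" "P 0 = p0" by (simp_all add: X_def P_def Z0)
  text \<open>The truncation \<open>F\<close> of the force below \<open>\<delta>\<close> is Lipschitz, and it is never felt by
    the solution: by conservation of the energy with the potential of \<open>F\<close> the solution cannot
    cross the barrier \<open>\<beta> > \<delta>\<close>.\<close>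
  define w where "w x = 1 / \<beta> ^ d - real d * (LBINT t=ereal \<beta>..ereal x. 1 / (max t \<delta>) ^ (d + 1))" for x
  have dw: "(w has_real_derivative - real d / (max x \<delta>) ^ (d + 1)) (at x)" for x
  proof -
    have "((\<lambda>x. LBINT t=ereal \<beta>..ereal x. 1 / (max t \<delta>) ^ (d + 1)) has_real_derivative
        1 / (max x \<delta>) ^ (d + 1)) (at x)"
      unfolding has_real_derivative_iff_has_vector_derivative
      by (rule interval_integral_has_vector_derivative[of UNIV])
        (use \<delta> in \<open>auto intro!: continuous_intros\<close>)
    from DERIV_diff[OF DERIV_const DERIV_cmult[OF this]]
    show ?thesis by (simp add: w_def[abs_def])
  qed
  \<comment> \<open>Both sides have the same derivative above \<open>\<delta>\<close>, and
    \<open>w\<close> was normalised to agree at \<open>\<beta>\<close>.\<close>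
  have w: "w x = 1 / x ^ d" if "x > \<delta>" for x
  proof -
    have "\<exists>c. \<forall>x\<in>{\<delta><..}. w x - 1 / x ^ d = c"
    proof (rule has_field_derivative_zero_constant)
      fix x assume "x \<in> {\<delta><..}"
      then have x: "x > \<delta>" "x > 0" using \<delta> by auto
      have "((\<lambda>y. 1 / y ^ d) has_real_derivative - (real d * x ^ (d - 1)) / (x ^ d * x ^ d)) (at x)"
        using x by (auto intro!: derivative_eq_intros)
      also have "- (real d * x ^ (d - 1)) / (x ^ d * x ^ d) = - real d / (max x \<delta>) ^ (d + 1)"
        using x by (cases d) (simp_all add: field_simps max_def)
      finally have "((\<lambda>x. w x - 1 / x ^ d) has_real_derivative 0) (at x)"
        using DERIV_diff[OF dw[of x]] by fastforce
      then show "((\<lambda>x. w x - 1 / x ^ d) has_real_derivative 0) (at x within {\<delta><..})"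
        by (rule has_field_derivative_at_within)
    qed auto
    then obtain c where c: "\<And>x. x > \<delta> \<Longrightarrow> w x - 1 / x ^ d = c" by auto
    have "w \<beta> = 1 / \<beta> ^ d" by (simp add: w_def)
    then show ?thesis using c[OF \<delta>(2)] c[OF that] by simp
  qed
  have x0: "x0 > \<beta>" using radial_level_bound(3)[OF level0 K] \<delta> by linarith
  have energy: "(P t)\<^sup>2 / 4 = X t * (1 - X t) - K\<^sup>2 * w (X t)" for t
  proof -
    define E where "E t = (P t)\<^sup>2 / 4 - (X t * (1 - X t) - K\<^sup>2 * w (X t))" for t
    have "(E has_real_derivative 0) (at t)" for t
    proof -
      have "((\<lambda>t. w (X t)) has_real_derivative - real d / (max (X t) \<delta>) ^ (d + 1) * P t) (at t)"
        by (rule DERIV_chain2[OF dw dX])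
      then have "(E has_real_derivative (2 * P t * F (X t)) / 4 - (P t * (1 - X t) - X t * P t
          - K\<^sup>2 * (- real d / (max (X t) \<delta>) ^ (d + 1) * P t))) (at t)"
        unfolding E_def[abs_def] by (auto intro!: derivative_eq_intros dX dP)
      also have "(2 * P t * F (X t)) / 4 - (P t * (1 - X t) - X t * P t
          - K\<^sup>2 * (- real d / (max (X t) \<delta>) ^ (d + 1) * P t)) = 0"
        by (simp add: F_def algebra_simps add_divide_distrib diff_divide_distrib)
      finally show ?thesis .
    qed
    then have "E t = E 0" using DERIV_isconst_all[of E t 0] by blast
    also have "\<dots> = 0"
      using level0 w[of x0] x0 \<delta> by (simp add: E_def init radial_level_def)
    finally show ?thesis by (simp add: E_def)
  qed
  have X_gt: "X t > \<beta>" for t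
  proof (rule ccontr)
    assume t: "\<not> X t > \<beta>"
    have "continuous_on UNIV X"
      by (intro continuous_at_imp_continuous_on ballI DERIV_isCont[OF dX])
    then have conn: "connected (range X)" by (intro connected_continuous_image) auto
    have "\<beta> \<in> range X"
      using t x0 init by (intro connectedD_interval[OF conn rangeI[of X t] rangeI[of X 0]]) auto
    then obtain t' where t': "X t' = \<beta>" by auto
    \<comment> \<open>A solution reaching the barrier would be a point of the level with
      \<open>x = \<beta> < K\<^sup>2\<close>.\<close>
    have "radial_level d K \<beta> (P t')"
      using energy[of t'] \<delta> w[OF \<delta>(2)] by (simp add: radial_level_def t')
    then show False using radial_level_bound(3)[OF _ K] \<delta> by fastforce
  qed
  show thesis
  proof (rule that[of X P])
    show "(X has_real_derivative P t) (at t)" for t by (rule dX)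
    show "(P has_real_derivative radial_force d K (X t)) (at t)" for t
      using dP[of t] F_eq[of "X t"] X_gt[of t] \<delta> by simp
    show "radial_level d K (X t) (P t)" for t
      using energy[of t] w[of "X t"] X_gt[of t] \<delta> by (simp add: radial_level_def)
    fix I :: "real set" and s0 s and \<sigma> l x p :: "real \<Rightarrow> real"
    assume I: "is_interval I" "s0 \<in> I" "s \<in> I" and sol: "\<And>s. s \<in> I \<Longrightarrow>
        (\<sigma> has_real_derivative l s) (at s) \<and> l s \<ge> 0 \<and> radial_level d K (x s) (p s) \<and>
        (x has_real_derivative l s * p s) (at s) \<and>
        (p has_real_derivative l s * radial_force d K (x s)) (at s)"
      and init': "\<sigma> s0 = 0" "x s0 = x0" "p s0 = p0"
    have "(x s, p s) = Z (\<sigma> s)"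
    proof (rule lipschitz_ode_unique[OF lipV I])
      fix s assume s: "s \<in> I"
      show "(\<sigma> has_real_derivative l s) (at s)" "l s \<ge> 0" using sol[OF s] by auto
      have "x s \<ge> \<delta>" using radial_level_bound(3)[OF _ K] sol[OF s] \<delta> by fastforce
      then have "l s *\<^sub>R V (x s, p s) = (l s * p s, l s * radial_force d K (x s))"
        by (simp add: V_def F_eq)
      then show "((\<lambda>s. (x s, p s)) has_vector_derivative l s *\<^sub>R V (x s, p s)) (at s)"
        using sol[OF s] by (simp add: has_vector_derivative_Pair has_real_derivative_iff_has_vector_derivative)
      show "((\<lambda>s. Z (\<sigma> s)) has_vector_derivative l s *\<^sub>R V (Z (\<sigma> s))) (at s)"
        using vector_diff_chain_at[OF _ Z, of \<sigma> "l s" s] sol[OF s]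
        by (simp add: has_real_derivative_iff_has_vector_derivative o_def)
    qed (simp add: init' Z0)
    then show "x s = X (\<sigma> s)" by (metis X_def fst_conv)
  qed
qed

text \<open>Sturm comparison with \<open>sin (2 t)\<close>: the derivative of \<open>radial_force\<close> is at most \<open>-4\<close>.\<close>

lemma radial_turning_point:
  assumes dX: "\<And>t. (X has_real_derivative P t) (at t)"
    and dP: "\<And>t. (P has_real_derivative radial_force d K (X t)) (at t)"
    and pos: "\<And>t. X t > 0"
  obtains t where "P t = 0"
proof (rule ccontr)
  assume "\<not> thesis"
  then have nz: "P t \<noteq> 0" for t using that by blast
  define e where "e = sgn (P 0)"
  have e: "e * P t > 0" for t
  proof (rule ccontr)
    assume t: "\<not> e * P t > 0"
    have "continuous_on UNIV (\<lambda>t. e * P t)"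
      by (intro continuous_on_mult continuous_on_const continuous_at_imp_continuous_on ballI DERIV_isCont[OF dP])
    then have conn: "connected (range (\<lambda>t. e * P t))" by (intro connected_continuous_image) auto
    have "e * P 0 > 0" using nz[of 0] by (simp add: e_def sgn_if)
    then have "0 \<in> range (\<lambda>t. e * P t)"
      using t by (intro connectedD_interval[OF conn rangeI[of _ t] rangeI[of _ 0]]) auto
    then show False using nz e_def by (auto simp: sgn_if split: if_splits)
  qed
  define f' where "f' t = - 4 - 2 * real d * K\<^sup>2 * real (d + 1) / X t ^ (d + 2)" for t
  have df: "((\<lambda>t. radial_force d K (X t)) has_real_derivative f' t * P t) (at t)" for t
  proof -
    have "((\<lambda>t. radial_force d K (X t)) has_real_derivative
      2 * (- 2 * P t) - 2 * real d * K\<^sup>2 * (real (d + 1) * (P t * X t ^ d)) / (X t ^ (d + 1) * X t ^ (d + 1))) (at t)"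
      unfolding radial_force_def using pos[of t]
      by (auto intro!: derivative_eq_intros dX simp del: power_Suc)
    also have "2 * (- 2 * P t) - 2 * real d * K\<^sup>2 * (real (d + 1) * (P t * X t ^ d)) / (X t ^ (d + 1) * X t ^ (d + 1))
      = f' t * P t"
      using pos[of t] by (simp add: f'_def field_simps)
    finally show ?thesis .
  qed
  \<comment> \<open>Up to the sign \<open>e\<close>, the Wronskian of \<open>sin (2 * t)\<close> and
    \<open>P\<close>. If \<open>P\<close> kept its sign, \<open>G\<close> would not increase on
    \<open>[0, pi / 2]\<close>, although it is negative at the left end and positive at the right
    end.\<close>
  define G where "G t = e * (radial_force d K (X t) * sin (2 * t) - 2 * P t * cos (2 * t))" for t
  have "G (pi / 2) \<le> G 0"
  proof (rule DERIV_nonpos_imp_nonincreasing[where f = G])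
    fix t assume t: "0 \<le> t" "t \<le> pi / 2"
    have "(G has_real_derivative e * ((f' t * P t * sin (2 * t) + radial_force d K (X t) * (cos (2 * t) * 2))
        - (2 * radial_force d K (X t) * cos (2 * t) + 2 * P t * (- sin (2 * t) * 2)))) (at t)"
      unfolding G_def[abs_def] by (auto intro!: derivative_eq_intros df dP)
    also have "e * ((f' t * P t * sin (2 * t) + radial_force d K (X t) * (cos (2 * t) * 2))
        - (2 * radial_force d K (X t) * cos (2 * t) + 2 * P t * (- sin (2 * t) * 2)))
        = (f' t + 4) * ((e * P t) * sin (2 * t))"
      by (simp add: algebra_simps)
    finally have "(G has_real_derivative (f' t + 4) * ((e * P t) * sin (2 * t))) (at t)" .
    moreover have "f' t + 4 \<le> 0" using pos[of t] by (simp add: f'_def)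
    moreover have "(e * P t) * sin (2 * t) \<ge> 0"
      by (rule mult_nonneg_nonneg[OF less_imp_le[OF e] sin_ge_zero]) (use t in auto)
    ultimately show "\<exists>y. (G has_real_derivative y) (at t) \<and> y \<le> 0"
      by (meson mult_nonpos_nonneg)
  qed simp
  moreover have "G (pi / 2) = 2 * (e * P (pi / 2))" "G 0 = - (2 * (e * P 0))"
    by (simp_all add: G_def)
  ultimately show False using e[of 0] e[of "pi / 2"] by linarith
qed

text \<open>The solution is restarted at its turning point \<open>t0\<close> and run in the
  direction \<open>e\<close>, which is 1 or -1. Since \<open>0 < X < 1\<close>, the substitution
  \<open>X = (sin r)\<^sup>2\<close> is smoothly invertible and carries the radial equation into the
  profile equation.\<close>

theorem radial_profile:
  assumes dX: "\<And>t. (X has_real_derivative P t) (at t)"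
    and dP: "\<And>t. (P has_real_derivative radial_force d K (X t)) (at t)"
    and level: "\<And>t. radial_level d K (X t) (P t)"
    and K: "K \<noteq> 0" and t0: "P t0 = 0" and e: "e * e = 1"
  defines "r \<equiv> \<lambda>t. arcsin (sqrt (X (e * t + t0)))"
  obtains r' r'' where "profile (d + 1) (r 0) r r' r''"
    "\<And>t. (sin (r t))\<^sup>2 = X (e * t + t0)" "\<And>t. sin (r t) > 0" "r 0 > 0"
    "\<And>t. r' t * sin (r t) * cos (r t) = e * P (e * t + t0) / 2"
    "first_integral_const (d + 1) (r 0) = \<bar>K\<bar>"
proof -
  define x p u where "x t = X (e * t + t0)" and "p t = P (e * t + t0)" and "u t = x t * (1 - x t)" for t
  have x: "0 < x t" "x t < 1" for t
    using level[of "e * t + t0"] radial_level_bound(1)[OF level K, of "e * t + t0"]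
    by (auto simp: x_def radial_level_def)
  have u: "u t > 0" for t using x[of t] by (simp add: u_def)
  have sin_r: "sin (r t) = sqrt (x t)" for t
    using x[of t] by (simp add: r_def x_def sin_arcsin[of "sqrt (X (e * t + t0))"]
        order_trans[of "-1" 0])
  have cos_r: "cos (r t) = sqrt (1 - x t)" for t
    using x[of t] by (simp add: r_def x_def cos_arcsin order_trans[of "-1" 0])
  have sc: "sin (r t) * cos (r t) = sqrt (u t)" for t
    by (simp add: sin_r cos_r u_def real_sqrt_mult)
  have dx: "(x has_real_derivative e * p t) (at t)" for t
  proof -
    have "((\<lambda>t. X (e * t + t0)) has_real_derivative P (e * t + t0) * e) (at t)"
      by (rule DERIV_chain2[OF dX]) (auto intro!: derivative_eq_intros)
    then show ?thesis by (simp add: x_def[abs_def] p_def mult.commute)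
  qed
  have dp: "(p has_real_derivative e * radial_force d K (x t)) (at t)" for t
  proof -
    have "((\<lambda>t. P (e * t + t0)) has_real_derivative radial_force d K (X (e * t + t0)) * e) (at t)"
      by (rule DERIV_chain2[OF dP]) (auto intro!: derivative_eq_intros)
    then show ?thesis by (simp add: x_def p_def[abs_def] mult.commute)
  qed
  define r' where "r' t = e * p t / (2 * sqrt (u t))" for t
  define r'' where "r'' t = radial_force d K (x t) / (2 * sqrt (u t))
    - (p t)\<^sup>2 * (1 - 2 * x t) / (4 * u t * sqrt (u t))" for t
  have dr: "(r has_real_derivative r' t) (at t)" for t
  proof -
    have "((\<lambda>t. arcsin (sqrt (x t))) has_real_derivative
        inverse (sqrt (1 - (sqrt (x t))\<^sup>2)) * (inverse (sqrt (x t)) / 2 * (e * p t))) (at t)"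
      using x[of t]
      by (intro DERIV_chain2[OF DERIV_arcsin] DERIV_chain2[OF DERIV_real_sqrt dx])
        (auto intro: order.strict_trans2[of "-1" 0])
    also have "inverse (sqrt (1 - (sqrt (x t))\<^sup>2)) * (inverse (sqrt (x t)) / 2 * (e * p t)) = r' t"
    proof -
      have "sqrt (u t) = sqrt (x t) * sqrt (1 - x t)" by (simp only: u_def real_sqrt_mult)
      then show ?thesis using x[of t] by (simp add: r'_def divide_simps)
    qed
    finally show ?thesis by (simp add: r_def x_def)
  qed
  have dr': "(r' has_real_derivative r'' t) (at t)" for t
  proof -
    have du: "(u has_real_derivative e * p t * (1 - 2 * x t)) (at t)"
      unfolding u_def[abs_def] by (auto intro!: derivative_eq_intros dx simp: algebra_simps)
    have ds: "((\<lambda>t. sqrt (u t)) has_real_derivative inverse (sqrt (u t)) / 2 * (e * p t * (1 - 2 * x t))) (at t)"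
      by (rule DERIV_chain2[OF DERIV_real_sqrt[OF u] du])
    have "(r' has_real_derivative ((e * (e * radial_force d K (x t))) * (2 * sqrt (u t))
        - e * p t * (2 * (inverse (sqrt (u t)) / 2 * (e * p t * (1 - 2 * x t)))))
        / ((2 * sqrt (u t)) * (2 * sqrt (u t)))) (at t)"
      unfolding r'_def[abs_def] using u[of t]
      by (intro DERIV_divide DERIV_cmult dp ds) auto
    also have "((e * (e * radial_force d K (x t))) * (2 * sqrt (u t))
        - e * p t * (2 * (inverse (sqrt (u t)) / 2 * (e * p t * (1 - 2 * x t)))))
        / ((2 * sqrt (u t)) * (2 * sqrt (u t))) = (e * e) * r'' t"
    proof -
      define S where "S = sqrt (u t)"
      have S: "S > 0" "u t = S * S" using u[of t] by (simp_all add: S_def)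
      show ?thesis
        unfolding r''_def S_def[symmetric] unfolding S(2) using S(1)
        by (simp add: field_simps power2_eq_square)
    qed
    also have "\<dots> = r'' t" by (simp add: e)
    finally show ?thesis .
  qed
  \<comment> \<open>By the energy this is \<open>1 - (r' t)\<^sup>2\<close>, the factor on the
    right-hand side of the profile equation.\<close>
  define k where "k t = K\<^sup>2 / (x t ^ (d + 1) * (1 - x t))" for t
  have pk: "(p t)\<^sup>2 / (4 * u t) = 1 - k t" for t
  proof -
    have "(p t)\<^sup>2 / 4 = u t - K\<^sup>2 / x t ^ d"
      using level[of "e * t + t0"] by (simp add: radial_level_def x_def p_def u_def)
    then have "(p t)\<^sup>2 / (4 * u t) = (u t - K\<^sup>2 / x t ^ d) / u t"
      by (simp only: divide_divide_eq_left[symmetric])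
    then show ?thesis using x[of t] u[of t] by (simp add: k_def u_def field_simps)
  qed
  have ode: "r'' t * sin (r t) * cos (r t) =
      (1 - (r' t)\<^sup>2) * (real (d + 1) * (cos (r t))\<^sup>2 - (sin (r t))\<^sup>2)" for t
  proof -
    have "r'' t * sin (r t) * cos (r t) = r'' t * sqrt (u t)" by (simp only: mult.assoc sc)
    also have "\<dots> = radial_force d K (x t) / 2 - (p t)\<^sup>2 / (4 * u t) * (1 - 2 * x t)"
      using u[of t] by (simp add: r''_def field_simps)
    also have "\<dots> = real d * K\<^sup>2 / x t ^ (d + 1) + (1 - 2 * x t) * k t"
      unfolding pk radial_force_def by (simp add: algebra_simps add_divide_distrib diff_divide_distrib)
    also have "K\<^sup>2 / x t ^ (d + 1) = k t * (1 - x t)" using x[of t] by (simp add: k_def)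
    then have "real d * K\<^sup>2 / x t ^ (d + 1) = real d * (k t * (1 - x t))"
      by (simp only: times_divide_eq_right[symmetric])
    also have "real d * (k t * (1 - x t)) + (1 - 2 * x t) * k t = k t * (real (d + 1) * (1 - x t) - x t)"
      by (simp add: algebra_simps)
    also have "k t = 1 - (r' t)\<^sup>2"
    proof -
      have "(r' t)\<^sup>2 = (e * e) * (p t)\<^sup>2 / (4 * u t)"
        using u[of t] by (simp add: r'_def power_divide power_mult_distrib power2_eq_square[of e])
      then show ?thesis using pk[of t] by (simp add: e)
    qed
    finally show ?thesis using x[of t] by (simp add: sin_r cos_r)
  qed
  have init: "r' 0 = 0" using t0 by (simp add: r'_def p_def)
  show thesis
  proof (rule that)
    show "profile (d + 1) (r 0) r r' r''"
      by unfold_locales (use dr dr' ode init in auto)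
    show "(sin (r t))\<^sup>2 = X (e * t + t0)" for t using x[of t] by (simp add: sin_r x_def)
    show s: "sin (r t) > 0" for t using x[of t] by (simp add: sin_r)
    show "r 0 > 0"
      using x[of 0] arcsin_less_arcsin[of 0 "sqrt (x 0)"] by (simp add: r_def x_def)
    show "r' t * sin (r t) * cos (r t) = e * P (e * t + t0) / 2" for t
      using u[of t] by (simp only: mult.assoc sc) (simp add: r'_def p_def)
    \<comment> \<open>At the turning point the kinetic term vanishes, so the energy identifies
      \<open>K\<^sup>2\<close> with the square of the first integral of the profile.\<close>
    have "k 0 = 1" using pk[of 0] t0 by (simp add: p_def)
    then have "x 0 ^ (d + 1) * (1 - x 0) = K\<^sup>2" using x[of 0] by (simp add: k_def field_simps)
    moreover have "(first_integral_const (d + 1) (r 0))\<^sup>2 = x 0 ^ (d + 1) * (1 - x 0)"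
    proof -
      have "(sqrt (x 0) ^ (d + 1))\<^sup>2 = ((sqrt (x 0))\<^sup>2) ^ (d + 1)"
        by (simp only: power_mult[symmetric] mult.commute)
      also have "\<dots> = x 0 ^ (d + 1)" using x[of 0] by simp
      finally show ?thesis
        using x[of 0] unfolding first_integral_const_def sin_r cos_r power_mult_distrib by simp
    qed
    moreover have "first_integral_const (d + 1) (r 0) \<ge> 0"
      using x[of 0] unfolding first_integral_const_def sin_r cos_r by simp
    ultimately show "first_integral_const (d + 1) (r 0) = \<bar>K\<bar>"
      by (metis abs_of_nonneg real_sqrt_abs)
  qed
qed

section \<open>The classification of minimal curves\<close>

lemma vector_derivative_zero_imp_constant:
  fixes f :: "real \<Rightarrow> 'a::real_normed_vector"
  assumes "open I" "is_interval I" "\<And>s. s \<in> I \<Longrightarrow> (f has_vector_derivative 0) (at s)"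
    "s \<in> I" "t \<in> I"
  shows "f s = f t"
proof -
  have "convex I" using assms(2) by (rule is_interval_convex)
  then have "\<exists>c. \<forall>x\<in>I. f x = c"
    by (rule has_derivative_zero_constant)
      (use assms(3) in \<open>auto simp: has_vector_derivative_def intro: has_derivative_at_withinI\<close>)
  then show ?thesis using assms(4,5) by auto
qed

lemma proportional_of_log_derivative:
  fixes f g a :: "real \<Rightarrow> complex"
  assumes I: "open I" "is_interval I" "s0 \<in> I"
    and f: "\<And>s. s \<in> I \<Longrightarrow> (f has_vector_derivative f s * a s) (at s)"
    and g: "\<And>s. s \<in> I \<Longrightarrow> (g has_vector_derivative g s * a s) (at s)"
    and nz: "\<And>s. s \<in> I \<Longrightarrow> g s \<noteq> 0"
  obtains c where "\<And>s. s \<in> I \<Longrightarrow> f s = c * g s"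
proof -
  have d: "((\<lambda>s. f s / g s) has_vector_derivative 0) (at s)" if "s \<in> I" for s
  proof -
    have "((\<lambda>s. inverse (g s)) has_vector_derivative (g s * a s) * (- (inverse (g s) * inverse (g s)))) (at s)"
      using field_vector_diff_chain_at[OF g[OF that] DERIV_inverse[OF nz[OF that]]]
      by (simp add: o_def power2_eq_square)
    from has_vector_derivative_mult[OF f[OF that] this]
    show ?thesis using nz[OF that] by (simp add: divide_inverse mult_ac)
  qed
  have "f s = (f s0 / g s0) * g s" if s: "s \<in> I" for s
  proof -
    have "f s / g s = f s0 / g s0"
      by (rule vector_derivative_zero_imp_constant[OF I(1,2) d s I(3)])
    then have "f s / g s * g s = (f s0 / g s0) * g s" by (rule arg_cong)
    then show ?thesis using nz[OF s] by simp
  qed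
  then show thesis using that by blast
qed

lemma Re_mult_cnj_self: "Re (z * cnj z) = (cmod z)\<^sup>2"
  unfolding cmod_power2 by (simp add: power2_eq_square)

lemma cmod_has_real_derivative:
  assumes f: "(f has_vector_derivative f') (at s)" and nz: "f s \<noteq> 0"
  shows "((\<lambda>s. cmod (f s)) has_real_derivative Re (f' * cnj (f s)) / cmod (f s)) (at s)"
proof -
  have "((\<lambda>s. Re (f s * cnj (f s))) has_vector_derivative Re (f s * cnj f' + f' * cnj (f s))) (at s)"
    by (intro bounded_linear.has_vector_derivative[OF bounded_linear_Re] has_vector_derivative_mult
        bounded_linear.has_vector_derivative[OF bounded_linear_cnj] f)
  then have d: "((\<lambda>s. (cmod (f s))\<^sup>2) has_real_derivative 2 * Re (f' * cnj (f s))) (at s)"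
    unfolding Re_mult_cnj_self has_real_derivative_iff_has_vector_derivative by (simp add: mult.commute)
  have "((\<lambda>s. sqrt ((cmod (f s))\<^sup>2)) has_real_derivative
      inverse (sqrt ((cmod (f s))\<^sup>2)) / 2 * (2 * Re (f' * cnj (f s)))) (at s)"
    by (rule DERIV_chain2[OF DERIV_real_sqrt d]) (use nz in simp)
  then have "((\<lambda>s. cmod (f s)) has_real_derivative
      inverse (cmod (f s)) / 2 * (2 * Re (f' * cnj (f s)))) (at s)"
    by (simp only: real_sqrt_abs abs_norm_cancel)
  then show ?thesis by (rule DERIV_cong) (simp only: divide_inverse mult.commute, simp)
qed

lemma smooth_on_cmod:
  assumes "open S" "smooth_on S f" "\<And>x. x \<in> S \<Longrightarrow> f x \<noteq> 0"
  shows "smooth_on S (\<lambda>x. cmod (f x))"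
proof -
  have "smooth_on S (\<lambda>x. Re (f x * cnj (f x)))"
    by (intro smooth_on_linear_compose[OF bounded_linear_Re] smooth_on_mult
        smooth_on_linear_compose[OF bounded_linear_cnj] assms)
  then have "smooth_on S (\<lambda>x. sqrt ((cmod (f x))\<^sup>2))"
    unfolding Re_mult_cnj_self by (rule smooth_on_sqrt[OF assms(1)]) (use assms(3) in simp)
  then show ?thesis by simp
qed

text \<open>The function and its modulus have the same real logarithmic derivative, hence they are
  proportional.\<close>

lemma constant_direction:
  fixes f :: "real \<Rightarrow> complex"
  assumes I: "open I" "is_interval I" "s0 \<in> I"
    and f: "\<And>s. s \<in> I \<Longrightarrow> (f has_vector_derivative f s * of_real (q s)) (at s)"
    and nz: "\<And>s. s \<in> I \<Longrightarrow> f s \<noteq> 0"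
  obtains c where "cmod c = 1" "\<And>s. s \<in> I \<Longrightarrow> f s = c * of_real (cmod (f s))"
proof -
  have "((\<lambda>s. complex_of_real (cmod (f s))) has_vector_derivative of_real (cmod (f s)) * of_real (q s)) (at s)"
    if "s \<in> I" for s
  proof -
    have "Re (f s * of_real (q s) * cnj (f s)) / cmod (f s) = cmod (f s) * q s"
    proof -
      have "f s * of_real (q s) * cnj (f s) = of_real ((cmod (f s))\<^sup>2 * q s)"
        by (simp add: of_real_cmod_square mult_ac)
      then show ?thesis using nz[OF that] by (simp only: Re_complex_of_real) (simp add: power2_eq_square)
    qed
    then show ?thesis
      using has_vector_derivative_of_real'[OF cmod_has_real_derivative[OF f[OF that] nz[OF that]]] by simp
  qed
  from proportional_of_log_derivative[OF I f this]
  obtain c where c: "\<And>s. s \<in> I \<Longrightarrow> f s = c * of_real (cmod (f s))" using nz by auto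
  have "cmod (f s0) = cmod c * cmod (f s0)" using arg_cong[OF c[OF I(3)], of cmod] by (simp add: norm_mult)
  then have "cmod c = 1" using nz[OF I(3)] by simp
  then show thesis using that c by blast
qed

lemma has_vector_derivative_cpower:
  fixes g :: "real \<Rightarrow> complex"
  assumes "(g has_vector_derivative v) (at s)"
  shows "((\<lambda>s. g s ^ Suc m) has_vector_derivative of_nat (Suc m) * g s ^ m * v) (at s)"
proof -
  have "((\<lambda>z. z ^ Suc m) has_field_derivative of_nat (Suc m) * g s ^ m) (at (g s))"
    using DERIV_power[OF DERIV_ident, of "Suc m" "g s"] by simp
  from field_vector_diff_chain_at[OF assms this] show ?thesis by (simp add: o_def mult_ac)
qed

lemma congruent_on_proportional:
  fixes \<psi> :: "'p \<Rightarrow> complex^('m::finite)"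
  assumes "cmod c1 = 1" "cmod c2 = 1"
    and "\<And>s. s \<in> I \<Longrightarrow> g1 s = c1 * e1 (h s)" "\<And>s. s \<in> I \<Longrightarrow> g2 s = c2 * e2 (h s)"
    and "smooth_on I h" "\<And>s. s \<in> I \<Longrightarrow> deriv h s \<noteq> 0" "h ` I \<subseteq> J"
  shows "congruent_on I J (curve_map g1 g2 \<psi>) (curve_map e1 e2 \<psi>)"
proof -
  obtain T :: "(complex^('m option)) set \<Rightarrow> (complex^('m option)) set" where T: "holomorphic_isometry T"
    "\<And>z c. T (hopf (join z c)) = hopf (join (c1 *s z) (c2 * c))"
    using diagonal_isometry[OF assms(1,2)] by blast
  have "\<forall>s\<in>I. \<forall>x. curve_map g1 g2 \<psi> (s, x) = T (curve_map e1 e2 \<psi> (h s, x))"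
    using assms(3,4) by (simp add: curve_map_def T(2))
  then show ?thesis unfolding congruent_on_def using T(1) assms(5-7) by blast
qed

section \<open>Invariants of a minimal Legendre curve and its congruence with an example\<close>

locale minimal_legendre = regular_legendre I g1 g2 v1 v2 w1 w2 for I g1 g2 v1 v2 w1 w2 +
  fixes d :: nat and s0 :: real
  assumes s0: "s0 \<in> I"
    and g1_nz: "s \<in> I \<Longrightarrow> g1 s \<noteq> 0"
    and minimal: "s \<in> I \<Longrightarrow> curve_minimal (real d) (g1 s) (v1 s) (v2 s) (w1 s) (w2 s)"
begin

definition lam :: "real \<Rightarrow> complex" where "lam s = g1 s * v2 s - g2 s * v1 s"
definition l :: "real \<Rightarrow> real" where "l s = cmod (lam s)"
definition R :: "real \<Rightarrow> real" where "R s = cmod (g1 s)"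

lemma algebra:
  assumes "s \<in> I"
  shows "v1 s = - lam s * cnj (g2 s)" "v2 s = lam s * cnj (g1 s)"
    "(cmod (v1 s))\<^sup>2 + (cmod (v2 s))\<^sup>2 = (l s)\<^sup>2"
  using legendre_algebra[OF unit[OF assms] legendre[OF assms]] by (simp_all add: lam_def l_def)

lemma lam_nz: "s \<in> I \<Longrightarrow> lam s \<noteq> 0"
  using algebra(1,2)[of s] regular[of s] by auto

lemma l_pos: "s \<in> I \<Longrightarrow> l s > 0" and R_pos: "s \<in> I \<Longrightarrow> R s > 0"
  using lam_nz g1_nz by (simp_all add: l_def R_def)

lemma smooth_l: "smooth_on I l"
  unfolding l_def[abs_def] lam_def
  by (intro smooth_on_cmod smooth_on_diff smooth_on_mult open_I smooth_g smooth_v)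
    (use lam_nz in \<open>simp add: lam_def\<close>)

lemma lam_deriv:
  assumes s: "s \<in> I"
  shows "(lam has_vector_derivative g1 s * w2 s - g2 s * w1 s) (at s)"
proof -
  have "(lam has_vector_derivative (g1 s * w2 s + v1 s * v2 s) - (g2 s * w1 s + v2 s * v1 s)) (at s)"
    unfolding lam_def[abs_def]
    by (intro has_vector_derivative_diff has_vector_derivative_mult v w s)
  then show ?thesis by (simp add: mult.commute)
qed

lemma R_square: "complex_of_real ((R s)\<^sup>2) = g1 s * cnj (g1 s)"
  by (simp add: R_def of_real_cmod_square)

lemma g2_square: "s \<in> I \<Longrightarrow> g2 s * cnj (g2 s) = of_real (1 - (R s)\<^sup>2)"
  using unit[of s] by (simp add: R_square[symmetric] algebra_simps del: of_real_power)

text \<open>Up to a positive factor and the contribution of \<open>\<psi>\<close>, \<open>lam * g1 ^ d\<close> is the complex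
  determinant of the lift and its derivatives, whose argument is the Lagrangian angle.\<close>

lemma constant_angle:
  obtains c where "cmod c = 1" "\<And>s. s \<in> I \<Longrightarrow> lam s * g1 s ^ d = c * of_real (l s * R s ^ d)"
proof -
  define q where "q s = (g1 s * w2 s - g2 s * w1 s) / lam s + of_nat d * (v1 s / g1 s)" for s
  have q: "q s = of_real (Re (q s))" if "s \<in> I" for s
  proof -
    have "Im (q s) = 0"
      using minimal[OF that] unfolding curve_minimal_iff[OF unit[OF that] legendre[OF that]]
      by (simp add: q_def lam_def)
    then show ?thesis by (intro complex_eqI) auto
  qed
  have pw: "((\<lambda>s. g1 s ^ d) has_vector_derivative g1 s ^ d * (of_nat d * (v1 s / g1 s))) (at s)" if "s \<in> I" for s
  proof (cases d)
    case (Suc m)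
    show ?thesis
      unfolding Suc using has_vector_derivative_cpower[OF v(1)[OF that], of m] g1_nz[OF that]
      by (simp add: mult_ac)
  qed (simp add: has_vector_derivative_const)
  have "((\<lambda>s. lam s * g1 s ^ d) has_vector_derivative (lam s * g1 s ^ d) * of_real (Re (q s))) (at s)"
    if "s \<in> I" for s
  proof -
    define a where "a = (g1 s * w2 s - g2 s * w1 s) / lam s"
    have N: "g1 s * w2 s - g2 s * w1 s = lam s * a" using lam_nz[OF that] by (simp add: a_def)
    have "q s = a + of_nat d * (v1 s / g1 s)" by (simp add: q_def a_def)
    then show ?thesis
      using has_vector_derivative_mult[OF lam_deriv[OF that] pw[OF that]]
      unfolding q[OF that, symmetric] N by (simp add: algebra_simps)
  qed
  from constant_direction[OF open_I interval s0 this]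
  obtain c where "cmod c = 1" "\<And>s. s \<in> I \<Longrightarrow> lam s * g1 s ^ d = c * of_real (cmod (lam s * g1 s ^ d))"
    using lam_nz g1_nz by auto
  then show thesis
    using that[of c] by (simp add: l_def R_def norm_mult norm_power)
qed

text \<open>Chosen once, so that the constants and invariants of the locale can refer to it.\<close>

definition c :: complex
  where "c = (SOME c. cmod c = 1 \<and> (\<forall>s\<in>I. lam s * g1 s ^ d = c * of_real (l s * R s ^ d)))"

lemma c: "cmod c = 1" "s \<in> I \<Longrightarrow> lam s * g1 s ^ d = c * of_real (l s * R s ^ d)"
proof -
  have "\<exists>c. cmod c = 1 \<and> (\<forall>s\<in>I. lam s * g1 s ^ d = c * of_real (l s * R s ^ d))"
    using constant_angle by metis
  from someI_ex[OF this, folded c_def]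
  show "cmod c = 1" "s \<in> I \<Longrightarrow> lam s * g1 s ^ d = c * of_real (l s * R s ^ d)" by auto
qed

lemma cc: "cnj c * c = 1"
  using c(1) complex_norm_square[of c] by (simp add: mult.commute)

lemma lam_eq:
  assumes "s \<in> I"
  shows "lam s = c * cnj (g1 s) ^ d * of_real (l s / R s ^ d)"
proof -
  have RR: "g1 s ^ d * cnj (g1 s) ^ d = of_real (R s ^ d * R s ^ d)"
    by (simp only: power_mult_distrib[symmetric] R_square[symmetric] of_real_power[symmetric])
      (simp add: power2_eq_square power_mult_distrib)
  have "lam s * of_real (R s ^ d * R s ^ d) = (lam s * g1 s ^ d) * cnj (g1 s) ^ d"
    unfolding RR[symmetric] by (simp add: mult_ac)
  also have "\<dots> = c * cnj (g1 s) ^ d * of_real (l s / R s ^ d) * of_real (R s ^ d * R s ^ d)"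
    unfolding c(2)[OF assms] using R_pos[OF assms] by (simp add: field_simps)
  finally have eq: "lam s * of_real (R s ^ d * R s ^ d) =
    c * cnj (g1 s) ^ d * of_real (l s / R s ^ d) * of_real (R s ^ d * R s ^ d)" .
  have nz: "complex_of_real (R s ^ d * R s ^ d) \<noteq> 0" using R_pos[OF assms] by simp
  show ?thesis by (rule mult_right_cancel[OF nz, THEN iffD1, OF eq])
qed

definition Z :: "real \<Rightarrow> complex" where "Z s = cnj c * g1 s ^ Suc d * g2 s"
definition K :: real where "K = Im (Z s0)"

text \<open>The velocity formulas make the derivative of \<open>Z\<close> equal to
  \<open>cnj c * (lam * g1 ^ d)\<close> times a real factor, and the constant angle makes that real.
  Hence the imaginary part of \<open>Z\<close> is conserved.\<close>

lemma Z_deriv: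
  assumes s: "s \<in> I"
  shows "(Z has_vector_derivative of_real (l s * R s ^ d * ((R s)\<^sup>2 - real (d + 1) * (1 - (R s)\<^sup>2)))) (at s)"
proof -
  have "(Z has_vector_derivative cnj c * (g1 s ^ Suc d * v2 s + (of_nat (Suc d) * g1 s ^ d * v1 s) * g2 s)) (at s)"
    unfolding Z_def[abs_def] mult.assoc[of "cnj c"]
    by (intro has_vector_derivative_mult_right has_vector_derivative_mult has_vector_derivative_cpower v s)
  also have "cnj c * (g1 s ^ Suc d * v2 s + (of_nat (Suc d) * g1 s ^ d * v1 s) * g2 s)
    = cnj c * (lam s * g1 s ^ d) * (g1 s * cnj (g1 s) - of_nat (Suc d) * (g2 s * cnj (g2 s)))"
    unfolding algebra(1,2)[OF s] by (simp add: algebra_simps)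
  also have "\<dots> = (cnj c * c) * of_real (l s * R s ^ d) * (of_real ((R s)\<^sup>2) - of_nat (Suc d) * of_real (1 - (R s)\<^sup>2))"
    unfolding c(2)[OF s] g2_square[OF s] R_square by simp
  also have "\<dots> = of_real (l s * R s ^ d * ((R s)\<^sup>2 - real (d + 1) * (1 - (R s)\<^sup>2)))"
    by (simp add: cc)
  finally show ?thesis .
qed

lemma Im_Z: "s \<in> I \<Longrightarrow> Im (Z s) = K"
proof -
  assume s: "s \<in> I"
  have "((\<lambda>s. Im (Z s)) has_vector_derivative 0) (at s)" if "s \<in> I" for s
    using bounded_linear.has_vector_derivative[OF bounded_linear_Im Z_deriv[OF that]] by simp
  then show ?thesis
    unfolding K_def
    using vector_derivative_zero_imp_constant[OF open_I interval, of "\<lambda>s. Im (Z s)"] s s0 by blast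
qed

lemma Z_norm:
  assumes s: "s \<in> I"
  shows "(Re (Z s))\<^sup>2 + K\<^sup>2 = ((R s)\<^sup>2) ^ (d + 1) * (1 - (R s)\<^sup>2)"
proof -
  have "complex_of_real ((cmod (Z s))\<^sup>2) = (cnj c * c) * (g1 s * cnj (g1 s)) ^ (d + 1) * (g2 s * cnj (g2 s))"
    by (simp add: of_real_cmod_square Z_def power_mult_distrib mult_ac)
  also have "\<dots> = of_real (((R s)\<^sup>2) ^ (d + 1) * (1 - (R s)\<^sup>2))"
    unfolding cc g2_square[OF s] R_square[symmetric] by simp
  finally show ?thesis
    unfolding Im_Z[OF s, symmetric] cmod_power2[symmetric] by (simp only: of_real_eq_iff)
qed

text \<open>The real part of \<open>Z\<close> thus governs the radial velocity and its imaginary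
  part \<open>K\<close> the angular velocity of the first component.\<close>

lemma v1_g1:
  assumes s: "s \<in> I"
  shows "v1 s * cnj (g1 s) = - of_real (l s / R s ^ d) * cnj (Z s)"
  unfolding algebra(1)[OF s] lam_eq[OF s] by (simp add: Z_def mult_ac)

text \<open>The position and velocity of the radial motion; \<open>p\<close> is the derivative of
  \<open>x\<close> with respect to arc length, not with respect to \<open>s\<close>.\<close>

definition x :: "real \<Rightarrow> real" where "x s = (R s)\<^sup>2"
definition p :: "real \<Rightarrow> real" where "p s = - 2 * Re (Z s) / R s ^ d"

lemma x_deriv:
  assumes s: "s \<in> I"
  shows "(x has_real_derivative l s * p s) (at s)"
  unfolding x_def[abs_def] R_def[abs_def]
  by (rule DERIV_cong[OF g1_norm_derivative[OF s]]) (simp add: v1_g1[OF s] p_def)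

lemma R_deriv:
  assumes s: "s \<in> I"
  shows "(R has_real_derivative - l s * Re (Z s) / R s ^ Suc d) (at s)"
proof -
  have "(R has_real_derivative Re (v1 s * cnj (g1 s)) / R s) (at s)"
    unfolding R_def[abs_def] by (rule cmod_has_real_derivative[OF v(1)[OF s] g1_nz[OF s]])
  then show ?thesis by (simp add: v1_g1[OF s] mult.commute)
qed

lemma p_level:
  assumes s: "s \<in> I"
  shows "radial_level d K (x s) (p s)"
proof -
  have "(p s)\<^sup>2 / 4 = (Re (Z s))\<^sup>2 / x s ^ d"
    by (simp add: p_def x_def power_divide power_mult_distrib power_mult[symmetric] mult.commute)
  also have "(Re (Z s))\<^sup>2 = x s ^ (d + 1) * (1 - x s) - K\<^sup>2"
    using Z_norm[OF s] by (simp add: x_def)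
  finally show ?thesis
    using R_pos[OF s] by (simp add: radial_level_def x_def diff_divide_distrib)
qed

lemma p_deriv:
  assumes s: "s \<in> I"
  shows "(p has_real_derivative l s * radial_force d K (x s)) (at s)"
proof -
  let ?Y = "Re (Z s)" and ?F = "(R s)\<^sup>2 - real (d + 1) * (1 - (R s)\<^sup>2)"
  have R: "R s > 0" by (rule R_pos[OF s])
  have Y: "((\<lambda>s. Re (Z s)) has_real_derivative l s * R s ^ d * ?F) (at s)"
    using bounded_linear.has_vector_derivative[OF bounded_linear_Re Z_deriv[OF s]]
    by (simp add: has_real_derivative_iff_has_vector_derivative)
  have "((\<lambda>s. - 2 * Re (Z s) / R s ^ d) has_real_derivative
      ((- 2 * (l s * R s ^ d * ?F)) * R s ^ d
        - (- 2 * ?Y) * (of_nat d * ((- l s * ?Y / R s ^ Suc d) * R s ^ (d - Suc 0))))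
       / (R s ^ d * R s ^ d)) (at s)"
    using R by (intro DERIV_divide DERIV_cmult Y DERIV_power R_deriv s) auto
  also have "((- 2 * (l s * R s ^ d * ?F)) * R s ^ d
        - (- 2 * ?Y) * (of_nat d * ((- l s * ?Y / R s ^ Suc d) * R s ^ (d - Suc 0))))
       / (R s ^ d * R s ^ d) = l s * (- 2 * ?F - 2 * real d * (?Y\<^sup>2 / x s ^ (d + 1)))"
  proof -
    have xR: "x s ^ (d + 1) = R s ^ Suc d * R s ^ Suc d"
      by (simp add: x_def power_mult_distrib[symmetric] power2_eq_square)
    \<comment> \<open>The truncated exponent at \<open>d = 0\<close> does no harm, because of the
      factor \<open>d\<close>.\<close>
    have "real d * R s ^ (d - Suc 0) * R s = real d * R s ^ d" by (cases d) auto
    then have "real d * R s ^ (d - Suc 0) = real d * R s ^ d / R s" using R by (simp add: field_simps)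
    moreover have "(- 2 * ?Y) * (of_nat d * ((- l s * ?Y / R s ^ Suc d) * R s ^ (d - Suc 0)))
      = 2 * l s * ?Y\<^sup>2 / R s ^ Suc d * (real d * R s ^ (d - Suc 0))"
      by (simp add: power2_eq_square mult_ac del: power_Suc)
    ultimately have "(- 2 * ?Y) * (of_nat d * ((- l s * ?Y / R s ^ Suc d) * R s ^ (d - Suc 0)))
      = 2 * l s * ?Y\<^sup>2 / R s ^ Suc d * (real d * R s ^ d / R s)" by metis
    also have "\<dots> = 2 * l s * real d * (?Y\<^sup>2 / x s ^ (d + 1)) * (R s ^ d * R s ^ d)"
      unfolding xR using R by (simp add: field_simps)
    finally show ?thesis
      using R by (simp add: diff_divide_distrib) (simp add: algebra_simps)
  qed
  also have "?Y\<^sup>2 / x s ^ (d + 1) = (1 - x s) - K\<^sup>2 / x s ^ (d + 1)"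
  proof -
    have "?Y\<^sup>2 = x s ^ (d + 1) * (1 - x s) - K\<^sup>2" using Z_norm[OF s] by (simp add: x_def)
    then show ?thesis using R by (simp add: x_def diff_divide_distrib)
  qed
  also have "l s * (- 2 * ?F - 2 * real d * ((1 - x s) - K\<^sup>2 / x s ^ (d + 1))) = l s * radial_force d K (x s)"
    unfolding x_def[symmetric] radial_force_def by (simp add: algebra_simps)
  finally show ?thesis by (simp add: p_def[abs_def])
qed

definition \<sigma> :: "real \<Rightarrow> real" where "\<sigma> s = (LBINT t=ereal s0..ereal s. l t)"

lemma \<sigma>_deriv: "s \<in> I \<Longrightarrow> (\<sigma> has_real_derivative l s) (at s)"
  unfolding \<sigma>_def[abs_def] has_real_derivative_iff_has_vector_derivative
  by (rule interval_integral_has_vector_derivative[OF open_I interval smooth_on_continuous[OF smooth_l] s0])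

lemma smooth_\<sigma>: "smooth_on I \<sigma>"
  by (rule smooth_on_real_curve[OF open_I \<sigma>_deriv[unfolded has_real_derivative_iff_has_vector_derivative] smooth_l])

text \<open>The squared radius is the global radial solution at arc length \<open>\<sigma>\<close>.
  The parameter \<open>h\<close> shifts the turning point to 0 and may reverse the direction. Then
  both components have the logarithmic derivatives of the example composed with \<open>h\<close>, so
  they agree with it up to constant phases.\<close>

theorem congruent_to_example_a:
  fixes \<psi> :: "'p \<Rightarrow> complex^('m::finite)"
  assumes K: "K \<noteq> 0"
  shows "\<exists>\<rho> r. \<rho> > 0 \<and> profile_solution (d + 1) \<rho> r \<and>
    congruent_on I UNIV (curve_map g1 g2 \<psi>) (example_a (d + 1) \<rho> r \<psi>)"
proof -
  obtain X P where dX: "\<And>t. (X has_real_derivative P t) (at t)"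
    and dP: "\<And>t. (P has_real_derivative radial_force d K (X t)) (at t)"
    and level: "\<And>t. radial_level d K (X t) (P t)"
    and uniq: "\<And>I' s0' s \<sigma> l y q. is_interval I' \<Longrightarrow> s0' \<in> I' \<Longrightarrow> s \<in> I' \<Longrightarrow>
      (\<And>s. s \<in> I' \<Longrightarrow> (\<sigma> has_real_derivative l s) (at s) \<and> l s \<ge> 0 \<and> radial_level d K (y s) (q s) \<and>
        (y has_real_derivative l s * q s) (at s) \<and>
        (q has_real_derivative l s * radial_force d K (y s)) (at s)) \<Longrightarrow>
      \<sigma> s0' = 0 \<Longrightarrow> y s0' = x s0 \<Longrightarrow> q s0' = p s0 \<Longrightarrow> y s = X (\<sigma> s)"
    using radial_solution_exists[OF K p_level[OF s0]] by metis
  have "\<sigma> s0 = 0" by (simp add: \<sigma>_def)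
  then have xX: "x s = X (\<sigma> s)" if "s \<in> I" for s
    using uniq[OF interval s0 that, of \<sigma> l x p] \<sigma>_deriv l_pos p_level x_deriv p_deriv
    by (simp add: less_imp_le)
  have pP: "p s = P (\<sigma> s)" if s: "s \<in> I" for s
  proof -
    have "((\<lambda>s. X (\<sigma> s)) has_real_derivative P (\<sigma> s) * l s) (at s)"
      by (rule DERIV_chain2[OF dX \<sigma>_deriv[OF s]])
    then have "(x has_real_derivative P (\<sigma> s) * l s) (at s)"
      by (rule has_field_derivative_transform_within_open[OF _ open_I s]) (simp add: xX)
    from DERIV_unique[OF this x_deriv[OF s]] show ?thesis using l_pos[OF s] by simp
  qed
  obtain t0 where t0: "P t0 = 0"
    using radial_turning_point[OF dX dP] level by (auto simp: radial_level_def)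
  \<comment> \<open>The first phase of the example decreases, as its \<open>\<kappa>\<close> is
    \<open>\<bar>K\<bar> > 0\<close>, whereas the first component of the curve rotates with the sign
    of \<open>K\<close>; hence the minus sign.\<close>
  define e where "e = - sgn K"
  have e: "e * e = 1" "e * \<bar>K\<bar> = - K" using K by (auto simp: e_def sgn_if)
  define r where "r t = arcsin (sqrt (X (e * t + t0)))" for t
  obtain r' r'' where prof: "profile (d + 1) (r 0) r r' r''"
    and sin_r: "\<And>t. (sin (r t))\<^sup>2 = X (e * t + t0)" "\<And>t. sin (r t) > 0" and pos: "r 0 > 0"
    and r': "\<And>t. r' t * sin (r t) * cos (r t) = e * P (e * t + t0) / 2"
    and \<kappa>: "first_integral_const (d + 1) (r 0) = \<bar>K\<bar>"
    using radial_profile[OF dX dP level K t0 e(1), folded r_def] by metis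
  interpret P: profile "d + 1" "r 0" r r' r'' by (rule prof)
  define h where "h s = e * (\<sigma> s - t0)" for s
  have eh: "e * h s + t0 = \<sigma> s" for s using e(1) by (simp add: h_def mult.assoc[symmetric])
  have sin_h: "(sin (r (h s)))\<^sup>2 = x s" "sin (r (h s)) = R s" if "s \<in> I" for s
  proof -
    show 1: "(sin (r (h s)))\<^sup>2 = x s" using sin_r(1)[of "h s"] xX[OF that] by (simp add: eh)
    then show "sin (r (h s)) = R s"
      using sin_r(2)[of "h s"] R_pos[OF that] by (simp add: x_def power2_eq_iff_nonneg)
  qed
  have cos_h: "of_real ((cos (r (h s)))\<^sup>2) = g2 s * cnj (g2 s)" if "s \<in> I" for s
    unfolding g2_square[OF that] using sin_h(1)[OF that] by (simp add: cos_squared_eq x_def)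
  have dh: "(h has_real_derivative e * l s) (at s)" if "s \<in> I" for s
    unfolding h_def[abs_def] using \<sigma>_deriv[OF that] by (auto intro!: derivative_eq_intros)
  \<comment> \<open>The real parts agree by the radial motion, the imaginary parts by
    \<open>K\<close> and the choice of \<open>e\<close>. The second component then follows from the
    Legendre condition.\<close>
  have logA: "v1 s * cnj (g1 s) = of_real (e * l s) * (of_real (x s) * P.A (h s))" if s: "s \<in> I" for s
  proof (rule complex_eqI)
    have "Re (of_real (x s) * P.A (h s)) = r' (h s) * sin (r (h s)) * cos (r (h s))"
      unfolding sin_h(1)[OF s, symmetric] Re_of_real_mult P.A_def complex.sel using P.sin_nz[of "h s"]
      by (simp add: power2_eq_square)
    then have "Re (of_real (e * l s) * (of_real (x s) * P.A (h s))) = (e * e) * (l s * P (\<sigma> s) / 2)"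
      unfolding Re_of_real_mult[of "e * l s"] r' by (simp add: eh)
    then show "Re (v1 s * cnj (g1 s)) = Re (of_real (e * l s) * (of_real (x s) * P.A (h s)))"
      unfolding e(1) pP[OF s, symmetric] v1_g1[OF s] by (simp add: p_def)
    have "Im (of_real (x s) * P.A (h s)) = - \<bar>K\<bar> / R s ^ d"
      unfolding Im_of_real_mult P.A_def complex.sel P.a_def sin_h(2)[OF s] P.\<kappa>_def \<kappa>
      using R_pos[OF s] by (simp add: x_def power2_eq_square)
    then have "Im (of_real (e * l s) * (of_real (x s) * P.A (h s))) = - (e * \<bar>K\<bar>) * (l s / R s ^ d)"
      unfolding Im_of_real_mult[of "e * l s"] by simp
    then show "Im (v1 s * cnj (g1 s)) = Im (of_real (e * l s) * (of_real (x s) * P.A (h s)))"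
      unfolding e(2) v1_g1[OF s] by (simp add: Im_Z[OF s])
  qed
  have v1: "v1 s = g1 s * (of_real (e * l s) * P.A (h s))" if s: "s \<in> I" for s
  proof -
    have "v1 s * of_real (x s) = (v1 s * cnj (g1 s)) * g1 s"
      by (simp add: x_def R_square mult_ac del: of_real_power)
    also have "\<dots> = (g1 s * (of_real (e * l s) * P.A (h s))) * of_real (x s)"
      unfolding logA[OF s] by (simp add: mult_ac)
    finally show ?thesis using R_pos[OF s] by (simp add: x_def)
  qed
  have v2: "v2 s = g2 s * (of_real (e * l s) * P.B (h s))" if s: "s \<in> I" for s
  proof -
    have AB: "of_real (x s) * P.A (h s) = - (of_real ((cos (r (h s)))\<^sup>2) * P.B (h s))"
      unfolding sin_h(1)[OF s, symmetric] using P.A_B_orthogonal[of "h s"]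
      by (simp only: eq_neg_iff_add_eq_0)
    have "v2 s * cnj (g2 s) = - (v1 s * cnj (g1 s))"
      using legendre[OF s] by (simp add: eq_neg_iff_add_eq_0 add.commute)
    also have "\<dots> = of_real (e * l s) * P.B (h s) * (g2 s * cnj (g2 s))"
      unfolding logA[OF s] AB cos_h[OF s] by simp
    finally have "v2 s * cnj (g2 s) = (g2 s * (of_real (e * l s) * P.B (h s))) * cnj (g2 s)"
      by (simp add: mult_ac)
    moreover have "g2 s \<noteq> 0" using cos_h[OF s] P.cos_nz[of "h s"] by auto
    ultimately show ?thesis by simp
  qed
  have comp: "((\<lambda>s. E (h s)) has_vector_derivative E (h s) * (of_real (e * l s) * D (h s))) (at s)"
    if s: "s \<in> I" and E: "\<And>t. (E has_vector_derivative E t * D t) (at t)" for E D :: "real \<Rightarrow> complex" and s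
    using vector_diff_chain_at[OF _ E, of h "e * l s" s] dh[OF s]
    by (simp add: has_real_derivative_iff_has_vector_derivative o_def scaleR_conv_of_real mult_ac)
  obtain c1 where c1: "\<And>s. s \<in> I \<Longrightarrow> g1 s = c1 * P.e1 (h s)"
    by (rule proportional_of_log_derivative[OF open_I interval s0, of g1 "\<lambda>s. of_real (e * l s) * P.A (h s)"
          "\<lambda>s. P.e1 (h s)"])
      (use v(1) v1 comp[OF _ P.e1_deriv] P.e_nz in auto)
  obtain c2 where c2: "\<And>s. s \<in> I \<Longrightarrow> g2 s = c2 * P.e2 (h s)"
    by (rule proportional_of_log_derivative[OF open_I interval s0, of g2 "\<lambda>s. of_real (e * l s) * P.B (h s)"
          "\<lambda>s. P.e2 (h s)"])
      (use v(2) v2 comp[OF _ P.e2_deriv] P.e_nz in auto)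
  have "cmod c1 = 1"
    using arg_cong[OF c1[OF s0], of cmod] sin_h(2)[OF s0] R_pos[OF s0]
    unfolding norm_mult P.norm_e R_def by simp
  moreover have "cmod c2 = 1"
  proof -
    have "(cmod (g2 s0))\<^sup>2 = (cos (r (h s0)))\<^sup>2"
      using cos_h[OF s0] unfolding complex_norm_square[symmetric] by (simp only: of_real_eq_iff)
    then have "cmod (g2 s0) = \<bar>cos (r (h s0))\<bar>" by (metis abs_norm_cancel real_sqrt_abs)
    then show ?thesis
      using arg_cong[OF c2[OF s0], of cmod] P.cos_nz[of "h s0"] unfolding norm_mult P.norm_e by simp
  qed
  moreover have "smooth_on I h"
    unfolding h_def[abs_def]
    by (intro smooth_on_mult smooth_on_diff smooth_on_const smooth_\<sigma> open_I)
  moreover have "deriv h s \<noteq> 0" if "s \<in> I" for s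
    using DERIV_imp_deriv[OF dh[OF that]] l_pos[OF that] e(1) by auto
  ultimately have "congruent_on I UNIV (curve_map g1 g2 \<psi>) (curve_map P.e1 P.e2 \<psi>)"
    using c1 c2 by (intro congruent_on_proportional[of c1 c2]) auto
  moreover have "profile_solution (d + 1) (r 0) r"
    unfolding profile_solution_def using P.r P.r' P.ode P.init by blast
  ultimately show ?thesis using pos P.example_a_eq by metis
qed

text \<open>With \<open>K = 0\<close> the first component keeps its argument, and so does the
  determinant \<open>lam\<close>. After removal of constant phases the curve is a real unit vector
  \<open>(R, G)\<close> that rotates with speed \<open>l\<close>.\<close>

theorem congruent_to_example_b:
  fixes \<psi> :: "'p \<Rightarrow> complex^('m::finite)"
  assumes K: "K = 0"
  defines "J \<equiv> if \<forall>s\<in>I. g2 s \<noteq> 0 then {0<..<pi/2} else {0<..<pi}"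
  shows "congruent_on I J (curve_map g1 g2 \<psi>) (example_b \<psi>)"
proof -
  have v1: "v1 s = g1 s * of_real (Re (v1 s * cnj (g1 s)) / x s)" if s: "s \<in> I" for s
  proof -
    have "Im (v1 s * cnj (g1 s)) = 0" by (simp add: v1_g1[OF s] Im_Z[OF s] K)
    then have "v1 s * cnj (g1 s) = of_real (Re (v1 s * cnj (g1 s)))" by (intro complex_eqI) auto
    then have "v1 s * cnj (g1 s) * g1 s = g1 s * of_real (Re (v1 s * cnj (g1 s)))" by (metis mult.commute)
    moreover have "v1 s * cnj (g1 s) * g1 s = v1 s * of_real (x s)"
      by (simp add: x_def R_square mult_ac del: of_real_power)
    ultimately show ?thesis using R_pos[OF s] by (simp add: x_def field_simps)
  qed
  obtain c1 where c1: "cmod c1 = 1" "\<And>s. s \<in> I \<Longrightarrow> g1 s = c1 * of_real (R s)"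
    by (rule constant_direction[OF open_I interval s0, of g1 "\<lambda>s. Re (v1 s * cnj (g1 s)) / x s"])
      (use v(1) v1 g1_nz in \<open>auto simp: R_def\<close>)
  have cc1: "cnj c1 * c1 = 1" using c1(1) complex_norm_square[of c1] by (simp add: mult.commute)
  \<comment> \<open>The phase of \<open>v2 = lam * cnj g1\<close>: \<open>lam\<close> contributes
    \<open>c * cnj c1 ^ d\<close> and \<open>cnj g1\<close> one more factor
    \<open>cnj c1\<close>.\<close>
  define c2 where "c2 = c * cnj c1 ^ Suc d"
  have c2: "cmod c2 = 1" by (simp add: c2_def norm_mult norm_power c(1) c1(1))
  then have cc2: "cnj c2 * c2 = 1" using complex_norm_square[of c2] by (simp add: mult.commute)
  have lam: "lam s = c * cnj c1 ^ d * of_real (l s)" if "s \<in> I" for s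
    unfolding lam_eq[OF that] using R_pos[OF that] by (subst c1(2)[OF that]) (simp add: power_mult_distrib)
  define G where "G s = Re (cnj c2 * g2 s)" for s
  \<comment> \<open>The derivative of the real function \<open>R\<close> is real, and it is a
    positive multiple of \<open>- cnj (cnj c2 * g2)\<close>. This makes \<open>cnj c2 * g2\<close>
    real without dividing by \<open>g2\<close>, which may vanish.\<close>
  have dR: "(R has_vector_derivative Re (- of_real (l s) * cnj (cnj c2 * g2 s))) (at s)"
    and G_real: "cnj c2 * g2 s = of_real (G s)" if s: "s \<in> I" for s
  proof -
    have "((\<lambda>s. cnj c1 * g1 s) has_vector_derivative cnj c1 * v1 s) (at s)"
      by (intro has_vector_derivative_mult_right v s)
    moreover have "cnj c1 * v1 s = - of_real (l s) * cnj (cnj c2 * g2 s)"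
      unfolding algebra(1)[OF s] lam[OF s] c2_def by (simp add: mult_ac)
    ultimately have "((\<lambda>s. cnj c1 * g1 s) has_vector_derivative - of_real (l s) * cnj (cnj c2 * g2 s)) (at s)"
      by simp
    then have d: "((\<lambda>s. complex_of_real (R s)) has_vector_derivative - of_real (l s) * cnj (cnj c2 * g2 s)) (at s)"
      by (rule has_vector_derivative_transform_within_open[OF _ open_I s])
        (use c1(2) cc1 in \<open>simp add: mult.assoc[symmetric]\<close>)
    show "(R has_vector_derivative Re (- of_real (l s) * cnj (cnj c2 * g2 s))) (at s)"
      using bounded_linear.has_vector_derivative[OF bounded_linear_Re d] by simp
    have "((\<lambda>s. 0::real) has_vector_derivative Im (- of_real (l s) * cnj (cnj c2 * g2 s))) (at s)"
      using bounded_linear.has_vector_derivative[OF bounded_linear_Im d] by simp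
    from vector_derivative_unique_at[OF this has_vector_derivative_const]
    have "l s * Im (cnj c2 * g2 s) = 0" by (simp add: algebra_simps)
    then show "cnj c2 * g2 s = of_real (G s)"
      using l_pos[OF s] by (intro complex_eqI) (auto simp: G_def)
  qed
  have g2: "g2 s = c2 * of_real (G s)" if "s \<in> I" for s
    unfolding G_real[OF that, symmetric] using cc2 by (simp add: mult.assoc[symmetric] mult.commute)
  have dR': "(R has_real_derivative - l s * G s) (at s)" if "s \<in> I" for s
    using dR[OF that] unfolding G_real[OF that] has_real_derivative_iff_has_vector_derivative by simp
  have dG: "(G has_real_derivative l s * R s) (at s)" if s: "s \<in> I" for s
  proof -
    have "((\<lambda>s. Re (cnj c2 * g2 s)) has_vector_derivative Re (cnj c2 * v2 s)) (at s)"
      by (intro bounded_linear.has_vector_derivative[OF bounded_linear_Re] has_vector_derivative_mult_right v s)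
    moreover have "v2 s = c2 * of_real (l s * R s)"
      unfolding algebra(2)[OF s] lam[OF s] c2_def by (subst c1(2)[OF s]) (simp add: mult_ac)
    then have "cnj c2 * v2 s = of_real (l s * R s)"
      using cc2 by (simp add: mult.assoc[symmetric])
    ultimately show ?thesis
      by (simp add: has_real_derivative_iff_has_vector_derivative G_def[abs_def])
  qed
  have RG: "(R s)\<^sup>2 + (G s)\<^sup>2 = 1" if "s \<in> I" for s
  proof -
    have "complex_of_real ((G s)\<^sup>2) = (cnj c2 * c2) * (g2 s * cnj (g2 s))"
      unfolding of_real_cmod_square[symmetric] cc2 g2[OF that]
      using c2 by (simp add: norm_mult flip: of_real_power)
    then have "(G s)\<^sup>2 = 1 - (R s)\<^sup>2"
      unfolding cc2 g2_square[OF that] mult_1 by (simp only: of_real_eq_iff)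
    then show ?thesis by simp
  qed
  obtain \<theta> where \<theta>: "0 \<le> \<theta>" "\<theta> < 2 * pi" "G s0 = cos \<theta>" "R s0 = sin \<theta>"
    using sincos_total_2pi[of "G s0" "R s0"] RG[OF s0] by (auto simp: add.commute)
  define h where "h s = \<theta> - \<sigma> s" for s
  have rot: "Complex (G s) (R s) = cis (h s)" if s: "s \<in> I" for s
  proof -
    \<comment> \<open>The pair satisfies \<open>G' = l * R\<close> and \<open>R' = - l * G\<close>;
      rotating back by the arc length makes it constant.\<close>
    let ?W = "\<lambda>s. Complex (G s) (R s) * cis (\<sigma> s)"
    have "(?W has_vector_derivative 0) (at s)" if "s \<in> I" for s
    proof -
      have "(?W has_vector_derivative Complex (G s) (R s) * (cis (\<sigma> s) * (\<i> * of_real (l s)))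
          + Complex (l s * R s) (- l s * G s) * cis (\<sigma> s)) (at s)"
        unfolding Complex_eq
        by (intro has_vector_derivative_mult has_vector_derivative_cis \<sigma>_deriv
            has_vector_derivative_add has_vector_derivative_mult_right has_vector_derivative_of_real'
            dG dR' that)
      moreover have "Complex (G s) (R s) * (cis (\<sigma> s) * (\<i> * of_real (l s)))
          + Complex (l s * R s) (- l s * G s) * cis (\<sigma> s)
          = cis (\<sigma> s) * (Complex (G s) (R s) * (\<i> * of_real (l s)) + Complex (l s * R s) (- l s * G s))"
        by (simp add: algebra_simps)
      moreover have "Complex (G s) (R s) * (\<i> * of_real (l s)) + Complex (l s * R s) (- l s * G s) = 0"
        by (simp add: complex_eq_iff)
      ultimately show ?thesis by simp
    qed
    from vector_derivative_zero_imp_constant[OF open_I interval this s s0]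
    have "Complex (G s) (R s) * cis (\<sigma> s) = Complex (G s0) (R s0)" by (simp add: \<sigma>_def)
    also have "\<dots> = cis \<theta>" by (simp add: \<theta> cis.ctr)
    finally have "Complex (G s) (R s) * cis (\<sigma> s) * cis (- \<sigma> s) = cis \<theta> * cis (- \<sigma> s)" by simp
    then show ?thesis by (simp add: mult.assoc cis_mult h_def)
  qed
  have GR: "G s = cos (h s)" "R s = sin (h s)" if "s \<in> I" for s
    using rot[OF that] by (simp_all add: complex_eq_iff)
  have dh: "(h has_real_derivative - l s) (at s)" if "s \<in> I" for s
    unfolding h_def[abs_def] using \<sigma>_deriv[OF that] by (auto intro!: derivative_eq_intros)
  have "continuous_on I h"
    by (intro continuous_at_imp_continuous_on ballI DERIV_isCont[OF dh])
  then have conn: "connected (h ` I)"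
    using interval by (intro connected_continuous_image) (auto simp: is_interval_connected)
  have sin_pos: "sin (h s) > 0" if "s \<in> I" for s using GR(2)[OF that] R_pos[OF that] by simp
  have h0: "0 < h s0" "h s0 < pi"
  proof -
    have "h s0 = \<theta>" by (simp add: h_def \<sigma>_def)
    moreover have "sin \<theta> > 0" using sin_pos[OF s0] calculation by simp
    moreover have "\<theta> < pi"
    proof (rule ccontr)
      assume "\<not> \<theta> < pi"
      then have "sin \<theta> \<le> 0" using \<theta>(2) by (intro sin_le_zero) auto
      then show False using \<open>sin \<theta> > 0\<close> by simp
    qed
    moreover have "\<theta> \<noteq> 0" using \<open>sin \<theta> > 0\<close> by auto
    ultimately show "0 < h s0" "h s0 < pi" using \<theta>(1) by auto
  qed
  \<comment> \<open>By connectedness the angle stays on one side of any value that it omits.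
    Positivity of the radius excludes 0 and \<open>pi\<close>, and \<open>pi / 2\<close> is excluded
    when \<open>g2\<close> has no zero.\<close>
  have avoid: "(\<forall>s\<in>I. h s < a) \<or> (\<forall>s\<in>I. a < h s)" if a: "\<And>s. s \<in> I \<Longrightarrow> h s \<noteq> a" for a
  proof (rule ccontr)
    assume "\<not> ?thesis"
    then obtain t1 t2 where "t1 \<in> I" "t2 \<in> I" "a \<le> h t1" "h t2 \<le> a" by (meson not_le)
    then have "a \<in> h ` I" using connectedD_interval[OF conn, of "h t2" "h t1" a] by auto
    then show False using a by auto
  qed
  have "h s \<noteq> 0" "h s \<noteq> pi" if "s \<in> I" for s using sin_pos[OF that] by auto
  then have hpi: "0 < h s" "h s < pi" if "s \<in> I" for s
    using avoid[of 0] avoid[of pi] h0 s0 that by (auto dest: order.strict_trans bspec[OF _ s0])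
  have smooth_h: "smooth_on I h"
    unfolding h_def[abs_def] by (intro smooth_on_diff smooth_on_const smooth_\<sigma> open_I)
  have deriv_h: "deriv h s \<noteq> 0" if "s \<in> I" for s
    using DERIV_imp_deriv[OF dh[OF that]] l_pos[OF that] by simp
  have g1h: "g1 s = c1 * of_real (sin (h s))" and g2h: "g2 s = c2 * of_real (cos (h s))" if "s \<in> I" for s
    using c1(2)[OF that] g2[OF that] GR[OF that] by simp_all
  have direct: "congruent_on I J (curve_map g1 g2 \<psi>) (example_b \<psi>)" if "h ` I \<subseteq> J"
    unfolding example_b_def
    by (rule congruent_on_proportional[of c1 c2 I g1 "\<lambda>s. complex_of_real (sin s)" h g2
          "\<lambda>s. complex_of_real (cos s)", OF c1(1) c2 g1h g2h smooth_h deriv_h that])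
  show ?thesis
  proof (cases "\<forall>s\<in>I. g2 s \<noteq> 0")
    case False
    then have "J = {0<..<pi}" by (simp only: J_def if_False)
    then show ?thesis using hpi by (intro direct) auto
  next
    case True
    then have J: "J = {0<..<pi/2}" by (simp add: J_def)
    have "h s \<noteq> pi / 2" if "s \<in> I" for s
    proof
      assume "h s = pi / 2"
      then have "cos (h s) = 0" by (simp only: cos_pi_half)
      then show False using True g2h[OF that] that by simp
    qed
    then consider "\<forall>s\<in>I. h s < pi / 2" | "\<forall>s\<in>I. pi / 2 < h s" using avoid[of "pi / 2"] by blast
    then show ?thesis
    proof cases
      case 1
      then show ?thesis using hpi by (intro direct) (auto simp: J)
    next
      case 2
      \<comment> \<open>On the far half of the circle the angle is reflected. The sine is unchanged
        and the cosine changes sign, which the phase \<open>- c2\<close> absorbs.\<close>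
      have dk: "((\<lambda>s. pi - h s) has_real_derivative l s) (at s)" if "s \<in> I" for s
        using dh[OF that] by (auto intro!: derivative_eq_intros)
      show ?thesis
        unfolding example_b_def
      proof (rule congruent_on_proportional[of c1 "- c2" I g1 "\<lambda>s. complex_of_real (sin s)"
            "\<lambda>s. pi - h s" g2 "\<lambda>s. complex_of_real (cos s)"])
        show "(\<lambda>s. pi - h s) ` I \<subseteq> J" using 2 hpi by (auto simp: J)
        show "smooth_on I (\<lambda>s. pi - h s)" by (intro smooth_on_diff smooth_on_const smooth_h open_I)
        show "deriv (\<lambda>s. pi - h s) s \<noteq> 0" if "s \<in> I" for s
          using DERIV_imp_deriv[OF dk[OF that]] l_pos[OF that] by simp
      qed (use c1(1) c2 g1h g2h in auto)
    qed
  qed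
qed

end

theorem proposition6:
  fixes \<A> :: "('p::{t2_space, second_countable_topology}, real^'d::finite) atlas"
    and \<phi> :: "'p \<Rightarrow> (complex^('d option)) set"
    and \<psi> :: "'p \<Rightarrow> complex^('d option)"
    and n :: nat
  assumes n: "n = CARD('d) + 1"
    and manifold: "smooth_atlas \<A>"
    and simply_conn: "simply_connected (UNIV :: 'p set)"
    and minlag: "minimal_lagrangian_immersion \<A> \<phi>"
    and lift: "horizontal_lift \<A> \<phi> \<psi>"
  shows "(\<forall>\<rho> r. \<rho> > 0 \<and> profile_solution n \<rho> r \<longrightarrow>
            minimal_lagrangian_immersion (prod_atlas UNIV \<A>) (example_a n \<rho> r \<psi>)) \<and>
         minimal_lagrangian_immersion (prod_atlas {0<..<pi/2} \<A>) (example_b \<psi>) \<and>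
         (\<forall>I \<gamma>. open I \<and> is_interval I \<and> I \<noteq> {} \<and> legendre_curve I \<gamma> \<longrightarrow>
            (minimal_lagrangian_immersion (prod_atlas I \<A>)
                (curve_map (\<lambda>s. \<gamma> s $ 1) (\<lambda>s. \<gamma> s $ 2) \<psi>) \<longleftrightarrow>
             (\<exists>\<rho> r. \<rho> > 0 \<and> profile_solution n \<rho> r \<and>
                congruent_on I UNIV (curve_map (\<lambda>s. \<gamma> s $ 1) (\<lambda>s. \<gamma> s $ 2) \<psi>)
                  (example_a n \<rho> r \<psi>)) \<or>
             congruent_on I (interval_b I \<gamma>)
                (curve_map (\<lambda>s. \<gamma> s $ 1) (\<lambda>s. \<gamma> s $ 2) \<psi>) (example_b \<psi>)))"
  proof (intro conjI allI impI)
  have dim: "real DIM(real^'d) = real n - 1" and n_pos: "n > 0" and n': "n = CARD('d) + 1"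
    using n by simp_all
  show "minimal_lagrangian_immersion (prod_atlas UNIV \<A>) (example_a n \<rho> r \<psi>)"
    if \<rho>: "\<rho> > 0 \<and> profile_solution n \<rho> r" for \<rho> r
  proof -
    obtain r' r'' where "profile n \<rho> r r' r''"
      using profile_solutionE[OF conjunct2[OF \<rho>] n_pos] by blast
    then interpret P: profile n \<rho> r r' r'' .
    have reg: "P.e1 s * P.A s \<noteq> 0 \<or> P.e2 s * P.B s \<noteq> 0" for s
      using P.e_nz[of s] P.A_neq_B[of s] by auto
    show ?thesis
      unfolding P.example_a_eq
      by (subst P.minimal_lagrangian_immersion_curve_map_iff[OF manifold minlag lift reg])
        (use P.e_nz P.curve_minimal_e in \<open>auto simp: dim simp del: DIM_cart\<close>)
  qed
  show "minimal_lagrangian_immersion (prod_atlas {0<..<pi/2} \<A>) (example_b \<psi>)"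
  proof -
    interpret B: legendre_pair "{0<..<pi/2}" "\<lambda>s. of_real (sin s)" "\<lambda>s. of_real (cos s)"
      "\<lambda>s. of_real (cos s)" "\<lambda>s. of_real (- sin s)" "\<lambda>s. of_real (- sin s)" "\<lambda>s. of_real (- cos s)"
      by (rule legendre_pair_subset[OF legendre_pair_sin_cos]) auto
    have s: "sin s > 0" if "s \<in> {0<..<pi/2}" for s using that by (intro sin_gt_zero) auto
    have reg: "complex_of_real (cos s) \<noteq> 0 \<or> complex_of_real (- sin s) \<noteq> 0" if "s \<in> {0<..<pi/2}" for s
      using s[OF that] by simp
    \<comment> \<open>All data of this curve are real, so both imaginary parts in
      \<open>curve_minimal\<close> vanish, and the first component \<open>sin s\<close> is positive
      on the interval.\<close>
    show ?thesis
      unfolding example_b_def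
      by (subst B.minimal_lagrangian_immersion_curve_map_iff[OF manifold minlag lift reg])
        (auto simp: curve_minimal_def dest: s)
  qed
  fix I \<gamma> assume I\<gamma>: "open I \<and> is_interval I \<and> I \<noteq> {} \<and> legendre_curve I \<gamma>"
  let ?g = "\<lambda>i s. \<gamma> s $ i"
  let ?v = "\<lambda>i s. D (?g i) s 1"
  let ?w = "\<lambda>i s. D (?v i) s 1"
  interpret L: regular_legendre I "?g 1" "?g 2" "?v 1" "?v 2" "?w 1" "?w 2"
    using legendre_curve_regular[of I \<gamma>] I\<gamma> by blast
  let ?\<Phi> = "curve_map (?g 1) (?g 2) \<psi>"
  note iff = L.minimal_lagrangian_immersion_curve_map_iff[OF manifold minlag lift L.regular, unfolded dim]
  show "minimal_lagrangian_immersion (prod_atlas I \<A>) ?\<Phi> \<longleftrightarrow>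
    (\<exists>\<rho> r. \<rho> > 0 \<and> profile_solution n \<rho> r \<and> congruent_on I UNIV ?\<Phi> (example_a n \<rho> r \<psi>)) \<or>
    congruent_on I (interval_b I \<gamma>) ?\<Phi> (example_b \<psi>)"
  proof
    assume m: "minimal_lagrangian_immersion (prod_atlas I \<A>) ?\<Phi>"
    obtain s0 where s0: "s0 \<in> I" using I\<gamma> by blast
    have d: "real n - 1 = real CARD('d)" using n by simp
    interpret M: minimal_legendre I "?g 1" "?g 2" "?v 1" "?v 2" "?w 1" "?w 2" "CARD('d)" s0
      using iffD1[OF iff m] s0 by unfold_locales (auto simp: d)
    show "(\<exists>\<rho> r. \<rho> > 0 \<and> profile_solution n \<rho> r \<and> congruent_on I UNIV ?\<Phi> (example_a n \<rho> r \<psi>)) \<or>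
      congruent_on I (interval_b I \<gamma>) ?\<Phi> (example_b \<psi>)"
    proof (cases "M.K = 0")
      case True
      then show ?thesis
        using M.congruent_to_example_b[of \<psi>] unfolding interval_b_def by blast
    next
      case False
      then show ?thesis using M.congruent_to_example_a[of \<psi>] unfolding n' by blast
    qed
  next
    assume "(\<exists>\<rho> r. \<rho> > 0 \<and> profile_solution n \<rho> r \<and> congruent_on I UNIV ?\<Phi> (example_a n \<rho> r \<psi>)) \<or>
      congruent_on I (interval_b I \<gamma>) ?\<Phi> (example_b \<psi>)"
    then show "minimal_lagrangian_immersion (prod_atlas I \<A>) ?\<Phi>"
    proof
      assume "\<exists>\<rho> r. \<rho> > 0 \<and> profile_solution n \<rho> r \<and> congruent_on I UNIV ?\<Phi> (example_a n \<rho> r \<psi>)"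
      then obtain \<rho> r where prof: "profile_solution n \<rho> r"
        and cong: "congruent_on I UNIV ?\<Phi> (example_a n \<rho> r \<psi>)" by blast
      obtain r' r'' where P: "profile n \<rho> r r' r''" using profile_solutionE[OF prof n_pos] by blast
      interpret P: profile n \<rho> r r' r'' by (rule P)
      obtain h where h: "smooth_on I h" "\<And>s. s \<in> I \<Longrightarrow> deriv h s \<noteq> 0"
        and radius: "\<And>s. s \<in> I \<Longrightarrow> cmod (?g 1 s) = cmod (P.e1 (h s))"
        and speed: "\<And>s. s \<in> I \<Longrightarrow> (cmod (?v 1 s))\<^sup>2 + (cmod (?v 2 s))\<^sup>2 =
          (deriv h s)\<^sup>2 * ((cmod (P.e1 (h s) * P.A (h s)))\<^sup>2 + (cmod (P.e2 (h s) * P.B (h s)))\<^sup>2)"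
        using congruent_speed[OF manifold minlag lift L.legendre_pair_axioms P.legendre_pair_axioms
            cong[unfolded P.example_a_eq]] by metis
      obtain h'' where h': "\<And>s. s \<in> I \<Longrightarrow> (h has_real_derivative deriv h s) (at s)"
        "\<And>s. s \<in> I \<Longrightarrow> (deriv h has_real_derivative h'' s) (at s)"
        using smooth_on_deriv[OF L.open_I h(1)] by blast
      have radius': "(cmod (?g 1 s))\<^sup>2 = (sin (r (h s)))\<^sup>2" if "s \<in> I" for s
        unfolding radius[OF that] P.norm_e(1) by simp
      have speed': "(cmod (?v 1 s))\<^sup>2 + (cmod (?v 2 s))\<^sup>2 = (deriv h s)\<^sup>2" if "s \<in> I" for s
        unfolding speed[OF that] P.unit_speed_e by simp
      show ?thesis
        by (rule iffD2[OF iff]; (intro ballI conjI L.curve_minimal_profile[OF P h' h(2) radius' speed'])?)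
    next
      assume "congruent_on I (interval_b I \<gamma>) ?\<Phi> (example_b \<psi>)"
      from congruent_speed[OF manifold minlag lift L.legendre_pair_axioms legendre_pair_sin_cos
          this[unfolded example_b_def]]
      obtain h where h: "smooth_on I h" "h ` I \<subseteq> interval_b I \<gamma>"
        and radius: "\<And>s. s \<in> I \<Longrightarrow> cmod (?g 1 s) = cmod (complex_of_real (sin (h s)))"
        and speed: "\<And>s. s \<in> I \<Longrightarrow> (cmod (?v 1 s))\<^sup>2 + (cmod (?v 2 s))\<^sup>2 =
          (deriv h s)\<^sup>2 * ((cmod (complex_of_real (cos (h s))))\<^sup>2 + (cmod (complex_of_real (- sin (h s))))\<^sup>2)"
        by metis
      \<comment> \<open>In both cases of \<open>interval_b\<close> the sine is positive, which is
        all that the converse needs to know about the interval.\<close>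
      have "interval_b I \<gamma> \<subseteq> {0<..<pi}" using pi_gt_zero by (auto simp: interval_b_def)
      then have "h s \<in> {0<..<pi}" if "s \<in> I" for s using h(2) that by blast
      then have pos: "sin (h s) > 0" if "s \<in> I" for s using that by (simp add: sin_gt_zero)
      have radius': "cmod (?g 1 s) = sin (h s)" if "s \<in> I" for s
        using radius[OF that] pos[OF that] by simp
      have speed': "(cmod (?v 1 s))\<^sup>2 + (cmod (?v 2 s))\<^sup>2 = (deriv h s)\<^sup>2" if "s \<in> I" for s
        unfolding speed[OF that] by simp
      obtain h'' where h': "\<And>s. s \<in> I \<Longrightarrow> (h has_real_derivative deriv h s) (at s)"
        using smooth_on_deriv[OF L.open_I h(1)] by blast
      show ?thesis
        by (rule iffD2[OF iff]; (intro ballI conjI L.curve_minimal_great_circle[OF h' pos radius' speed'])?)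
    qed
  qed
qed

end
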